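(* Let $\nu>0$ and let $v\in L^{2}_{\mathrm{loc}}(\mathbb R^{3},\mathbb R^{3})$ be a vector field and $p$ a scalar distribution on $\mathbb R^{3}$ such that, in the sense of distributions, $$-\nu\Delta v+\sum_{1\le j\le 3}\partial_{j}(v_{j}v)+\nabla p=0,\qquad \operatorname{div} v=0 .$$ Assume moreover that $v\in\mathscr S'(\mathbb R^{3},\mathbb R^{3})$, that for every $s>0$ the set $\{x\in\mathbb R^{3}: |v(x)|>s\}$ has finite Lebesgue measure, and that $\operatorname{curl} v\in L^{2}(\mathbb R^{3},\mathbb R^{3})$. Let $Q=p+\frac12|v|^{2}$ and assume that $\nabla Q$ belongs to $L^{6/5}(\mathbb R^{3})$. Then $v$ is identically $0$.
   Context: $Q$ is called the Bernoulli head pressure. *)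

theory Defs
  imports "HOL-Analysis.Analysis"
begin

definition partial :: "3 \<Rightarrow> (real^3 \<Rightarrow> real) \<Rightarrow> real^3 \<Rightarrow> real" where
  "partial i f x = frechet_derivative f (at x) (axis i 1)"

text \<open>Multi-indices are rendered as lists of coordinate directions, so that the derivatives of
  order at most \<open>N\<close> are those along the finitely many lists of length at most \<open>N\<close>.\<close>

definition partials :: "3 list \<Rightarrow> (real^3 \<Rightarrow> real) \<Rightarrow> real^3 \<Rightarrow> real" where
  "partials is f = foldr partial is f"

text \<open>Differentiability of every iterated partial derivative makes all of them continuous, so this
  is the usual class of infinitely differentiable functions; it also ensures that
  \<^const>\<open>partial\<close> is only ever applied to differentiable functions.\<close>

definition smooth :: "(real^3 \<Rightarrow> real) \<Rightarrow> bool" where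
  "smooth f \<longleftrightarrow> (\<forall>is. partials is f differentiable_on UNIV)"

definition supp :: "(real^3 \<Rightarrow> real) \<Rightarrow> (real^3) set" where
  "supp f = closure (support_on UNIV f)"

definition test_functions :: "(real^3 \<Rightarrow> real) set" where
  "test_functions = {\<phi>. smooth \<phi> \<and> compact (supp \<phi>)}"

definition schwartz_functions :: "(real^3 \<Rightarrow> real) set" where
  "schwartz_functions =
     {\<phi>. smooth \<phi> \<and> (\<forall>k is. bounded (range (\<lambda>x. (1 + norm x) ^ k * partials is \<phi> x)))}"

text \<open>A distribution is a functional whose values matter only on test functions; equalities between
  distributions are therefore always stated on \<^const>\<open>test_functions\<close>.\<close>

type_synonym functional = "(real^3 \<Rightarrow> real) \<Rightarrow> real"

definition linear_functional_on :: "(real^3 \<Rightarrow> real) set \<Rightarrow> functional \<Rightarrow> bool" where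
  "linear_functional_on S T \<longleftrightarrow>
     (\<forall>\<phi>\<in>S. \<forall>\<psi>\<in>S. \<forall>a b. T (\<lambda>x. a * \<phi> x + b * \<psi> x) = a * T \<phi> + b * T \<psi>)"

text \<open>Continuity is expressed through the seminorms defining the topologies of the spaces of test
  functions (supported in a fixed compact set) and of Schwartz functions.  The suprema are finite on the respective spaces.\<close>

definition distribution :: "functional \<Rightarrow> bool" where
  "distribution T \<longleftrightarrow> linear_functional_on test_functions T \<and>
     (\<forall>K. compact K \<longrightarrow> (\<exists>C N. \<forall>\<phi>\<in>test_functions. supp \<phi> \<subseteq> K \<longrightarrow>
        \<bar>T \<phi>\<bar> \<le> C * (\<Sum>is\<in>{is. length is \<le> N}. SUP x. \<bar>partials is \<phi> x\<bar>)))"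

definition tempered_distribution :: "functional \<Rightarrow> bool" where
  "tempered_distribution T \<longleftrightarrow> linear_functional_on schwartz_functions T \<and>
     (\<exists>C N. \<forall>\<phi>\<in>schwartz_functions.
        \<bar>T \<phi>\<bar> \<le> C * (\<Sum>is\<in>{is. length is \<le> N}. SUP x. (1 + norm x) ^ N * \<bar>partials is \<phi> x\<bar>))"

definition is_tempered :: "functional \<Rightarrow> bool" where
  "is_tempered T \<longleftrightarrow> (\<exists>U. tempered_distribution U \<and> (\<forall>\<phi>\<in>test_functions. U \<phi> = T \<phi>))"

definition dist_of :: "(real^3 \<Rightarrow> real) \<Rightarrow> functional" where
  "dist_of f \<phi> = (\<integral>x. f x * \<phi> x \<partial>lebesgue)"

definition vdist_of :: "(real^3 \<Rightarrow> real^3) \<Rightarrow> functional^3" where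
  "vdist_of f = (\<chi> i. dist_of (\<lambda>x. f x $ i))"

definition dist_partial :: "3 \<Rightarrow> functional \<Rightarrow> functional" where
  "dist_partial i T \<phi> = - T (partial i \<phi>)"

definition dist_laplacian :: "functional \<Rightarrow> functional" where
  "dist_laplacian T \<phi> = (\<Sum>j\<in>UNIV. dist_partial j (dist_partial j T) \<phi>)"

definition dist_grad :: "functional \<Rightarrow> functional^3" where
  "dist_grad T = (\<chi> i. dist_partial i T)"

definition dist_div :: "functional^3 \<Rightarrow> functional" where
  "dist_div V \<phi> = (\<Sum>j\<in>UNIV. dist_partial j (V $ j) \<phi>)"

definition dist_curl :: "functional^3 \<Rightarrow> functional^3" where
  "dist_curl V = (\<chi> i. (\<lambda>\<phi>.
     if i = 1 then dist_partial 2 (V $ 3) \<phi> - dist_partial 3 (V $ 2) \<phi>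
     else if i = 2 then dist_partial 3 (V $ 1) \<phi> - dist_partial 1 (V $ 3) \<phi>
     else dist_partial 1 (V $ 2) \<phi> - dist_partial 2 (V $ 1) \<phi>))"

definition in_Lp :: "real \<Rightarrow> (real^3 \<Rightarrow> real^3) \<Rightarrow> bool" where
  "in_Lp q f \<longleftrightarrow> f \<in> borel_measurable lebesgue \<and> integrable lebesgue (\<lambda>x. norm (f x) powr q)"

definition in_Lp_loc :: "real \<Rightarrow> (real^3 \<Rightarrow> real^3) \<Rightarrow> bool" where
  "in_Lp_loc q f \<longleftrightarrow> f \<in> borel_measurable lebesgue \<and>
     (\<forall>K. compact K \<longrightarrow> set_integrable lebesgue K (\<lambda>x. norm (f x) powr q))"

definition vdist_in_Lp :: "real \<Rightarrow> functional^3 \<Rightarrow> bool" where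
  "vdist_in_Lp q V \<longleftrightarrow>
     (\<exists>f. in_Lp q f \<and> (\<forall>i. \<forall>\<phi>\<in>test_functions. (V $ i) \<phi> = (vdist_of f $ i) \<phi>))"

definition stationary_navier_stokes ::
    "real \<Rightarrow> (real^3 \<Rightarrow> real^3) \<Rightarrow> functional \<Rightarrow> bool" where
  "stationary_navier_stokes \<nu> v p \<longleftrightarrow>
     (\<forall>i. \<forall>\<phi>\<in>test_functions.
        - \<nu> * dist_laplacian (vdist_of v $ i) \<phi>
        + (\<Sum>j\<in>UNIV. dist_partial j (dist_of (\<lambda>x. v x $ j * v x $ i)) \<phi>)
        + (dist_grad p $ i) \<phi> = 0) \<and>
     (\<forall>\<phi>\<in>test_functions. dist_div (vdist_of v) \<phi> = 0)"

definition bernoulli_head_pressure :: "(real^3 \<Rightarrow> real^3) \<Rightarrow> functional \<Rightarrow> functional" where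
  "bernoulli_head_pressure v p \<phi> = p \<phi> + dist_of (\<lambda>x. 1/2 * (norm (v x))\<^sup>2) \<phi>"

end

theory Submission
  imports Defs
begin

text \<open>Write \<open>W\<^bsub>ji\<^esub> = \<partial>\<^sub>j v\<^sub>i - \<partial>\<^sub>i v\<^sub>j\<close> for the vorticity and let \<open>V t\<close> be the average of \<open>v\<close> at scale
  \<open>1/t\<close> against a radial bump \<open>phi\<close> with \<open>\<nabla> psi(x) = - phi(x) x\<close>.  The Laplacian of
  \<open>\<integral>\<^sub>a\<^sup>b psi(tx) dt\<close> is the difference of the two averaging kernels, so \<open>V a - V b\<close> is controlled by
  averages of \<open>W\<close> weighted with \<open>dt/t\<^sup>2\<close>, without any singular kernel.  Temperedness makes \<open>V 1\<close>
  grow polynomially, and since its level sets have finite measure each averaging step lowers the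
  exponent, so \<open>V 1\<close> is bounded and \<open>V t\<close> tends to \<open>0\<close> as \<open>t\<close> tends to \<open>0\<close>.  Hence \<open>v\<close> is recovered from \<open>W\<close>,
  which gives \<open>v \<in> L\<^sup>6\<close> by a Marcinkiewicz argument, and a bound \<open>O(R\<^sup>2)\<close> for the integral of
  \<open>|v|\<^sup>2\<close> over the ball of radius \<open>R\<close>.

  The momentum equation reads \<open>\<nu> curl curl v + curl v \<times> v + \<nabla>Q = 0\<close>.  It is tested against a cutoff
  times \<open>V t\<close>, then \<open>t\<close> and the radius of the cutoff tend to infinity.  The cubic term vanishes by
  antisymmetry, the boundary terms of the viscous part by the bound on balls.  For the term with \<open>\<nabla>Q\<close>, the
  homotopy operator of the Poincare lemma writes \<open>V t\<close> as the divergence of an antisymmetric tensor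
  that is bounded in \<open>L\<^sup>6\<close> after division by \<open>|x|\<close>; as \<open>\<nabla>Q\<close> is curl-free, only an
  \<open>L\<^bsup>6/5\<^esup>\<close> tail of \<open>\<nabla>Q\<close> survives.  So \<open>W = 0\<close>, and then \<open>v = 0\<close>.\<close>

subsection \<open>Smooth functions\<close>

text \<open>Curl and divergence determine \<open>v\<close> only up to the gradient of a harmonic
  function. Finite level sets exclude it: a set of finite measure fills only a fraction O(r^-3) of a
  ball of radius r, which beats polynomial growth step by step. The integral of
  \<open>psi (t x)\<close> is a truncation of a multiple of the Newtonian potential 1/|x|; its
  gradient is dominated by a truncated Riesz kernel of size 1/|x|^2, which maps L^2 to L^6. The
  exponent 6 is dual to 6/5, so \<open>\<nabla>Q\<close> can be paired with the tensor. Testing with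
  a smooth \<open>V t\<close> instead of \<open>v\<close> spoils the exact cancellation in the cubic
  term. The error carries the factor \<open>V t - v\<close>, small in L^2 and bounded in L^6,
  against \<open>W\<close> in L^2; this is the second use of L^6. The limits are taken in the order:
  mollification at a fixed cutoff, cutoff radius R, and last the parameter l of Young's inequality.
  The growth R^2 of the local energy exactly cancels the squared gradient R^-2 of the cutoff, so
  smallness comes from the tails and from l, not from a power of R.\<close>

lemma partials_Nil [simp]: "partials [] f = f"
  and partials_Cons [simp]: "partials (i # is) f = partial i (partials is f)"
  and partials_snoc: "partials (is @ [i]) f = partials is (partial i f)"
  by (simp_all add: partials_def)

lemma partial_eqI: "(f has_derivative f') (at x) \<Longrightarrow> partial i f x = f' (axis i 1)"
  unfolding partial_def using frechet_derivative_at by metis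

lemma partial_has_derivative:
  assumes "f differentiable at x"
  shows "(f has_derivative (\<lambda>h. \<Sum>i\<in>UNIV. h $ i * partial i f x)) (at x)"
proof -
  obtain D where D: "(f has_derivative D) (at x)"
    using assms by (auto simp: differentiable_def)
  interpret D: bounded_linear D
    using D by (rule has_derivative_bounded_linear)
  have "D h = (\<Sum>i\<in>UNIV. h $ i * partial i f x)" for h
  proof -
    have "D h = D (\<Sum>i\<in>UNIV. h $ i *\<^sub>R axis i 1)"
      using basis_expansion[of h] by (simp add: scalar_mult_eq_scaleR)
    also have "\<dots> = (\<Sum>i\<in>UNIV. h $ i * D (axis i 1))"
      by (simp add: D.sum D.scaleR)
    finally show ?thesis
      using D by (simp add: partial_eqI)
  qed
  then show ?thesis
    using D by (metis (no_types, lifting) ext)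
qed

text \<open>A family of differentiable functions that \<open>partial\<close> maps into itself
  contains every iterated derivative of its members. Exhibiting such a family replaces an induction
  over direction lists.\<close>

lemma smooth_coinduct:
  assumes "f \<in> S"
    and diff: "\<And>f x. f \<in> S \<Longrightarrow> f differentiable at x"
    and part: "\<And>f i. f \<in> S \<Longrightarrow> partial i f \<in> S"
  shows "smooth f"
proof -
  have "partials is f \<in> S" for "is"
    by (induction "is") (auto simp: assms)
  then show ?thesis
    using diff by (auto simp: smooth_def differentiable_on_def differentiable_at_withinI)
qed

lemma smooth_partials: "smooth f \<Longrightarrow> smooth (partials is f)"
  unfolding smooth_def by (metis comp_apply foldr_append partials_def)

lemma smooth_partial: "smooth f \<Longrightarrow> smooth (partial i f)"
  using smooth_partials[of f "[i]"] by simp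

lemma smooth_differentiable: "smooth f \<Longrightarrow> f differentiable at x"
  unfolding smooth_def differentiable_on_def by (metis UNIV_I partials_Nil)

lemmas smooth_has_derivative = partial_has_derivative[OF smooth_differentiable]

lemma smooth_continuous: "smooth f \<Longrightarrow> continuous_on A f"
  by (simp add: continuous_at_imp_continuous_on differentiable_imp_continuous_within smooth_differentiable)

lemma smooth_borel: "smooth f \<Longrightarrow> f \<in> borel_measurable borel"
  by (intro borel_measurable_continuous_onI smooth_continuous)

lemma partial_add:
  assumes "f differentiable at x" "g differentiable at x"
  shows "partial i (\<lambda>x. f x + g x) x = partial i f x + partial i g x"
  using partial_eqI[OF has_derivative_add[OF assms[THEN partial_has_derivative]], of i]
  by (simp add: axis_def if_distrib[of "\<lambda>u. u * _"] cong: if_cong)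

lemma partial_mult:
  assumes "f differentiable at x" "g differentiable at x"
  shows "partial i (\<lambda>x. f x * g x) x = f x * partial i g x + partial i f x * g x"
  using partial_eqI[OF has_derivative_mult[OF assms[THEN partial_has_derivative]], of i]
  by (simp add: axis_def if_distrib[of "\<lambda>u. u * _"] cong: if_cong)

lemma partial_const [simp]: "partial i (\<lambda>x. c) x = 0"
  using partial_eqI[OF has_derivative_const] .

lemma smooth_const [simp]: "smooth (\<lambda>x. c)"
proof (rule smooth_coinduct[of _ "{\<lambda>x. c | c. True}"])
  show "partial i f \<in> {\<lambda>x. c | c. True}" if "f \<in> {\<lambda>x. c | c. True}" for f :: "real^3 \<Rightarrow> real" and i
  proof -
    from that obtain c where "f = (\<lambda>x. c)" by blast
    then have "partial i f = (\<lambda>x. 0)" by (metis ext partial_const)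
    then show ?thesis by blast
  qed
qed auto

lemma partial_nth: "partial i (\<lambda>x. x $ j) x = (if i = j then 1 else 0)"
  using partial_eqI[OF bounded_linear_imp_has_derivative[OF bounded_linear_vec_nth], of i j]
  by (simp add: axis_def)

inductive_set smooth_alg :: "(real^3 \<Rightarrow> real) set \<Rightarrow> (real^3 \<Rightarrow> real) set" for S where
  base: "f \<in> S \<Longrightarrow> f \<in> smooth_alg S"
| smooth: "smooth f \<Longrightarrow> f \<in> smooth_alg S"
| add: "f \<in> smooth_alg S \<Longrightarrow> g \<in> smooth_alg S \<Longrightarrow> (\<lambda>x. f x + g x) \<in> smooth_alg S"
| mult: "f \<in> smooth_alg S \<Longrightarrow> g \<in> smooth_alg S \<Longrightarrow> (\<lambda>x. f x * g x) \<in> smooth_alg S"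

text \<open>Coinduction up to sums and products: derivatives of the generators may leave
  \<open>S\<close> as long as they stay polynomials in the generators with smooth coefficients. The
  sum and product rules extend this from \<open>S\<close> to the whole algebra.\<close>

lemma smooth_coinduct_alg:
  assumes "f \<in> smooth_alg S"
    and diff: "\<And>f x. f \<in> S \<Longrightarrow> f differentiable at x"
    and part: "\<And>f i. f \<in> S \<Longrightarrow> partial i f \<in> smooth_alg S"
  shows "smooth f"
proof (rule smooth_coinduct[OF assms(1)])
  show d: "f differentiable at x" if "f \<in> smooth_alg S" for f x
    using that by (induction) (auto simp: diff smooth_differentiable)
  show "partial i f \<in> smooth_alg S" if "f \<in> smooth_alg S" for f i
    using that
  proof (induction)
    case (base f)
    then show ?case by (rule part)
  next
    case (smooth f)
    then show ?case by (intro smooth_alg.smooth smooth_partial)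
  next
    case (add f g)
    then have "partial i (\<lambda>x. f x + g x) = (\<lambda>x. partial i f x + partial i g x)"
      by (simp add: fun_eq_iff partial_add d)
    with add show ?case by (simp add: smooth_alg.add)
  next
    case (mult f g)
    then have "partial i (\<lambda>x. f x * g x) = (\<lambda>x. f x * partial i g x + partial i f x * g x)"
      by (simp add: fun_eq_iff partial_mult d)
    with mult show ?case by (simp add: smooth_alg.add smooth_alg.mult)
  qed
qed

lemma smooth_add [simp]: "smooth f \<Longrightarrow> smooth g \<Longrightarrow> smooth (\<lambda>x. f x + g x)"
  and smooth_mult [simp]: "smooth f \<Longrightarrow> smooth g \<Longrightarrow> smooth (\<lambda>x. f x * g x)"
  by (rule smooth_coinduct_alg[of _ "{}"]; auto intro: smooth_alg.intros)+

lemma smooth_nth [simp]: "smooth (\<lambda>x. x $ j)"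
proof (rule smooth_coinduct_alg[of _ "{\<lambda>x. x $ j}"])
  show "partial i f \<in> smooth_alg {\<lambda>x. x $ j}" if "f \<in> {\<lambda>x. x $ j}" for f i
    using that smooth_const[of "if i = j then 1 else 0"]
    by (auto simp: partial_nth[abs_def] intro: smooth_alg.smooth)
qed (auto intro: smooth_alg.base bounded_linear_imp_differentiable bounded_linear_vec_nth)

lemma smooth_uminus: "smooth f \<Longrightarrow> smooth (\<lambda>x. - f x)"
  using smooth_mult[OF smooth_const[of "-1"], of f] by simp

lemma smooth_diff [simp]: "smooth f \<Longrightarrow> smooth g \<Longrightarrow> smooth (\<lambda>x. f x - g x)"
  using smooth_add[OF _ smooth_uminus, of f g] by simp

lemma partial_cmult: "f differentiable at x \<Longrightarrow> partial i (\<lambda>x. c * f x) x = c * partial i f x"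
  by (simp add: partial_mult)

lemma partial_uminus: "f differentiable at x \<Longrightarrow> partial i (\<lambda>x. - f x) x = - partial i f x"
  using partial_cmult[of f x i "-1"] by simp

lemma partial_diff:
  "f differentiable at x \<Longrightarrow> g differentiable at x \<Longrightarrow>
    partial i (\<lambda>x. f x - g x) x = partial i f x - partial i g x"
  using partial_add[of f x "\<lambda>x. - g x" i] by (simp add: partial_uminus)

lemma has_derivative_affine:
  fixes f :: "real^3 \<Rightarrow> real"
  assumes "f differentiable at (c *\<^sub>R x + a)"
  shows "((\<lambda>x. f (c *\<^sub>R x + a)) has_derivative
    (\<lambda>h. \<Sum>i\<in>UNIV. h $ i * (c * partial i f (c *\<^sub>R x + a)))) (at x)"
proof -
  have "((\<lambda>x. c *\<^sub>R x + a) has_derivative (\<lambda>h. c *\<^sub>R h)) (at x)"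
    by (auto intro!: derivative_eq_intros)
  from has_derivative_compose[OF this partial_has_derivative[OF assms]]
  show ?thesis
    by (simp add: algebra_simps)
qed

lemma partial_affine:
  assumes "f differentiable at (c *\<^sub>R x + a)"
  shows "partial i (\<lambda>x. f (c *\<^sub>R x + a)) x = c * partial i f (c *\<^sub>R x + a)"
  using partial_eqI[OF has_derivative_affine[OF assms], of i]
  by (simp add: axis_def if_distrib[of "\<lambda>u. u * _"] cong: if_cong)

lemma smooth_affine:
  assumes "smooth f"
  shows "smooth (\<lambda>x. f (c *\<^sub>R x + a))"
proof (rule smooth_coinduct_alg[of _ "{\<lambda>x. f (c *\<^sub>R x + a) | f. smooth f}"])
  show "partial i g \<in> smooth_alg {\<lambda>x. f (c *\<^sub>R x + a) |f. smooth f}"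
    if "g \<in> {\<lambda>x. f (c *\<^sub>R x + a) |f. smooth f}" for g i
  proof -
    from that obtain f where f: "g = (\<lambda>x. f (c *\<^sub>R x + a))" "smooth f" by blast
    have *: "partial i g = (\<lambda>x. c * partial i f (c *\<^sub>R x + a))"
      unfolding f(1) using f(2) by (intro ext partial_affine smooth_differentiable)
    show ?thesis
      unfolding * by (rule smooth_alg.mult[OF smooth_alg.smooth[OF smooth_const] smooth_alg.base])
        (use f smooth_partial in blast)
  qed
next
  show "(\<lambda>x. f (c *\<^sub>R x + a)) \<in> smooth_alg {\<lambda>x. f (c *\<^sub>R x + a) |f. smooth f}"
    using assms by (intro smooth_alg.base) blast
  show "g differentiable at x" if "g \<in> {\<lambda>x. f (c *\<^sub>R x + a) |f. smooth f}" for g x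
    using that has_derivative_affine[OF smooth_differentiable] differentiableI by fast
qed

lemma partials_affine:
  assumes "smooth f"
  shows "partials is (\<lambda>x. f (c *\<^sub>R x + a)) x = c ^ length is * partials is f (c *\<^sub>R x + a)"
proof (induction "is" arbitrary: x)
  case (Cons i "is")
  have "partials (i # is) (\<lambda>x. f (c *\<^sub>R x + a)) x
      = partial i (\<lambda>x. c ^ length is * partials is f (c *\<^sub>R x + a)) x"
    by (simp add: Cons[abs_def])
  also have "\<dots> = c ^ length is * partial i (\<lambda>x. partials is f (c *\<^sub>R x + a)) x"
    using assms by (intro partial_cmult smooth_differentiable smooth_affine smooth_partials)
  finally show ?case
    using assms by (simp add: partial_affine smooth_differentiable smooth_partials)
qed simp

lemma smooth_mvt:
  assumes "smooth u"
  obtains \<theta> where "0 < \<theta>" "\<theta> < 1"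
    "u (y + h) - u y = (\<Sum>i\<in>UNIV. h $ i * partial i u (y + \<theta> *\<^sub>R h))"
proof -
  have "((\<lambda>t. u (y + t *\<^sub>R h)) has_derivative
      (\<lambda>s. \<Sum>i\<in>UNIV. (s *\<^sub>R h) $ i * partial i u (y + t *\<^sub>R h))) (at t within {0..1})" for t
    by (rule has_derivative_compose[OF _ smooth_has_derivative[OF assms]])
      (auto intro!: derivative_eq_intros)
  from mvt_simple[OF zero_less_one this] obtain \<theta> where "\<theta> \<in> {0<..<1}"
    "u (y + 1 *\<^sub>R h) - u (y + 0 *\<^sub>R h) = (\<Sum>i\<in>UNIV. ((1 - 0) *\<^sub>R h) $ i * partial i u (y + \<theta> *\<^sub>R h))"
    by blast
  then show thesis by (intro that[of \<theta>]) simp_all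
qed

lemma smooth_mvt_partial:
  assumes "smooth u"
  obtains \<theta> where "0 < \<theta>" "\<theta> < 1"
    "u (y + r *\<^sub>R axis j 1) - u y = r * partial j u (y + (\<theta> * r) *\<^sub>R axis j 1)"
proof -
  obtain \<theta> where "0 < \<theta>" "\<theta> < 1" and *: "u (y + r *\<^sub>R axis j 1) - u y
      = (\<Sum>i\<in>UNIV. (r *\<^sub>R axis j 1 :: real^3) $ i * partial i u (y + \<theta> *\<^sub>R (r *\<^sub>R axis j 1)))"
    using smooth_mvt[OF assms] by blast
  moreover have "(\<Sum>i\<in>UNIV. (r *\<^sub>R axis j 1 :: real^3) $ i * partial i u (y + \<theta> *\<^sub>R (r *\<^sub>R axis j 1)))
      = (\<Sum>i\<in>UNIV. if i = j then r * partial i u (y + (\<theta> * r) *\<^sub>R axis j 1) else 0)"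
    by (intro sum.cong) (auto simp: axis_def)
  ultimately show thesis by (intro that[of \<theta>]) simp_all
qed

text \<open>The second difference of \<open>u\<close> over a parallelogram of side r is symmetric in
  the two directions. Two applications of the mean value theorem equate it with r^2 times a mixed
  derivative at a point within 2r of \<open>x\<close>, the order of the derivatives being that of
  the applications; continuity settles the limit r -> 0.\<close>

lemma partial_commute:
  assumes u: "smooth u"
  shows "partial i (partial j u) x = partial j (partial i u) x"
proof -
  have *: "\<exists>y. dist y x \<le> 2 * r \<and> D' = r * r * partial j (partial i u) y"
    if r: "r > 0" and D': "D' = u (x + r *\<^sub>R axis i 1 + r *\<^sub>R axis j 1) - u (x + r *\<^sub>R axis i 1)
    - u (x + r *\<^sub>R axis j 1) + u x" for r i j D'
  proof -
    let ?w = "\<lambda>y. u (y + r *\<^sub>R axis j 1) - u y"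
    have sj: "smooth (\<lambda>y. u (y + r *\<^sub>R axis j 1))"
      using smooth_affine[OF u, of 1] by simp
    then have "smooth ?w" using u by simp
    then obtain \<theta> where \<theta>: "0 < \<theta>" "\<theta> < 1"
        "?w (x + r *\<^sub>R axis i 1) - ?w x = r * partial i ?w (x + (\<theta> * r) *\<^sub>R axis i 1)"
      using smooth_mvt_partial by blast
    let ?y = "x + (\<theta> * r) *\<^sub>R axis i 1"
    have "partial i ?w ?y = partial i u (?y + r *\<^sub>R axis j 1) - partial i u ?y"
      using partial_affine[OF smooth_differentiable[OF u], where c = 1 and i = i] sj u
      by (simp add: partial_diff smooth_differentiable)
    moreover obtain \<eta> where \<eta>: "0 < \<eta>" "\<eta> < 1"
        "partial i u (?y + r *\<^sub>R axis j 1) - partial i u ?y = r * partial j (partial i u) (?y + (\<eta> * r) *\<^sub>R axis j 1)"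
      using smooth_mvt_partial[OF smooth_partial[OF u]] by blast
    ultimately have "D' = r * r * partial j (partial i u) (?y + (\<eta> * r) *\<^sub>R axis j 1)"
      using \<theta>(3) D' by simp
    moreover have "dist (?y + (\<eta> * r) *\<^sub>R axis j 1) x \<le> 2 * r"
    proof -
      have "norm ((\<theta> * r) *\<^sub>R axis i 1 + (\<eta> * r) *\<^sub>R axis j (1::real) :: real^3) \<le> \<theta> * r + \<eta> * r"
        using norm_triangle_ineq[of "(\<theta> * r) *\<^sub>R axis i (1::real) :: real^3" "(\<eta> * r) *\<^sub>R axis j (1::real)"]
          \<theta> \<eta> r by (simp add: norm_axis_1)
      also have "\<dots> \<le> 1 * r + 1 * r"
        using \<theta> \<eta> r by (intro add_mono mult_right_mono) auto
      finally show ?thesis by (simp add: dist_norm algebra_simps)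
    qed
    ultimately show ?thesis by blast
  qed
  define r where "r n = 1 / real (Suc n)" for n
  have r: "r n > 0" for n by (simp add: r_def)
  have r0: "r \<longlonglongrightarrow> 0" unfolding r_def using LIMSEQ_inverse_real_of_nat by (simp add: inverse_eq_divide)
  let ?D = "\<lambda>n. u (x + r n *\<^sub>R axis i 1 + r n *\<^sub>R axis j 1) - u (x + r n *\<^sub>R axis i 1)
    - u (x + r n *\<^sub>R axis j 1) + u x"
  have "\<forall>n. \<exists>y. dist y x \<le> 2 * r n \<and> ?D n = r n * r n * partial j (partial i u) y"
    by (intro allI *[OF r refl])
  from choice[OF this] obtain y where y: "\<And>n. dist (y n) x \<le> 2 * r n" "\<And>n. ?D n = r n * r n * partial j (partial i u) (y n)"
    by auto
  have "\<forall>n. \<exists>z. dist z x \<le> 2 * r n \<and> ?D n = r n * r n * partial i (partial j u) z"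
  proof
    fix n
    have D: "?D n = u (x + r n *\<^sub>R axis j 1 + r n *\<^sub>R axis i 1) - u (x + r n *\<^sub>R axis j 1)
      - u (x + r n *\<^sub>R axis i 1) + u x"
      by (simp add: algebra_simps)
    show "\<exists>z. dist z x \<le> 2 * r n \<and> ?D n = r n * r n * partial i (partial j u) z"
      by (rule *[OF r D])
  qed
  from choice[OF this] obtain z where z: "\<And>n. dist (z n) x \<le> 2 * r n" "\<And>n. ?D n = r n * r n * partial i (partial j u) (z n)"
    by auto
  have eq: "partial j (partial i u) (y n) = partial i (partial j u) (z n)" for n
    using y(2)[of n] z(2)[of n] r[of n] by simp
  have lim: "(\<lambda>n. f (y n)) \<longlonglongrightarrow> f x" if "smooth f" "\<And>n. dist (y n) x \<le> 2 * r n"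
    for f :: "real^3 \<Rightarrow> real" and y
  proof -
    have "(\<lambda>n. 2 * r n) \<longlonglongrightarrow> 0" using tendsto_mult_right_zero[OF r0] by simp
    then have "(\<lambda>n. dist (y n) x) \<longlonglongrightarrow> 0"
      by (rule Lim_null_comparison[rotated]) (use that in auto)
    then have "y \<longlonglongrightarrow> x" by (rule tendsto_dist_iff[THEN iffD2])
    then show ?thesis
      by (rule isCont_tendsto_compose[OF differentiable_imp_continuous_within[OF smooth_differentiable[OF that(1)]]])
  qed
  have "(\<lambda>n. partial j (partial i u) (y n)) \<longlonglongrightarrow> partial j (partial i u) x"
    by (intro lim smooth_partial u y)
  moreover have "(\<lambda>n. partial j (partial i u) (y n)) \<longlonglongrightarrow> partial i (partial j u) x"
    unfolding eq by (intro lim smooth_partial u z)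
  ultimately show ?thesis
    by (rule LIMSEQ_unique[rotated])
qed

section \<open>Compact supports and the space of test functions\<close>

lemma supp_subset_cball_iff: "supp f \<subseteq> cball 0 R \<longleftrightarrow> (\<forall>x. norm x > R \<longrightarrow> f x = 0)"
proof -
  have "supp f \<subseteq> cball 0 R \<longleftrightarrow> support_on UNIV f \<subseteq> cball 0 R"
    unfolding supp_def by (meson closed_cball closure_minimal closure_subset order_trans)
  also have "\<dots> \<longleftrightarrow> (\<forall>x. norm x > R \<longrightarrow> f x = 0)"
    by (auto simp: support_on_def subset_eq simp flip: not_le)
  finally show ?thesis .
qed

lemma test_iff: "f \<in> test_functions \<longleftrightarrow> smooth f \<and> (\<exists>R. \<forall>x. norm x > R \<longrightarrow> f x = 0)"
proof -
  have "compact (supp f) \<longleftrightarrow> (\<exists>R. supp f \<subseteq> cball 0 R)"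
    by (metis bounded_cball bounded_iff bounded_subset compact_eq_bounded_closed closed_closure
        mem_cball_0 subsetI supp_def)
  then show ?thesis
    by (simp add: test_functions_def supp_subset_cball_iff)
qed

lemma testI: "smooth f \<Longrightarrow> (\<And>x. norm x > R \<Longrightarrow> f x = 0) \<Longrightarrow> f \<in> test_functions"
  by (auto simp: test_iff)

lemma test_smooth [dest]: "f \<in> test_functions \<Longrightarrow> smooth f"
  by (simp add: test_iff)

lemma partial_eq_0:
  assumes "\<And>x. norm x > R \<Longrightarrow> f x = 0" "norm x > R"
  shows "partial i f x = 0"
proof -
  have "((\<lambda>x. 0) has_derivative (\<lambda>h. 0)) (at x)" by simp
  moreover have "open {x :: real^3. norm x > R}"
    by (intro open_Collect_less continuous_intros)
  ultimately have "(f has_derivative (\<lambda>h. 0)) (at x)"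
    using has_derivative_transform_within_open[of "\<lambda>x. 0" "\<lambda>h. 0" x UNIV "{x. norm x > R}" f] assms by auto
  then show ?thesis by (simp add: partial_eqI)
qed

lemma partials_eq_0:
  assumes "\<And>x. norm x > R \<Longrightarrow> f x = 0"
  shows "norm x > R \<Longrightarrow> partials is f x = 0"
  by (induction "is" arbitrary: x) (auto intro: assms partial_eq_0)

lemma test_partial [intro]: "f \<in> test_functions \<Longrightarrow> partial i f \<in> test_functions"
  using partial_eq_0 smooth_partial unfolding test_iff by metis

lemma test_partials: "f \<in> test_functions \<Longrightarrow> partials is f \<in> test_functions"
  by (induction "is") auto

lemma test_mult_left:
  assumes "f \<in> test_functions" "smooth g"
  shows "(\<lambda>x. g x * f x) \<in> test_functions"
  using assms by (auto simp: test_iff)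

lemma test_affine:
  assumes "f \<in> test_functions" "c \<noteq> 0"
  shows "(\<lambda>x. f (c *\<^sub>R x + a)) \<in> test_functions"
proof -
  obtain R where R: "\<And>x. norm x > R \<Longrightarrow> f x = 0" using assms by (auto simp: test_iff)
  show ?thesis
  proof (rule testI)
    show "smooth (\<lambda>x. f (c *\<^sub>R x + a))" using assms by (auto intro: smooth_affine)
    fix x :: "real^3" assume x: "norm x > (R + norm a) / \<bar>c\<bar>"
    then have "\<bar>c\<bar> * norm x > R + norm a"
      using assms by (simp add: field_simps)
    then have "norm (c *\<^sub>R x) > R + norm a" by simp
    moreover have "norm (c *\<^sub>R x) \<le> norm (c *\<^sub>R x + a) + norm a"
      using norm_triangle_ineq4[of "c *\<^sub>R x + a" a] by simp
    ultimately show "f (c *\<^sub>R x + a) = 0" by (intro R) simp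
  qed
qed

lemma test_bounded:
  assumes "f \<in> test_functions"
  obtains B where "B \<ge> 0" "\<And>x. \<bar>f x\<bar> \<le> B"
proof -
  obtain R where R: "\<And>x. norm x > R \<Longrightarrow> f x = 0" using assms by (auto simp: test_iff)
  have "compact (f ` cball 0 R)"
    by (rule compact_continuous_image) (use assms smooth_continuous in auto)
  then obtain B where "\<forall>y\<in>f ` cball 0 R. norm y \<le> B"
    using compact_imp_bounded bounded_iff by blast
  then have "\<bar>f x\<bar> \<le> max B 0" for x
    using R[of x] by (cases "norm x \<le> R") (auto simp: le_max_iff_disj)
  with that[of "max B 0"] show thesis by simp
qed

section \<open>Differentiation under the integral sign\<close>

text \<open>Common form of convolutions and ray integrals: in the former \<open>s\<close> is the
  integration point with \<open>c = 1\<close> and \<open>d s = - s\<close>, in the latter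
  \<open>s\<close> is the dilation factor and \<open>d = 0\<close>. Smoothness is proved once for
  both.\<close>

definition param :: "'s measure \<Rightarrow> ('s \<Rightarrow> real) \<Rightarrow> ('s \<Rightarrow> real) \<Rightarrow> ('s \<Rightarrow> real^3) \<Rightarrow> (real^3 \<Rightarrow> real) \<Rightarrow> real^3 \<Rightarrow> real" where
  "param M k c d u x = (\<integral>s. k s * u (c s *\<^sub>R x + d s) \<partial>M)"

definition dominated :: "'s measure \<Rightarrow> ('s \<Rightarrow> real) \<Rightarrow> ('s \<Rightarrow> real) \<Rightarrow> ('s \<Rightarrow> real^3) \<Rightarrow> (real^3 \<Rightarrow> real) \<Rightarrow> bool" where
  "dominated M k c d u \<longleftrightarrow> k \<in> borel_measurable M \<and> c \<in> borel_measurable M \<and> d \<in> borel_measurable M \<and>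
    smooth u \<and> (\<exists>C. \<forall>s. \<bar>c s\<bar> \<le> C) \<and>
    (\<forall>is R. \<exists>g. integrable M g \<and> (\<forall>s x. norm x \<le> R \<longrightarrow> \<bar>k s * partials is u (c s *\<^sub>R x + d s)\<bar> \<le> g s))"

text \<open>A derivative of a \<open>param\<close> is a \<open>param\<close> with weight
  \<open>k s * c s\<close>. As \<open>c\<close> is bounded and \<open>dominated\<close> asks for a
  majorant of every derivative on every ball, the condition reproduces itself; the coinduction in
  \<open>smooth_param\<close> rests on this.\<close>

lemma dominated_partial:
  assumes "dominated M k c d u"
  shows "dominated M (\<lambda>s. k s * c s) c d (partial i u)"
  unfolding dominated_def
proof (intro conjI allI)
  fix "is" R
  obtain C where C: "\<And>s. \<bar>c s\<bar> \<le> C" using assms by (auto simp: dominated_def)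
  obtain g where g: "integrable M g"
    "\<And>s x. norm x \<le> R \<Longrightarrow> \<bar>k s * partials (is @ [i]) u (c s *\<^sub>R x + d s)\<bar> \<le> g s"
    using assms unfolding dominated_def by meson
  have "\<bar>k s * c s * partials is (partial i u) (c s *\<^sub>R x + d s)\<bar> \<le> C * g s" if "norm x \<le> R" for s x
  proof -
    have "\<bar>c s\<bar> * \<bar>k s * partials (is @ [i]) u (c s *\<^sub>R x + d s)\<bar> \<le> C * g s"
      by (intro mult_mono C g that) (use C[of s] in auto)
    then show ?thesis by (simp add: partials_snoc abs_mult mult_ac)
  qed
  then show "\<exists>g. integrable M g \<and> (\<forall>s x. norm x \<le> R \<longrightarrow>
      \<bar>k s * c s * partials is (partial i u) (c s *\<^sub>R x + d s)\<bar> \<le> g s)"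
    using g(1) by (intro exI[of _ "\<lambda>s. C * g s"]) auto
qed (use assms in \<open>auto simp: dominated_def smooth_partial\<close>)

lemma dominated_measurable:
  assumes "dominated M k c d u"
  shows "(\<lambda>s. k s * u (c s *\<^sub>R x + d s)) \<in> borel_measurable M"
proof -
  have [measurable]: "k \<in> borel_measurable M" "c \<in> borel_measurable M" "d \<in> borel_measurable M"
    "u \<in> borel_measurable borel"
    using assms smooth_borel by (auto simp: dominated_def)
  show ?thesis by measurable
qed

lemma dominated_integrable:
  assumes "dominated M k c d u"
  shows "integrable M (\<lambda>s. k s * u (c s *\<^sub>R x + d s))"
proof -
  obtain g where g: "integrable M g"
    "\<And>s y. norm y \<le> norm x \<Longrightarrow> \<bar>k s * partials [] u (c s *\<^sub>R y + d s)\<bar> \<le> g s"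
    using assms unfolding dominated_def by meson
  show ?thesis
    by (rule Bochner_Integration.integrable_bound[OF g(1) dominated_measurable[OF assms]])
      (use g(2)[OF order.refl] in \<open>auto intro!: order_trans[OF _ abs_ge_self]\<close>)
qed

lemma param_has_derivative:
  assumes dom: "dominated M k c d u"
  shows "(param M k c d u has_derivative
    (\<lambda>h. \<Sum>i\<in>UNIV. h $ i * param M (\<lambda>s. k s * c s) c d (partial i u) x)) (at x)"
proof -
  let ?F = "param M k c d u" and ?D = "\<lambda>i. param M (\<lambda>s. k s * c s) c d (partial i u) x"
  have u: "smooth u" using dom by (simp add: dominated_def)
  have "\<exists>g. integrable M g \<and> (\<forall>s y. norm y \<le> norm x + 1 \<longrightarrow>
      \<bar>k s * c s * partials [] (partial i u) (c s *\<^sub>R y + d s)\<bar> \<le> g s)" for i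
    using dominated_partial[OF dom, of i] unfolding dominated_def by meson
  then obtain g where g: "\<And>i. integrable M (g i)"
    "\<And>i s y. norm y \<le> norm x + 1 \<Longrightarrow> \<bar>k s * c s * partial i u (c s *\<^sub>R y + d s)\<bar> \<le> g i s"
    unfolding partials_Nil by metis
  \<comment> \<open>Remainder of the first-order expansion under the integral, divided by the length
    of \<open>h\<close>. Differentiability means that its integral tends to 0.\<close>
  define q where "q h s = (k s * u (c s *\<^sub>R (x + h) + d s) - k s * u (c s *\<^sub>R x + d s)
      - (\<Sum>i\<in>UNIV. h $ i * (k s * c s * partial i u (c s *\<^sub>R x + d s)))) / norm h" for h s
  have int: "integrable M (\<lambda>s. k s * c s * partial i u (c s *\<^sub>R x + d s))" for i
    using dominated_integrable[OF dominated_partial[OF dom]] .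
  have q_meas: "q h \<in> borel_measurable M" for h
    unfolding q_def using dominated_measurable[OF dom] int[THEN borel_measurable_integrable]
    by (intro borel_measurable_divide borel_measurable_diff borel_measurable_sum
        borel_measurable_times[OF borel_measurable_const]) auto
  have q_int: "(?F (x + h) - ?F x - (\<Sum>i\<in>UNIV. h $ i * ?D i)) / norm h = (\<integral>s. q h s \<partial>M)" for h
    unfolding q_def param_def using dominated_integrable[OF dom] int by simp
  have q_bound: "norm (q h s) \<le> (\<Sum>i\<in>UNIV. 2 * g i s)" if h: "norm h \<le> 1" "h \<noteq> 0" for h s
  proof -
    \<comment> \<open>The intermediate point corresponds to an argument in the ball of radius
      \<open>norm x + 1\<close>, so one majorant serves all \<open>h\<close> of length at most
      1.\<close>
    obtain \<theta> where \<theta>: "0 < \<theta>" "\<theta> < 1" "u (c s *\<^sub>R (x + h) + d s) - u (c s *\<^sub>R x + d s)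
        = (\<Sum>i\<in>UNIV. (c s *\<^sub>R h) $ i * partial i u ((c s *\<^sub>R x + d s) + \<theta> *\<^sub>R c s *\<^sub>R h))"
      using smooth_mvt[OF u, of "c s *\<^sub>R x + d s" "c s *\<^sub>R h"] by (auto simp: algebra_simps)
    have nx: "norm (x + \<theta> *\<^sub>R h) \<le> norm x + 1"
    proof -
      have "norm (x + \<theta> *\<^sub>R h) \<le> norm x + \<theta> * norm h"
        using norm_triangle_ineq[of x "\<theta> *\<^sub>R h"] \<theta> by simp
      also have "\<theta> * norm h \<le> 1 * 1" using \<theta> h by (intro mult_mono) auto
      finally show ?thesis by simp
    qed
    have "\<bar>k s * u (c s *\<^sub>R (x + h) + d s) - k s * u (c s *\<^sub>R x + d s)
      - (\<Sum>i\<in>UNIV. h $ i * (k s * c s * partial i u (c s *\<^sub>R x + d s)))\<bar>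
      = \<bar>\<Sum>i\<in>UNIV. h $ i * (k s * c s * partial i u (c s *\<^sub>R (x + \<theta> *\<^sub>R h) + d s))
          - h $ i * (k s * c s * partial i u (c s *\<^sub>R x + d s))\<bar>"
      unfolding right_diff_distrib[symmetric] \<theta>(3)
      by (simp add: sum_subtractf sum_distrib_left algebra_simps)
    also have "\<dots> \<le> (\<Sum>i\<in>UNIV. \<bar>h $ i * (k s * c s * partial i u (c s *\<^sub>R (x + \<theta> *\<^sub>R h) + d s))
          - h $ i * (k s * c s * partial i u (c s *\<^sub>R x + d s))\<bar>)"
      by (rule sum_abs)
    also have "\<dots> \<le> (\<Sum>i\<in>UNIV. norm h * (2 * g i s))"
    proof (rule sum_mono)
      fix i
      have "\<bar>h $ i * (k s * c s * partial i u (c s *\<^sub>R (x + \<theta> *\<^sub>R h) + d s))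
          - h $ i * (k s * c s * partial i u (c s *\<^sub>R x + d s))\<bar>
        = \<bar>h $ i\<bar> * \<bar>k s * c s * partial i u (c s *\<^sub>R (x + \<theta> *\<^sub>R h) + d s)
          - k s * c s * partial i u (c s *\<^sub>R x + d s)\<bar>"
        by (simp flip: abs_mult right_diff_distrib)
      also have "\<dots> \<le> norm h * (2 * g i s)"
        using g(2)[OF nx, of s i] g(2)[of x s i]
        by (intro mult_mono component_le_norm_cart) auto
      finally show "\<bar>h $ i * (k s * c s * partial i u (c s *\<^sub>R (x + \<theta> *\<^sub>R h) + d s))
          - h $ i * (k s * c s * partial i u (c s *\<^sub>R x + d s))\<bar> \<le> norm h * (2 * g i s)" .
    qed
    finally show ?thesis
      using h by (simp add: q_def divide_le_eq sum_distrib_left[symmetric] mult_ac)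
  qed
  have q_lim: "((\<lambda>h. q h s) \<longlongrightarrow> 0) (at 0)" for s
  proof -
    have "((\<lambda>y. k s * u (c s *\<^sub>R y + d s)) has_derivative
      (\<lambda>h. k s * (\<Sum>i\<in>UNIV. h $ i * (c s * partial i u (c s *\<^sub>R x + d s))))) (at x)"
      by (intro has_derivative_mult_right has_derivative_affine smooth_differentiable u)
    then have "((\<lambda>h. norm (k s * u (c s *\<^sub>R (x + h) + d s) - k s * u (c s *\<^sub>R x + d s)
      - k s * (\<Sum>i\<in>UNIV. h $ i * (c s * partial i u (c s *\<^sub>R x + d s)))) / norm h) \<longlongrightarrow> 0) (at 0)"
      by (simp add: has_derivative_at)
    then have "((\<lambda>h. norm (q h s)) \<longlongrightarrow> 0) (at 0)"
      by (simp add: q_def sum_distrib_left mult_ac)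
    then show ?thesis by (simp add: tendsto_rabs_zero_iff)
  qed
  \<comment> \<open>The restriction to the unit ball is where the majorant is valid; the ball is an
    open neighbourhood of 0, so the limit at 0 is the same.\<close>
  have "((\<lambda>h. \<integral>s. q h s \<partial>M) \<longlongrightarrow> 0) (at 0 within ball 0 1)"
    unfolding tendsto_at_iff_sequentially comp_def
  proof (intro allI impI)
    fix X :: "nat \<Rightarrow> real^3" assume X: "\<forall>i. X i \<in> ball 0 1 - {0}" "X \<longlonglongrightarrow> 0"
    have "(\<lambda>n. \<integral>s. q (X n) s \<partial>M) \<longlonglongrightarrow> (\<integral>s. 0 \<partial>M)"
    proof (rule integral_dominated_convergence)
      show "integrable M (\<lambda>s. \<Sum>i\<in>UNIV. 2 * g i s)" using g(1) by auto
      show "AE s in M. (\<lambda>n. q (X n) s) \<longlonglongrightarrow> 0"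
        using q_lim X unfolding tendsto_at_iff_sequentially comp_def by auto
      show "AE s in M. norm (q (X n) s) \<le> (\<Sum>i\<in>UNIV. 2 * g i s)" for n
        using q_bound[of "X n"] X by (auto simp: less_imp_le)
    qed (use q_meas in auto)
    then show "(\<lambda>n. \<integral>s. q (X n) s \<partial>M) \<longlonglongrightarrow> 0" by simp
  qed
  then have "((\<lambda>h. (?F (x + h) - ?F x - (\<Sum>i\<in>UNIV. h $ i * ?D i)) / norm h) \<longlongrightarrow> 0) (at 0)"
    unfolding q_int by (subst (asm) at_within_open) auto
  then have "((\<lambda>h. norm ((?F (x + h) - ?F x - (\<Sum>i\<in>UNIV. h $ i * ?D i)) / norm h)) \<longlongrightarrow> 0) (at 0)"
    by (rule tendsto_norm_zero)
  then have "((\<lambda>h. norm (?F (x + h) - ?F x - (\<Sum>i\<in>UNIV. h $ i * ?D i)) / norm h) \<longlongrightarrow> 0) (at 0)"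
    by simp
  moreover have "bounded_linear (\<lambda>h. \<Sum>i\<in>UNIV. h $ i * ?D i)"
    by (intro bounded_linear_sum bounded_linear_compose[OF bounded_linear_mult_left bounded_linear_vec_nth])
  ultimately show ?thesis
    by (simp add: has_derivative_at)
qed

lemma partial_param:
  assumes "dominated M k c d u"
  shows "partial i (param M k c d u) x = param M (\<lambda>s. k s * c s) c d (partial i u) x"
  using partial_eqI[OF param_has_derivative[OF assms], of i]
  by (simp add: axis_def if_distrib[of "\<lambda>u. u * _"] cong: if_cong)

lemma smooth_param:
  assumes "dominated M k c d u"
  shows "smooth (param M k c d u)"
proof (rule smooth_coinduct[of _ "{param M k c d u | k u. dominated M k c d u}"])
  let ?S = "{param M k c d u | k u. dominated M k c d u}"
  show "param M k c d u \<in> ?S" using assms by blast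
  fix f x i assume "f \<in> ?S"
  then obtain k u where f: "f = param M k c d u" and dom: "dominated M k c d u" by blast
  show "f differentiable at x"
    unfolding f using param_has_derivative[OF dom] by (rule differentiableI)
  have "partial i f = param M (\<lambda>s. k s * c s) c d (partial i u)"
    unfolding f using dom by (intro ext partial_param)
  then show "partial i f \<in> ?S"
    using dominated_partial[OF dom] by blast
qed

section \<open>Smooth functions built from exp(-1/t)\<close>

text \<open>Polynomials in 1/t as prefactors close the family under differentiation: the derivative
  of p(1/t) exp(-1/t) has the same form with the polynomial X^2 (p - p').\<close>

definition flat :: "real poly \<Rightarrow> real \<Rightarrow> real" where
  "flat p t = (if t > 0 then poly p (1 / t) * exp (- 1 / t) else 0)"

lemma flat_tendsto_0: "(flat p \<longlongrightarrow> 0) (at 0)"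
proof -
  have "((\<lambda>s. \<Sum>i\<le>degree p. coeff p i * (s ^ i / exp s)) \<longlongrightarrow> (\<Sum>i\<le>degree p. coeff p i * 0)) at_top"
    by (intro tendsto_intros tendsto_power_div_exp_0)
  then have "((\<lambda>s. poly p s * exp (- s)) \<longlongrightarrow> 0) at_top"
    by (simp add: poly_altdef sum_distrib_left exp_minus divide_inverse mult_ac)
  moreover have "filterlim (\<lambda>t. 1 / t :: real) at_top (at_right 0)"
    using filterlim_inverse_at_top_right by (simp add: inverse_eq_divide)
  ultimately have "((\<lambda>t. poly p (1 / t) * exp (- (1 / t))) \<longlongrightarrow> 0) (at_right 0)"
    by (rule filterlim_compose)
  then have "(flat p \<longlongrightarrow> 0) (at_right 0)"
    by (rule Lim_transform_eventually) (auto simp: flat_def eventually_at_right_less eventually_at_filter)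
  moreover have "(flat p \<longlongrightarrow> 0) (at_left 0)"
    by (rule Lim_transform_eventually[OF tendsto_const]) (auto simp: flat_def eventually_at_filter)
  ultimately show ?thesis by (simp add: filterlim_split_at)
qed

lemma flat_has_derivative:
  "(flat p has_real_derivative flat ([:0, 0, 1:] * (p - pderiv p)) t) (at t)"
proof -
  consider "t < 0" | "t = 0" | "t > 0" by linarith
  then show ?thesis
  proof cases
    case 1
    have "((\<lambda>t. 0) has_real_derivative 0) (at t)" by simp
    then have "(flat p has_real_derivative 0) (at t)"
      by (rule has_field_derivative_transform_within_open[where S = "{..<0}"]) (use 1 in \<open>auto simp: flat_def\<close>)
    with 1 show ?thesis by (simp add: flat_def)
  next
    case 2
    \<comment> \<open>At 0 the difference quotient is the function of the same family with
      polynomial X p, so the derivative there is a limit already known.\<close>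
    have "(\<lambda>y. (flat p y - flat p 0) / (y - 0)) = flat (pCons 0 p)"
      by (auto simp: flat_def fun_eq_iff)
    then have "(flat p has_real_derivative 0) (at 0)"
      using flat_tendsto_0[of "pCons 0 p"] by (simp add: has_field_derivative_iff)
    with 2 show ?thesis by (simp add: flat_def)
  next
    case 3
    have "((\<lambda>t. poly p (1 / t) * exp (- 1 / t)) has_real_derivative
        (poly p (1 / t) * (exp (- 1 / t) * (1 / (t * t)))
        + poly (pderiv p) (1 / t) * (- 1 / (t * t)) * exp (- 1 / t))) (at t)"
      (is "(_ has_real_derivative ?d) _")
      using 3 by (auto intro!: derivative_eq_intros DERIV_chain2[OF poly_DERIV])
    moreover have "?d = flat ([:0, 0, 1:] * (p - pderiv p)) t"
      using 3 by (simp add: flat_def algebra_simps)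
    ultimately have "((\<lambda>t. poly p (1 / t) * exp (- 1 / t)) has_real_derivative flat ([:0, 0, 1:] * (p - pderiv p)) t) (at t)"
      by simp
    then show ?thesis
      by (rule has_field_derivative_transform_within_open[where S = "{0<..}"]) (use 3 in \<open>auto simp: flat_def\<close>)
  qed
qed

lemma flat_has_derivative_norm:
  fixes x :: "real^3"
  shows "((\<lambda>x. flat p (1 - x \<bullet> x)) has_derivative
    (\<lambda>h. - 2 * (x \<bullet> h) * flat ([:0, 0, 1:] * (p - pderiv p)) (1 - x \<bullet> x))) (at x)"
proof -
  have "((\<lambda>x. 1 - x \<bullet> x) has_derivative (\<lambda>h. - 2 * (x \<bullet> h))) (at x)"
    by (auto intro!: derivative_eq_intros simp: inner_commute)
  from has_derivative_compose[OF this flat_has_derivative[unfolded has_field_derivative_def]]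
  show ?thesis by (simp add: mult_ac)
qed

lemma partial_flat_norm:
  "partial i (\<lambda>x. flat p (1 - x \<bullet> x)) x = - 2 * x $ i * flat ([:0, 0, 1:] * (p - pderiv p)) (1 - x \<bullet> x)"
  using partial_eqI[OF flat_has_derivative_norm, of i p x] by (simp add: inner_axis)

lemma flat_norm_test: "(\<lambda>x. flat p (1 - x \<bullet> x)) \<in> test_functions"
proof (rule testI)
  let ?S = "{\<lambda>x :: real^3. flat p (1 - x \<bullet> x) | p. True}"
  show "smooth (\<lambda>x. flat p (1 - x \<bullet> x))"
  proof (rule smooth_coinduct_alg[of _ ?S])
    show "(\<lambda>x. flat p (1 - x \<bullet> x)) \<in> smooth_alg ?S" by (rule smooth_alg.base) blast
    fix f x i assume "f \<in> ?S"
    then obtain p where f: "f = (\<lambda>x. flat p (1 - x \<bullet> x))" by blast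
    show "f differentiable at x" unfolding f using flat_has_derivative_norm by (rule differentiableI)
    have *: "partial i f = (\<lambda>x. (- 2 * x $ i) * flat ([:0, 0, 1:] * (p - pderiv p)) (1 - x \<bullet> x))"
      unfolding f by (intro ext partial_flat_norm)
    show "partial i f \<in> smooth_alg ?S"
      unfolding * by (rule smooth_alg.mult[OF smooth_alg.smooth[OF smooth_mult[OF smooth_const smooth_nth]] smooth_alg.base]) blast
  qed
  show "flat p (1 - x \<bullet> x) = 0" if "norm x > 1" for x :: "real^3"
  proof -
    have "1 < (norm x)\<^sup>2" using that by (intro one_less_power) auto
    then show ?thesis by (simp add: flat_def power2_norm_eq_inner)
  qed
qed

section \<open>Scaling, local integrability and convolution\<close>

lemma nn_integral_affine3:
  fixes f :: "real^3 \<Rightarrow> ennreal"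
  assumes [measurable]: "f \<in> borel_measurable borel" and "c \<noteq> 0"
  shows "(\<integral>\<^sup>+x. f x \<partial>lborel) = ennreal (\<bar>c\<bar> ^ 3) * (\<integral>\<^sup>+x. f (a + c *\<^sub>R x) \<partial>lborel)"
  by (subst lborel_affine[OF \<open>c \<noteq> 0\<close>, of a])
    (simp add: nn_integral_density nn_integral_distr nn_integral_cmult)

lemma integral_affine3:
  fixes f :: "real^3 \<Rightarrow> real"
  assumes [measurable]: "f \<in> borel_measurable borel" and "c \<noteq> 0"
  shows "(\<integral>x. f x \<partial>lborel) = \<bar>c\<bar> ^ 3 * (\<integral>x. f (a + c *\<^sub>R x) \<partial>lborel)"
  by (subst lborel_affine[OF \<open>c \<noteq> 0\<close>, of a]) (simp add: integral_density integral_distr)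

definition loc_int :: "(real^3 \<Rightarrow> real) \<Rightarrow> bool" where
  "loc_int f \<longleftrightarrow> f \<in> borel_measurable borel \<and> (\<forall>R. integrable lborel (\<lambda>y. indicator (cball 0 R) y * f y))"

lemma loc_int_mult:
  assumes "loc_int f" "g \<in> borel_measurable borel" "\<And>x. \<bar>g x\<bar> \<le> B" "\<And>x. norm x > R \<Longrightarrow> g x = 0"
  shows "integrable lborel (\<lambda>y. f y * g y)"
proof (rule Bochner_Integration.integrable_bound)
  show "integrable lborel (\<lambda>y. B * (indicator (cball 0 R) y * f y))"
    using assms by (auto simp: loc_int_def)
  show "AE y in lborel. norm (f y * g y) \<le> norm (B * (indicator (cball 0 R) y * f y))"
  proof (intro AE_I2)
    fix y
    have "\<bar>f y\<bar> * \<bar>g y\<bar> \<le> \<bar>f y\<bar> * \<bar>B\<bar>"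
      using assms(3)[of y] by (intro mult_left_mono) auto
    then show "norm (f y * g y) \<le> norm (B * (indicator (cball 0 R) y * f y))"
      using assms(4)[of y] by (auto simp: abs_mult indicator_def mult_ac not_le)
  qed
qed (use assms in \<open>auto simp: loc_int_def\<close>)

lemma loc_int_test:
  assumes "loc_int f" "g \<in> test_functions"
  shows "integrable lborel (\<lambda>y. f y * g y)"
  using assms loc_int_mult[of f g] test_bounded[of g] smooth_borel[of g] unfolding test_iff by metis

lemma test_loc_int: "smooth f \<Longrightarrow> loc_int f"
  unfolding loc_int_def
proof (intro conjI allI)
  fix R assume f: "smooth f"
  show "integrable lborel (\<lambda>y. indicator (cball 0 R) y * f y)"
    using borel_integrable_compact[of "cball 0 R" f] f smooth_continuous by auto
qed (simp add: smooth_borel)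

lemma test_integrable: "f \<in> test_functions \<Longrightarrow> integrable lborel f"
  using loc_int_test[OF test_loc_int[OF smooth_const], of f 1] by simp

definition conv :: "(real^3 \<Rightarrow> real) \<Rightarrow> (real^3 \<Rightarrow> real) \<Rightarrow> real^3 \<Rightarrow> real" where
  "conv K f x = (\<integral>y. f y * K (x - y) \<partial>lborel)"

lemma conv_param: "conv K f = param lborel f (\<lambda>_. 1) (\<lambda>y. - y) K"
  by (simp add: conv_def param_def fun_eq_iff)

text \<open>All derivatives fall on the kernel, so local integrability of \<open>f\<close> is
  enough: for |x| at most R, a kernel supported in the ball of radius R' sees \<open>f\<close> on
  the ball of radius R + R' only.\<close>

lemma dominated_conv:
  assumes f: "loc_int f" and K: "K \<in> test_functions"
  shows "dominated lborel f (\<lambda>_. 1) (\<lambda>y. - y) K"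
  unfolding dominated_def
proof (intro conjI allI)
  show "smooth K" using K by auto
  fix "is" R
  obtain B where B: "\<And>x. \<bar>partials is K x\<bar> \<le> B"
    using test_bounded[OF test_partials[OF K]] by blast
  obtain R' where R': "\<And>x. norm x > R' \<Longrightarrow> partials is K x = 0"
    using test_partials[OF K] by (auto simp: test_iff)
  have "\<bar>f y * partials is K (1 *\<^sub>R x + - y)\<bar> \<le> B * \<bar>indicator (cball 0 (R + R')) y * f y\<bar>" if "norm x \<le> R" for x y
  proof (cases "norm (x - y) > R'")
    case True
    then show ?thesis using R' B[of 0] by simp
  next
    case False
    then have "norm y \<le> R + R'"
      using norm_triangle_ineq4[of x "x - y"] that by simp
    then show ?thesis
      using mult_right_mono[OF B[of "x - y"], of "\<bar>f y\<bar>"] by (simp add: abs_mult mult_ac)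
  qed
  then show "\<exists>g. integrable lborel g \<and> (\<forall>y x. norm x \<le> R \<longrightarrow> \<bar>f y * partials is K (1 *\<^sub>R x + - y)\<bar> \<le> g y)"
    using f by (intro exI[of _ "\<lambda>y. B * \<bar>indicator (cball 0 (R + R')) y * f y\<bar>"]) (auto simp: loc_int_def)
qed (use f in \<open>auto simp: loc_int_def\<close>)

lemma conv_integrable: "loc_int f \<Longrightarrow> K \<in> test_functions \<Longrightarrow> integrable lborel (\<lambda>y. f y * K (x - y))"
  using dominated_integrable[OF dominated_conv, of f K x] by simp

lemma smooth_conv: "loc_int f \<Longrightarrow> K \<in> test_functions \<Longrightarrow> smooth (conv K f)"
  unfolding conv_param by (intro smooth_param dominated_conv)

lemma partial_conv: "loc_int f \<Longrightarrow> K \<in> test_functions \<Longrightarrow> partial i (conv K f) x = conv (partial i K) f x"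
  unfolding conv_param by (subst partial_param) (auto intro: dominated_conv)

text \<open>By translation invariance the convolution of \<open>f\<close> with the constant 1 is
  itself constant. Its derivative is, up to a reflection, the integral of
  \<open>partial i f\<close>.\<close>

lemma integral_partial_test:
  assumes "f \<in> test_functions"
  shows "(\<integral>x. partial i f x \<partial>lborel) = 0"
proof -
  have reflect: "(\<integral>y. g (x - y) \<partial>lborel) = (\<integral>y. g y \<partial>lborel)" if "g \<in> test_functions" for g :: "real^3 \<Rightarrow> real" and x
    using integral_affine3[of g "-1" x] smooth_borel[OF test_smooth[OF that]] by simp
  have one: "loc_int (\<lambda>x. 1)" by (intro test_loc_int) simp
  have "conv f (\<lambda>x. 1) = (\<lambda>x. \<integral>y. f y \<partial>lborel)"
    using reflect[OF assms] by (simp add: conv_def fun_eq_iff)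
  then have "partial i (conv f (\<lambda>x. 1)) 0 = 0" by simp
  then have "conv (partial i f) (\<lambda>x. 1) 0 = 0"
    using partial_conv[OF one assms] by simp
  then show ?thesis
    using reflect[OF test_partial[OF assms], of i 0] by (simp add: conv_def)
qed

lemma integration_by_parts:
  assumes "f \<in> test_functions" "smooth g"
  shows "(\<integral>x. g x * partial i f x \<partial>lborel) = - (\<integral>x. partial i g x * f x \<partial>lborel)"
proof -
  have "(\<integral>x. partial i (\<lambda>x. g x * f x) x \<partial>lborel) = 0"
    by (rule integral_partial_test[OF test_mult_left[OF assms]])
  moreover have "partial i (\<lambda>x. g x * f x) x = g x * partial i f x + partial i g x * f x" for x
    using assms by (intro partial_mult smooth_differentiable) auto
  moreover have "integrable lborel (\<lambda>x. g x * partial i f x)" "integrable lborel (\<lambda>x. partial i g x * f x)"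
    using assms by (auto intro!: test_integrable test_mult_left smooth_partial)
  ultimately show ?thesis by simp
qed

section \<open>Integrals along rays through the origin\<close>

text \<open>Two instances matter: \<open>m = 0\<close> with \<open>psi\<close> on [a, b] gives a
  truncated Newtonian potential, and \<open>m = 1\<close> on [0, 1] gives the homotopy operator for
  closed 2-forms.\<close>

definition ray :: "real \<Rightarrow> real \<Rightarrow> nat \<Rightarrow> (real^3 \<Rightarrow> real) \<Rightarrow> real^3 \<Rightarrow> real" where
  "ray a b m u x = (\<integral>t. indicator {a..b} t * t ^ m * u (t *\<^sub>R x) \<partial>lborel)"

text \<open>Under the weight, the indicator in the dilation factor changes nothing, but it makes
  this factor bounded on the whole line, as \<open>dominated\<close> demands.\<close>

lemma ray_param: "ray a b m u = param lborel (\<lambda>t. indicator {a..b} t * t ^ m) (\<lambda>t. indicator {a..b} t * t) (\<lambda>_. 0) u"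
  unfolding ray_def param_def by (intro ext Bochner_Integration.integral_cong) (auto simp: indicator_def)

lemma dominated_ray:
  assumes u: "smooth u" and ab: "0 \<le> a" "a \<le> b"
  shows "dominated lborel (\<lambda>t. indicator {a..b} t * t ^ m) (\<lambda>t. indicator {a..b} t * t) (\<lambda>_. 0) u"
  unfolding dominated_def
proof (intro conjI allI)
  show "\<exists>C. \<forall>t. \<bar>indicator {a..b} t * t\<bar> \<le> C"
    using ab by (intro exI[of _ b]) (auto simp: indicator_def)
  fix "is" R
  have "compact (partials is u ` cball 0 (b * R))"
    by (rule compact_continuous_image) (use smooth_continuous smooth_partials u in auto)
  then obtain B where B: "\<forall>y\<in>partials is u ` cball 0 (b * R). norm y \<le> B"
    using compact_imp_bounded bounded_iff by blast
  have "\<bar>indicator {a..b} t * t ^ m * partials is u ((indicator {a..b} t * t) *\<^sub>R x + 0)\<bar>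
      \<le> indicator {a..b} t * (b ^ m * B)" if "norm x \<le> R" for t x
  proof (cases "t \<in> {a..b}")
    case True
    then have "\<bar>t\<bar> * norm x \<le> b * R"
      using that ab by (intro mult_mono) auto
    then have "\<bar>partials is u (t *\<^sub>R x)\<bar> \<le> B" using B by auto
    moreover have "\<bar>t\<bar> ^ m \<le> b ^ m" using True ab by (intro power_mono) auto
    ultimately have "\<bar>t\<bar> ^ m * \<bar>partials is u (t *\<^sub>R x)\<bar> \<le> b ^ m * B"
      using ab by (intro mult_mono) auto
    with True show ?thesis by (simp add: abs_mult power_abs)
  qed simp
  then show "\<exists>g. integrable lborel g \<and> (\<forall>t x. norm x \<le> R \<longrightarrow>
      \<bar>indicator {a..b} t * t ^ m * partials is u ((indicator {a..b} t * t) *\<^sub>R x + 0)\<bar> \<le> g t)"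
    using integrable_mult_left[OF integrable_real_indicator[of "{a..b}" lborel], of "b ^ m * B"]
    by (intro exI[of _ "\<lambda>t. indicator {a..b} t * (b ^ m * B)"]) (simp add: emeasure_lborel_Icc_eq)
qed (use u in auto)

lemma smooth_ray: "smooth u \<Longrightarrow> 0 \<le> a \<Longrightarrow> a \<le> b \<Longrightarrow> smooth (ray a b m u)"
  unfolding ray_param by (intro smooth_param dominated_ray)

lemma ray_integrable:
  assumes "smooth u" "0 \<le> a" "a \<le> b"
  shows "integrable lborel (\<lambda>t. indicator {a..b} t * t ^ m * u (t *\<^sub>R x))"
proof -
  have "(\<lambda>t. indicator {a..b} t * t ^ m * u ((indicator {a..b} t * t) *\<^sub>R x + 0))
      = (\<lambda>t. indicator {a..b} t * t ^ m * u (t *\<^sub>R x))"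
    by (auto simp: indicator_def fun_eq_iff)
  then show ?thesis using dominated_integrable[OF dominated_ray[OF assms, of m], of x] by simp
qed

lemma partial_ray:
  assumes "smooth u" "0 \<le> a" "a \<le> b"
  shows "partial i (ray a b m u) x = ray a b (Suc m) (partial i u) x"
proof -
  have "(\<lambda>t. indicator {a..b} t * t ^ m * (indicator {a..b} t * t)) = (\<lambda>t. indicator {a..b} t * t ^ Suc m :: real)"
    by (auto simp: indicator_def fun_eq_iff)
  then show ?thesis
    unfolding ray_param by (subst partial_param) (use assms dominated_ray in auto)
qed

text \<open>Integrates the t-derivative of t^(m+1) u(t x), which splits into the derivative of the
  power and the radial derivative of \<open>u\<close>.\<close>

lemma ray_FTC:
  assumes u: "smooth u" and ab: "0 \<le> a" "a \<le> b"
  shows "real (Suc m) * ray a b m u x + (\<Sum>j\<in>UNIV. x $ j * ray a b (Suc m) (partial j u) x)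
    = b ^ Suc m * u (b *\<^sub>R x) - a ^ Suc m * u (a *\<^sub>R x)"
proof -
  let ?f = "\<lambda>t. real (Suc m) * t ^ m * u (t *\<^sub>R x) + (\<Sum>j\<in>UNIV. t ^ Suc m * (x $ j * partial j u (t *\<^sub>R x)))"
  have du: "((\<lambda>t. u (t *\<^sub>R x)) has_real_derivative (\<Sum>j\<in>UNIV. x $ j * partial j u (t *\<^sub>R x))) (at t)" for t
  proof -
    have "((\<lambda>t. t *\<^sub>R x) has_derivative (\<lambda>s. s *\<^sub>R x)) (at t)"
      by (auto intro!: derivative_eq_intros)
    from has_derivative_compose[OF this smooth_has_derivative[OF u]]
    show ?thesis
      by (rule has_derivative_imp_has_field_derivative) (simp add: sum_distrib_left mult_ac)
  qed
  have deriv: "((\<lambda>t. t ^ Suc m * u (t *\<^sub>R x)) has_real_derivative ?f t) (at t)" for t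
    using DERIV_mult[OF DERIV_pow[of "Suc m" t] du[of t]]
    by (simp add: sum_distrib_left mult_ac)
  have cont: "isCont ?f t" for t
  proof -
    have c: "isCont (\<lambda>t. w (t *\<^sub>R x)) t" if "smooth w" for w
      by (rule isCont_o2[where g = w])
        (use that in \<open>auto intro: differentiable_imp_continuous_within smooth_differentiable\<close>)
    show ?thesis
      by (intro continuous_intros c u smooth_partial)
  qed
  have "(\<integral>t. ?f t * indicator {a..b} t \<partial>lborel) = b ^ Suc m * u (b *\<^sub>R x) - a ^ Suc m * u (a *\<^sub>R x)"
    using ab deriv cont by (intro integral_FTC_Icc_real) auto
  moreover have "?f t * indicator {a..b} t = real (Suc m) * (indicator {a..b} t * t ^ m * u (t *\<^sub>R x))
      + (\<Sum>j\<in>UNIV. x $ j * (indicator {a..b} t * t ^ Suc m * partial j u (t *\<^sub>R x)))" for t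
    by (simp add: algebra_simps sum_distrib_left sum_distrib_right)
  moreover have "integrable lborel (\<lambda>t. indicator {a..b} t * t ^ m * u (t *\<^sub>R x))"
    "integrable lborel (\<lambda>t. indicator {a..b} t * t ^ Suc m * partial j u (t *\<^sub>R x))" for j
    using ray_integrable[OF u ab] ray_integrable[OF smooth_partial[OF u] ab] by blast+
  ultimately show ?thesis
    unfolding ray_def by simp
qed

subsection \<open>Averages over a radial bump\<close>

locale bump =
  fixes phi psi :: "real^3 \<Rightarrow> real"
  assumes phi_test: "phi \<in> test_functions" and psi_test: "psi \<in> test_functions"
    and phi_nonneg: "phi x \<ge> 0"
    and phi_eq_0: "norm x > 1 \<Longrightarrow> phi x = 0"
    and psi_partial: "partial i psi x = - x $ i * phi x"
    and phi_integral: "(\<integral>x. phi x \<partial>lborel) = 1"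

text \<open>Before normalisation psi is exp(-1/(1 - |x|^2)) on the unit ball. Its gradient is -x
  times 2 exp(-1/(1 - |x|^2)) / (1 - |x|^2)^2, and this factor serves as phi. Dividing both
  functions by the integral of phi keeps the relation.\<close>

lemma bump_exists: "\<exists>phi psi. bump phi psi"
proof -
  define psi0 :: "real^3 \<Rightarrow> real" where "psi0 = (\<lambda>x. flat 1 (1 - x \<bullet> x))"
  define phi0 :: "real^3 \<Rightarrow> real" where "phi0 = (\<lambda>x. 2 * flat [:0, 0, 1:] (1 - x \<bullet> x))"
  have psi0: "psi0 \<in> test_functions" unfolding psi0_def by (rule flat_norm_test)
  have phi0: "phi0 \<in> test_functions"
    unfolding phi0_def by (intro test_mult_left flat_norm_test smooth_const)
  have part: "partial i psi0 x = - x $ i * phi0 x" for i x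
    unfolding psi0_def phi0_def by (subst partial_flat_norm) (simp add: mult_ac)
  have nonneg: "phi0 x \<ge> 0" for x
    by (simp add: phi0_def flat_def)
  have vanish: "phi0 x = 0" if "norm x > 1" for x
  proof -
    have "1 < (norm x)\<^sup>2" using that by (intro one_less_power) auto
    then show ?thesis by (simp add: phi0_def flat_def power2_norm_eq_inner)
  qed
  define I where "I = (\<integral>x. phi0 x \<partial>lborel)"
  \<comment> \<open>On the ball of radius 1/2 the quantity 1 - |x|^2 lies in [3/4, 1], so
    \<open>phi0\<close> is at least 2 exp(-4/3) there.\<close>
  have "I > 0"
  proof -
    have "0 < 2 * exp (- 4/3) * measure lborel (cball (0::real^3) (1/2))"
      using content_cball_pos[of "1/2" "0::real^3"] by simp
    also have "\<dots> = (\<integral>x. 2 * exp (- 4/3) * indicator (cball (0::real^3) (1/2)) x \<partial>lborel)"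
      by simp
    also have "\<dots> \<le> I"
      unfolding I_def
    proof (rule integral_mono)
      show "integrable lborel (\<lambda>x. 2 * exp (- 4/3) * indicator (cball (0::real^3) (1/2)) x :: real)"
        using emeasure_lborel_cball_finite[of "0::real^3" "1/2"] by simp
      show "2 * exp (- 4/3) * indicator (cball 0 (1/2)) x \<le> phi0 x" for x
      proof (cases "norm x \<le> 1/2")
        case True
        then have "(norm x)\<^sup>2 \<le> (1/2)\<^sup>2" by (intro power_mono) auto
        then have s: "3/4 \<le> 1 - x \<bullet> x" "1 - x \<bullet> x \<le> 1"
          by (auto simp: power2_norm_eq_inner power_divide)
        have "1 * exp (- 4/3) \<le> (1 / (1 - x \<bullet> x))\<^sup>2 * exp (- 1 / (1 - x \<bullet> x))"
        proof (rule mult_mono)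
          show "1 \<le> (1 / (1 - x \<bullet> x))\<^sup>2" using s by (intro one_le_power) (auto simp: field_simps)
          show "exp (- 4/3) \<le> exp (- 1 / (1 - x \<bullet> x))" using s by (simp add: field_simps)
        qed auto
        with True s show ?thesis
          by (simp add: phi0_def flat_def power2_eq_square)
      qed (use nonneg in auto)
    qed (use phi0 test_integrable in auto)
    finally show ?thesis .
  qed
  have "bump (\<lambda>x. 1 / I * phi0 x) (\<lambda>x. 1 / I * psi0 x)"
  proof
    show "partial i (\<lambda>x. 1 / I * psi0 x) x = - x $ i * (1 / I * phi0 x)" for i x
      using psi0 by (subst partial_cmult) (auto simp: part smooth_differentiable)
    show "(\<integral>x. 1 / I * phi0 x \<partial>lborel) = 1"
      using \<open>I > 0\<close> by (simp flip: I_def)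
    show "(\<lambda>x. 1 / I * phi0 x) \<in> test_functions" "(\<lambda>x. 1 / I * psi0 x) \<in> test_functions"
      by (intro test_mult_left phi0 psi0 smooth_const)+
  qed (use \<open>I > 0\<close> nonneg vanish in auto)
  then show ?thesis by blast
qed

context bump begin

text \<open>The parameter is the reciprocal of a length: \<open>moll t\<close> has mass one and
  lives on the ball of radius 1/t. Large t approximates the identity, small t averages over large
  balls.\<close>

definition moll :: "real \<Rightarrow> real^3 \<Rightarrow> real" where
  "moll t z = t ^ 3 * phi (t *\<^sub>R z)"

text \<open>With extended nonnegative values the average exists for every argument, and integrals
  may be exchanged without integrability conditions.\<close>

definition avg :: "real \<Rightarrow> (real^3 \<Rightarrow> ennreal) \<Rightarrow> real^3 \<Rightarrow> ennreal" where
  "avg t f x = (\<integral>\<^sup>+y. ennreal (moll t (x - y)) * f y \<partial>lborel)"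

lemma phi_measurable [measurable]: "phi \<in> borel_measurable borel"
  using phi_test smooth_borel by auto

lemma moll_measurable [measurable]: "moll t \<in> borel_measurable borel"
  unfolding moll_def by measurable

lemma moll_test: "t \<noteq> 0 \<Longrightarrow> moll t \<in> test_functions"
  using test_mult_left[OF test_affine[OF phi_test, of t 0] smooth_const[of "t^3"]]
  by (simp add: moll_def[abs_def])

lemma moll_nonneg: "t > 0 \<Longrightarrow> moll t z \<ge> 0"
  by (simp add: moll_def phi_nonneg)

lemma moll_eq_0: "t > 0 \<Longrightarrow> norm z > 1 / t \<Longrightarrow> moll t z = 0"
  using phi_eq_0[of "t *\<^sub>R z"] by (simp add: moll_def field_simps)

lemma moll_nn_integral:
  assumes t: "t > 0"
  shows "(\<integral>\<^sup>+y. ennreal (moll t (x - y)) \<partial>lborel) = 1"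
    and "(\<integral>\<^sup>+x. ennreal (moll t (x - y)) \<partial>lborel) = 1"
proof -
  have 1: "(\<integral>\<^sup>+z. ennreal (phi z) \<partial>lborel) = 1"
    using nn_integral_eq_integral[OF test_integrable[OF phi_test]] phi_nonneg phi_integral by simp
  have *: "(\<integral>\<^sup>+y. ennreal (t ^ 3 * phi (a + c *\<^sub>R y)) \<partial>lborel) = 1" if "\<bar>c\<bar> = t" for a c
    using nn_integral_affine3[of "\<lambda>z. ennreal (phi z)" c a] that t 1
    by (auto simp: ennreal_mult' nn_integral_cmult)
  show "(\<integral>\<^sup>+y. ennreal (moll t (x - y)) \<partial>lborel) = 1"
    using *[of "- t" "t *\<^sub>R x"] t by (simp add: moll_def algebra_simps)
  show "(\<integral>\<^sup>+x. ennreal (moll t (x - y)) \<partial>lborel) = 1"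
    using *[of t "- t *\<^sub>R y"] t by (simp add: moll_def algebra_simps)
qed

lemma avg_measurable2 [measurable]:
  assumes [measurable]: "f \<in> borel_measurable borel" "g \<in> borel_measurable M" "h \<in> borel_measurable M"
  shows "(\<lambda>s. avg (g s) f (h s)) \<in> borel_measurable M"
  unfolding avg_def moll_def by measurable

lemma avg_const: "t > 0 \<Longrightarrow> avg t (\<lambda>_. c) x = c"
  by (simp add: avg_def nn_integral_multc moll_nn_integral)

lemma avg_mono: "(\<And>y. f y \<le> g y) \<Longrightarrow> avg t f x \<le> avg t g x"
  unfolding avg_def by (intro nn_integral_mono mult_left_mono) auto

lemma avg_add:
  assumes [measurable]: "f \<in> borel_measurable borel" "g \<in> borel_measurable borel"
  shows "avg t (\<lambda>y. f y + g y) x = avg t f x + avg t g x"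
  unfolding avg_def by (simp add: distrib_left nn_integral_add)

lemma avg_nn_integral:
  assumes [measurable]: "f \<in> borel_measurable borel" and t: "t > 0"
  shows "(\<integral>\<^sup>+x. avg t f x \<partial>lborel) = (\<integral>\<^sup>+x. f x \<partial>lborel)"
proof -
  have "(\<integral>\<^sup>+x. avg t f x \<partial>lborel) = (\<integral>\<^sup>+y. (\<integral>\<^sup>+x. ennreal (moll t (x - y)) * f y \<partial>lborel) \<partial>lborel)"
    unfolding avg_def by (rule lborel_pair.Fubini') simp
  also have "\<dots> = (\<integral>\<^sup>+y. f y \<partial>lborel)"
    using t by (simp add: nn_integral_multc moll_nn_integral)
  finally show ?thesis .
qed

text \<open>Jensen's inequality for the probability density \<open>moll t (x - y)\<close>, obtained
  from Cauchy-Schwarz by splitting the density into two square roots.\<close>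

lemma avg_square:
  assumes [measurable]: "f \<in> borel_measurable borel" and t: "t > 0"
  shows "(avg t f x)\<^sup>2 \<le> avg t (\<lambda>y. (f y)\<^sup>2) x"
proof -
  let ?s = "\<lambda>y. ennreal (sqrt (moll t (x - y)))"
  have s: "?s y * ?s y = ennreal (moll t (x - y))" for y
    using moll_nonneg[OF t] by (simp flip: ennreal_mult)
  have "(avg t f x)\<^sup>2 = (\<integral>\<^sup>+y. ?s y * (?s y * f y) \<partial>lborel)\<^sup>2"
    by (simp add: avg_def s flip: mult.assoc)
  also have "\<dots> \<le> (\<integral>\<^sup>+y. (?s y)\<^sup>2 \<partial>lborel) * (\<integral>\<^sup>+y. (?s y * f y)\<^sup>2 \<partial>lborel)"
    by (rule Cauchy_Schwarz_nn_integral) auto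
  also have "\<dots> = avg t (\<lambda>y. (f y)\<^sup>2) x"
    using moll_nn_integral[OF t] by (simp add: avg_def power_mult_distrib power2_eq_square[of "?s _"] s)
  finally show ?thesis .
qed

lemma avg_square_nn_integral:
  assumes [measurable]: "f \<in> borel_measurable borel" and t: "t > 0"
  shows "(\<integral>\<^sup>+x. (avg t f x)\<^sup>2 \<partial>lborel) \<le> (\<integral>\<^sup>+x. (f x)\<^sup>2 \<partial>lborel)"
proof -
  have "(\<integral>\<^sup>+x. (avg t f x)\<^sup>2 \<partial>lborel) \<le> (\<integral>\<^sup>+x. avg t (\<lambda>y. (f y)\<^sup>2) x \<partial>lborel)"
    by (intro nn_integral_mono avg_square t) simp
  also have "\<dots> = (\<integral>\<^sup>+x. (f x)\<^sup>2 \<partial>lborel)"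
    by (rule avg_nn_integral[OF _ t]) simp
  finally show ?thesis .
qed

definition phi_max :: real where "phi_max = (SOME B. B > 0 \<and> (\<forall>x. phi x \<le> B))"

lemma phi_max: "phi_max > 0" "phi x \<le> phi_max"
proof -
  obtain B where "B \<ge> 0" "\<And>x. \<bar>phi x\<bar> \<le> B" using test_bounded[OF phi_test] by blast
  then have "B + 1 > 0 \<and> (\<forall>x. phi x \<le> B + 1)" by (smt (verit))
  then have "phi_max > 0 \<and> (\<forall>x. phi x \<le> phi_max)"
    unfolding phi_max_def by (rule someI)
  then show "phi_max > 0" "phi x \<le> phi_max" by auto
qed

lemma avg_le:
  assumes [measurable]: "f \<in> borel_measurable borel" and t: "t > 0"
  shows "avg t f x \<le> ennreal (t ^ 3 * phi_max) * (\<integral>\<^sup>+y. f y \<partial>lborel)"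
proof -
  have "avg t f x \<le> (\<integral>\<^sup>+y. ennreal (t ^ 3 * phi_max) * f y \<partial>lborel)"
    unfolding avg_def moll_def using t phi_max
    by (intro nn_integral_mono mult_right_mono ennreal_leI mult_left_mono) auto
  then show ?thesis by (simp add: nn_integral_cmult)
qed

lemma avg_square_le:
  assumes [measurable]: "f \<in> borel_measurable borel" and t: "t > 0"
  shows "(avg t f x)\<^sup>2 \<le> ennreal (t ^ 3 * phi_max) * (\<integral>\<^sup>+y. (f y)\<^sup>2 \<partial>lborel)"
  using order_trans[OF avg_square avg_le] assms by (simp add: t)

text \<open>Holds for every \<open>f\<close>: where the integrand fails to be integrable, the
  Bochner integral on the left is 0 by convention.\<close>

lemma conv_moll_le_avg:
  assumes t: "t > 0"
  shows "ennreal \<bar>conv (moll t) f x\<bar> \<le> avg t (\<lambda>y. ennreal \<bar>f y\<bar>) x"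
proof (cases "integrable lborel (\<lambda>y. f y * moll t (x - y))")
  case True
  have "ennreal \<bar>conv (moll t) f x\<bar> \<le> (\<integral>\<^sup>+y. norm (f y * moll t (x - y)) \<partial>lborel)"
    using integral_norm_bound_ennreal[OF True] by (simp add: conv_def)
  also have "\<dots> = avg t (\<lambda>y. ennreal \<bar>f y\<bar>) x"
    unfolding avg_def using moll_nonneg[OF t]
    by (intro nn_integral_cong) (simp add: abs_mult ennreal_mult mult.commute)
  finally show ?thesis .
qed (simp add: conv_def not_integrable_integral_eq)

end

section \<open>Approximation in L^2 by averages\<close>

definition clamp_real :: "real \<Rightarrow> real \<Rightarrow> real" where
  "clamp_real k a = max (- k) (min k a)"

text \<open>Two approximations, each with squared error below e/4: \<open>f\<close> is clamped to
  [-k, k] and multiplied by a tent-shaped cutoff, then this truncation is replaced by a continuous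
  function. The factor 2 of the squared triangle inequality brings the total below e.\<close>

lemma L2_dense_continuous:
  fixes f :: "real^3 \<Rightarrow> real"
  assumes [measurable]: "f \<in> borel_measurable borel" and int: "integrable lborel (\<lambda>x. (f x)\<^sup>2)" and e: "e > 0"
  obtains g R where "continuous_on UNIV g" "\<And>x. norm x > R \<Longrightarrow> g x = 0"
    "integrable lborel (\<lambda>x. (g x - f x)\<^sup>2)" "(\<integral>x. (g x - f x)\<^sup>2 \<partial>lborel) < e"
proof -
  define cut where "cut k x = max 0 (min 1 (real k + 1 - norm x))" for k and x :: "real^3"
  have cut: "0 \<le> cut k x" "cut k x \<le> 1" for k x by (auto simp: cut_def)
  have cut0: "norm x > real (k + 1) \<Longrightarrow> cut k x = 0" for k x by (auto simp: cut_def)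
  have cut_cont: "continuous_on UNIV (cut k)" for k
    unfolding cut_def by (intro continuous_intros)
  have [measurable]: "cut k \<in> borel_measurable borel" for k
    by (intro borel_measurable_continuous_onI cut_cont)
  define h where "h k x = clamp_real (real k) (f x) * cut k x" for k x
  have [measurable]: "h k \<in> borel_measurable borel" for k
    unfolding h_def clamp_real_def by measurable
  have h_le: "\<bar>h k x\<bar> \<le> \<bar>f x\<bar>" for k x
    unfolding h_def abs_mult
    by (rule order_trans[OF mult_mono[of _ "\<bar>f x\<bar>" _ 1]]) (use cut[of k x] in \<open>auto simp: clamp_real_def\<close>)
  have h_lim: "(\<lambda>k. h k x) \<longlonglongrightarrow> f x" for x
  proof (rule tendsto_eventually)
    obtain K where K: "real K \<ge> norm x" "real K \<ge> \<bar>f x\<bar>"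
      using real_arch_simple[of "max (norm x) \<bar>f x\<bar>"] by auto
    have "h k x = f x" if "k \<ge> K" for k
    proof -
      have "real K \<le> real k" using that by simp
      with K show ?thesis by (auto simp: h_def cut_def clamp_real_def)
    qed
    then show "\<forall>\<^sub>F k in sequentially. h k x = f x"
      by (auto simp: eventually_sequentially)
  qed
  have "(\<lambda>k. \<integral>x. (h k x - f x)\<^sup>2 \<partial>lborel) \<longlonglongrightarrow> (\<integral>x. 0 \<partial>(lborel :: (real^3) measure))"
  proof (rule integral_dominated_convergence)
    show "integrable lborel (\<lambda>x. 4 * (f x)\<^sup>2)" using int by simp
    show "AE x in lborel. (\<lambda>k. (h k x - f x)\<^sup>2) \<longlonglongrightarrow> 0"
    proof (intro AE_I2)
      fix x
      have "(\<lambda>k. (h k x - f x)\<^sup>2) \<longlonglongrightarrow> (f x - f x)\<^sup>2"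
        by (intro tendsto_intros h_lim)
      then show "(\<lambda>k. (h k x - f x)\<^sup>2) \<longlonglongrightarrow> 0" by simp
    qed
    show "AE x in lborel. norm ((h k x - f x)\<^sup>2) \<le> 4 * (f x)\<^sup>2" for k
    proof (intro AE_I2)
      fix x
      have "\<bar>h k x - f x\<bar>\<^sup>2 \<le> (2 * \<bar>f x\<bar>)\<^sup>2"
        using h_le[of k x] by (intro power_mono) auto
      then show "norm ((h k x - f x)\<^sup>2) \<le> 4 * (f x)\<^sup>2" by (simp add: power_mult_distrib)
    qed
  qed auto
  then have "\<forall>\<^sub>F k in sequentially. (\<integral>x. (h k x - f x)\<^sup>2 \<partial>lborel) < e / 4"
    using e by (intro order_tendstoD) auto
  then obtain k where k: "(\<integral>x. (h k x - f x)\<^sup>2 \<partial>lborel) < e / 4"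
    by (auto simp: eventually_sequentially)
  \<comment> \<open>The source of the continuous approximants: \<open>measurable_on\<close> provides
    continuous functions that converge to \<open>f\<close> outside a negligible set.\<close>
  have "f measurable_on UNIV"
    by (rule lebesgue_measurable_imp_measurable_on_real) (auto intro: measurable_completion)
  then obtain N g where N: "negligible N" and g: "\<And>n. continuous_on UNIV (g n)"
    "\<And>x. x \<notin> N \<Longrightarrow> (\<lambda>n. g n x) \<longlonglongrightarrow> f x"
    by (auto simp: measurable_on_def)
  \<comment> \<open>These approximants carry no common bound. Clamping and cutting them with the
    same k as \<open>h k\<close> produces one integrable majorant for the second dominated
    convergence.\<close>
  define q where "q n x = clamp_real (real k) (g n x) * cut k x" for n x
  have q_cont: "continuous_on UNIV (q n)" for n
    unfolding q_def clamp_real_def by (intro continuous_intros g cut_cont)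
  then have [measurable]: "q n \<in> borel_measurable borel" for n
    by (intro borel_measurable_continuous_onI)
  have bounds: "\<bar>q n x\<bar> \<le> real k * indicator (cball 0 (real (k + 1))) x"
     "\<bar>h k x\<bar> \<le> real k * indicator (cball 0 (real (k + 1))) x" for n x
    using cut[of k x] cut0[of k x] mult_mono[of "\<bar>clamp_real (real k) (g n x)\<bar>" "real k" "\<bar>cut k x\<bar>" 1]
      mult_mono[of "\<bar>clamp_real (real k) (f x)\<bar>" "real k" "\<bar>cut k x\<bar>" 1]
    by (auto simp: q_def h_def indicator_def abs_mult clamp_real_def)
  have dom: "\<bar>(q n x - h k x)\<^sup>2\<bar> \<le> (2 * real k)\<^sup>2 * indicator (cball 0 (real (k + 1))) x" for n x
  proof -
    have "\<bar>q n x - h k x\<bar>\<^sup>2 \<le> (2 * real k * indicator (cball 0 (real (k + 1))) x)\<^sup>2"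
      using bounds(1)[of n x] bounds(2)[of x] by (intro power_mono) auto
    then show ?thesis by (cases "norm x \<le> 1 + real k") (simp_all add: power_mult_distrib)
  qed
  have dom_int: "integrable lborel (\<lambda>x. (2 * real k)\<^sup>2 * indicator (cball (0 :: real^3) (real (k + 1))) x :: real)"
    using emeasure_lborel_cball_finite[of "0 :: real^3" "real (k + 1)"] by simp
  have "(\<lambda>n. \<integral>x. (q n x - h k x)\<^sup>2 \<partial>lborel) \<longlonglongrightarrow> (\<integral>x. 0 \<partial>(lborel :: (real^3) measure))"
  proof (rule integral_dominated_convergence[OF _ _ dom_int])
    have "AE x in lebesgue. x \<notin> N"
      using N negligible_iff_null_sets AE_not_in by blast
    then have "AE x in lborel. x \<notin> N"
      by (simp add: AE_completion_iff)
    then show "AE x in lborel. (\<lambda>n. (q n x - h k x)\<^sup>2) \<longlonglongrightarrow> 0"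
    proof eventually_elim
      case (elim x)
      have "(\<lambda>n. q n x) \<longlonglongrightarrow> h k x"
        unfolding q_def h_def clamp_real_def using g(2)[OF elim] by (intro tendsto_intros)
      then have "(\<lambda>n. (q n x - h k x)\<^sup>2) \<longlonglongrightarrow> (h k x - h k x)\<^sup>2"
        by (intro tendsto_intros)
      then show ?case by simp
    qed
    show "AE x in lborel. norm ((q n x - h k x)\<^sup>2) \<le> (2 * real k)\<^sup>2 * indicator (cball 0 (real (k + 1))) x" for n
      using dom by (intro AE_I2) simp
  qed auto
  then have "\<forall>\<^sub>F n in sequentially. (\<integral>x. (q n x - h k x)\<^sup>2 \<partial>lborel) < e / 4"
    using e by (intro order_tendstoD) auto
  then obtain n where n: "(\<integral>x. (q n x - h k x)\<^sup>2 \<partial>lborel) < e / 4"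
    by (auto simp: eventually_sequentially)
  have int1: "integrable lborel (\<lambda>x. (q n x - h k x)\<^sup>2)"
    by (rule Bochner_Integration.integrable_bound[OF dom_int]) (use dom in auto)
  have int2: "integrable lborel (\<lambda>x. (h k x - f x)\<^sup>2)"
  proof (rule Bochner_Integration.integrable_bound)
    show "integrable lborel (\<lambda>x. 4 * (f x)\<^sup>2)" using int by simp
    show "AE x in lborel. norm ((h k x - f x)\<^sup>2) \<le> norm (4 * (f x)\<^sup>2)"
    proof (intro AE_I2)
      fix x
      have "\<bar>h k x - f x\<bar>\<^sup>2 \<le> (2 * \<bar>f x\<bar>)\<^sup>2"
        using h_le[of k x] by (intro power_mono) auto
      then show "norm ((h k x - f x)\<^sup>2) \<le> norm (4 * (f x)\<^sup>2)" by (simp add: power_mult_distrib)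
    qed
  qed auto
  have le: "(q n x - f x)\<^sup>2 \<le> 2 * (q n x - h k x)\<^sup>2 + 2 * (h k x - f x)\<^sup>2" for x
    using sum_squares_ge_zero[of "(q n x - h k x) - (h k x - f x)" 0] by (simp add: power2_eq_square algebra_simps)
  have int3: "integrable lborel (\<lambda>x. (q n x - f x)\<^sup>2)"
    by (rule Bochner_Integration.integrable_bound[where f = "\<lambda>x. 2 * (q n x - h k x)\<^sup>2 + 2 * (h k x - f x)\<^sup>2"])
      (use int1 int2 le in auto)
  show thesis
  proof (rule that[of "q n" "real (k + 1)", OF q_cont _ int3])
    show "q n x = 0" if "norm x > real (k + 1)" for x
      using cut0[OF that] by (simp add: q_def)
    have "(\<integral>x. (q n x - f x)\<^sup>2 \<partial>lborel) \<le> (\<integral>x. 2 * (q n x - h k x)\<^sup>2 + 2 * (h k x - f x)\<^sup>2 \<partial>lborel)"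
      using int1 int2 int3 le by (intro integral_mono) auto
    also have "\<dots> < e" using n k int1 int2 by simp
    finally show "(\<integral>x. (q n x - f x)\<^sup>2 \<partial>lborel) < e" .
  qed
qed

lemma continuous_loc_int:
  assumes "continuous_on UNIV g"
  shows "loc_int g"
  unfolding loc_int_def
proof (intro conjI allI)
  show "g \<in> borel_measurable borel" using assms by (rule borel_measurable_continuous_onI)
  show "integrable lborel (\<lambda>y. indicator (cball 0 R) y * g y)" for R
    using borel_integrable_compact[of "cball 0 R" g, OF compact_cball continuous_on_subset[OF assms subset_UNIV]] by simp
qed

lemma square_int_loc_int:
  assumes fm [measurable]: "f \<in> borel_measurable borel"
    and int: "\<And>R. integrable lborel (\<lambda>x. indicator (cball 0 R) x * (f x)\<^sup>2)"
  shows "loc_int f"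
  unfolding loc_int_def
proof (intro conjI allI)
  fix R
  show "integrable lborel (\<lambda>x. indicator (cball 0 R) x * f x)"
  proof (rule Bochner_Integration.integrable_bound)
    show "integrable lborel (\<lambda>x. indicator (cball 0 R) x + indicator (cball 0 R) x * (f x)\<^sup>2)"
      using int emeasure_lborel_cball_finite[of "0::real^3" R] by auto
    have "\<bar>a\<bar> \<le> 1 + a\<^sup>2" for a :: real
      using sum_squares_ge_zero[of "\<bar>a\<bar> - 1" 0] abs_ge_zero[of a] by (simp add: power2_eq_square algebra_simps)
    then show "AE x in lborel. norm (indicator (cball 0 R) x * f x)
        \<le> norm (indicator (cball 0 R) x + indicator (cball 0 R) x * (f x)\<^sup>2)"
      by (intro AE_I2) (auto simp: indicator_def add_nonneg_nonneg)
  qed (simp add: borel_measurable_times[OF borel_measurable_indicator fm])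
qed simp

lemma integrable_square_loc_int:
  assumes "f \<in> borel_measurable borel" "integrable lborel (\<lambda>x. (f x)\<^sup>2)"
  shows "loc_int f"
  using assms integrable_mult_indicator[of "cball 0 _" lborel "\<lambda>x. (f x)\<^sup>2"]
  by (intro square_int_loc_int) auto

lemma (in bump) conv_moll_uniform:
  assumes g: "continuous_on UNIV g" "\<And>x. norm x > R \<Longrightarrow> g x = 0" and e: "e > 0"
  obtains T where "T \<ge> 1" "\<And>t x. t \<ge> T \<Longrightarrow> \<bar>conv (moll t) g x - g x\<bar> \<le> e"
proof -
  have "uniformly_continuous_on (cball 0 (R + 2)) g"
    by (rule compact_uniformly_continuous) (use g(1) continuous_on_subset in auto)
  then obtain d where d: "d > 0" "\<And>x y. norm x \<le> R + 2 \<Longrightarrow> norm y \<le> R + 2 \<Longrightarrow> dist x y < d \<Longrightarrow> dist (g x) (g y) < e"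
    using e unfolding uniformly_continuous_on_def by (metis mem_cball_0)
  have close: "\<bar>g y - g x\<bar> \<le> e" if "norm (x - y) < min d 1" for x y
  proof (cases "norm x \<le> R + 1")
    case True
    then have "norm y \<le> R + 2"
      using that norm_triangle_ineq4[of x "x - y"] by auto
    with True that d(2)[of y x] show ?thesis by (auto simp: dist_norm norm_minus_commute dist_real_def)
  next
    case False
    then have "norm y > R" using that norm_triangle_ineq[of y "x - y"] by auto
    then show ?thesis using False g(2) e by auto
  qed
  \<comment> \<open>The numerator 2 makes \<open>1 / t < min d 1\<close> strict. The cap at 1 keeps
    the averaged points inside the ball of radius R + 2, where uniform continuity is known.\<close>
  define T where "T = max 1 (2 / min d 1)"
  have gm [measurable]: "g \<in> borel_measurable borel"
    using g(1) by (rule borel_measurable_continuous_onI)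
  have gl: "loc_int g"
    using g(1) by (rule continuous_loc_int)
  show thesis
  proof (rule that[of T])
    show "T \<ge> 1" by (simp add: T_def)
    fix t x assume t: "t \<ge> T"
    then have t0: "t > 0" by (simp add: T_def)
    have t1: "1 / t < min d 1"
    proof -
      have "2 / min d 1 \<le> t" using t by (simp add: T_def)
      then have "2 \<le> t * min d 1" using d by (subst (asm) pos_divide_le_eq) auto
      then have "1 < t * min d 1" by linarith
      then show ?thesis using t0 by (simp add: field_simps del: min_less_iff_conj min_mult_distrib_left)
    qed
    have mi: "integrable lborel (\<lambda>y. moll t (x - y))"
      using conv_integrable[OF test_loc_int[OF smooth_const[of 1]] moll_test[of t]] t0 by simp
    have one: "(\<integral>y. moll t (x - y) \<partial>lborel) = 1"
      using moll_nn_integral(1)[OF t0, of x] moll_nonneg[OF t0] by (simp add: integral_eq_nn_integral)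
    have ci: "integrable lborel (\<lambda>y. g y * moll t (x - y))"
      using conv_integrable[OF gl moll_test] t0 by simp
    have "conv (moll t) g x - g x = (\<integral>y. (g y - g x) * moll t (x - y) \<partial>lborel)"
      using ci mi one by (simp add: conv_def left_diff_distrib)
    also have "\<bar>\<dots>\<bar> \<le> (\<integral>y. e * moll t (x - y) \<partial>lborel)"
    proof (rule order_trans[OF integral_abs_bound integral_mono])
      show "integrable lborel (\<lambda>y. \<bar>(g y - g x) * moll t (x - y)\<bar>)"
        using ci mi by (intro integrable_abs) (simp add: left_diff_distrib)
      show "integrable lborel (\<lambda>y. e * moll t (x - y))" using mi by simp
      show "\<bar>(g y - g x) * moll t (x - y)\<bar> \<le> e * moll t (x - y)" for y
      proof (cases "norm (x - y) > 1 / t")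
        case True
        then show ?thesis using moll_eq_0[OF t0] by simp
      next
        case False
        then have "\<bar>g y - g x\<bar> \<le> e" using t1 by (intro close) simp
        then show ?thesis using moll_nonneg[OF t0, of "x - y"] by (simp add: abs_mult mult_right_mono)
      qed
    qed
    finally show "\<bar>conv (moll t) g x - g x\<bar> \<le> e" using one by simp
  qed
qed

lemma conv_diff:
  assumes "loc_int f" "loc_int g" "K \<in> test_functions"
  shows "conv K f x - conv K g x = conv K (\<lambda>y. f y - g y) x"
  using conv_integrable[of f K x] conv_integrable[of g K x] assms by (simp add: conv_def left_diff_distrib)

lemma (in bump) conv_moll_L2:
  assumes [measurable]: "f \<in> borel_measurable borel" and t: "t > 0"
  shows "(\<integral>\<^sup>+x. ennreal ((conv (moll t) f x)\<^sup>2) \<partial>lborel) \<le> (\<integral>\<^sup>+x. ennreal ((f x)\<^sup>2) \<partial>lborel)"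
proof -
  have "ennreal ((conv (moll t) f x)\<^sup>2) \<le> (avg t (\<lambda>y. ennreal \<bar>f y\<bar>) x)\<^sup>2" for x
    using power_mono[OF conv_moll_le_avg[OF t, of f x], of 2] by (simp add: ennreal_power)
  then have "(\<integral>\<^sup>+x. ennreal ((conv (moll t) f x)\<^sup>2) \<partial>lborel) \<le> (\<integral>\<^sup>+x. (avg t (\<lambda>y. ennreal \<bar>f y\<bar>) x)\<^sup>2 \<partial>lborel)"
    by (intro nn_integral_mono)
  also have "\<dots> \<le> (\<integral>\<^sup>+x. (ennreal \<bar>f x\<bar>)\<^sup>2 \<partial>lborel)"
    by (rule avg_square_nn_integral[OF _ t]) simp
  finally show ?thesis by (simp add: ennreal_power)
qed

text \<open>Averaging contracts L^2, so the claim passes from a dense class to all of L^2. For a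
  continuous compactly supported function the convergence is uniform and the error lives on one
  fixed ball.\<close>

lemma (in bump) conv_moll_tendsto_L2:
  assumes fm [measurable]: "f \<in> borel_measurable borel" and int: "integrable lborel (\<lambda>x. (f x)\<^sup>2)" and e: "e > 0"
  obtains T where "T \<ge> 1" "\<And>t. t \<ge> T \<Longrightarrow> (\<integral>\<^sup>+x. ennreal ((conv (moll t) f x - f x)\<^sup>2) \<partial>lborel) \<le> ennreal e"
proof -
  \<comment> \<open>Three errors enter, and the inequality for the square of a sum of three terms
    costs a factor 3 for each; hence e/9.\<close>
  obtain g R where g: "continuous_on UNIV g" "\<And>x. norm x > R \<Longrightarrow> g x = 0"
    "integrable lborel (\<lambda>x. (g x - f x)\<^sup>2)" "(\<integral>x. (g x - f x)\<^sup>2 \<partial>lborel) < e / 9"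
    using L2_dense_continuous[OF fm int, of "e / 9"] e by auto
  have gm [measurable]: "g \<in> borel_measurable borel"
    using g(1) by (rule borel_measurable_continuous_onI)
  define V where "V = measure lborel (cball (0::real^3) (R + 1))"
  have "V \<ge> 0" by (simp add: V_def)
  define \<delta> where "\<delta> = sqrt (e / (9 * (V + 1)))"
  have \<delta>: "\<delta> > 0" "\<delta>\<^sup>2 * V \<le> e / 9"
    using e \<open>V \<ge> 0\<close> by (auto simp: \<delta>_def field_simps)
  obtain T where T: "T \<ge> 1" "\<And>t x. t \<ge> T \<Longrightarrow> \<bar>conv (moll t) g x - g x\<bar> \<le> \<delta>"
    using conv_moll_uniform[OF g(1,2) \<delta>(1)] by blast
  have gl: "loc_int g"
    using g(1) by (rule continuous_loc_int)
  have fl: "loc_int f" using fm int by (rule integrable_square_loc_int)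
  show thesis
  proof (rule that[OF T(1)])
    fix t assume t: "t \<ge> T"
    then have t0: "t > 0" "t \<ge> 1" using T by auto
    let ?A = "\<lambda>x. (conv (moll t) (\<lambda>y. g y - f y) x)\<^sup>2" and ?B = "\<lambda>x. (conv (moll t) g x - g x)\<^sup>2"
      and ?C = "\<lambda>x. (g x - f x)\<^sup>2"
    have [measurable]: "conv (moll t) g \<in> borel_measurable borel" "conv (moll t) f \<in> borel_measurable borel"
      using smooth_borel smooth_conv[OF _ moll_test] gl fl t0 by auto
    have Cle: "(\<integral>\<^sup>+x. ennreal (?C x) \<partial>lborel) \<le> ennreal (e / 9)"
      using g(3,4) by (simp add: nn_integral_eq_integral ennreal_leI less_imp_le del: less_divide_eq_numeral1 ennreal_le_iff)
    have Ale: "(\<integral>\<^sup>+x. ennreal (?A x) \<partial>lborel) \<le> ennreal (e / 9)"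
      using conv_moll_L2[of "\<lambda>y. g y - f y" t] Cle t0 by auto
    have Ble: "(\<integral>\<^sup>+x. ennreal (?B x) \<partial>lborel) \<le> ennreal (e / 9)"
    proof -
      have "?B x \<le> \<delta>\<^sup>2 * indicator (cball 0 (R + 1)) x" for x
      proof (cases "norm x \<le> R + 1")
        case True
        then show ?thesis using power_mono[OF T(2)[OF t, of x], of 2] by simp
      next
        case False
        have "g y * moll t (x - y) = 0" for y
        proof (cases "norm (x - y) > 1 / t")
          case False
          have "1 / t \<le> 1" using t0 by simp
          then have "norm y > R" using False \<open>\<not> norm x \<le> R + 1\<close> norm_triangle_ineq[of y "x - y"] by simp
          then show ?thesis using g(2) by simp
        qed (use moll_eq_0 t0 in simp)
        then have "(\<lambda>y. g y * moll t (x - y)) = (\<lambda>y. 0)" by (simp only: fun_eq_iff simp_thms)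
        then show ?thesis using False g(2)[of x] by (simp add: conv_def)
      qed
      then have "ennreal (?B x) \<le> ennreal (\<delta>\<^sup>2) * indicator (cball 0 (R + 1)) x" for x
        using ennreal_leI[of "?B x" "\<delta>\<^sup>2 * indicator (cball 0 (R + 1)) x"]
        by (simp add: ennreal_mult'' ennreal_indicator del: indicator_simps)
      then have "(\<integral>\<^sup>+x. ennreal (?B x) \<partial>lborel) \<le> (\<integral>\<^sup>+x. ennreal (\<delta>\<^sup>2) * indicator (cball (0::real^3) (R + 1)) x \<partial>lborel)"
        by (intro nn_integral_mono)
      also have "\<dots> = ennreal (\<delta>\<^sup>2 * V)"
        using emeasure_lborel_cball_finite[of "0::real^3" "R + 1"]
        by (simp add: nn_integral_cmult_indicator V_def ennreal_mult emeasure_eq_ennreal_measure)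
      finally show ?thesis using ennreal_leI[OF \<delta>(2)] by (rule order_trans)
    qed
    have "(conv (moll t) f x - f x)\<^sup>2 \<le> 3 * ?A x + 3 * ?B x + 3 * ?C x" for x
    proof -
      have "conv (moll t) f x - f x = - conv (moll t) (\<lambda>y. g y - f y) x + (conv (moll t) g x - g x) + (g x - f x)"
        using conv_diff[OF gl fl moll_test, of t x] t0 by simp
      moreover have "(- a + b + c)\<^sup>2 \<le> 3 * a\<^sup>2 + 3 * b\<^sup>2 + 3 * c\<^sup>2" for a b c :: real
        using sum_squares_ge_zero[of "a + b" "a + c"] zero_le_power2[of "b - c"]
        by (simp add: power2_eq_square algebra_simps)
      ultimately show ?thesis by metis
    qed
    then have "(\<integral>\<^sup>+x. ennreal ((conv (moll t) f x - f x)\<^sup>2) \<partial>lborel)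
        \<le> (\<integral>\<^sup>+x. 3 * ennreal (?A x) + 3 * ennreal (?B x) + 3 * ennreal (?C x) \<partial>lborel)"
      by (intro nn_integral_mono) (simp flip: ennreal_plus ennreal_mult'' ennreal_numeral add: ennreal_leI)
    also have "\<dots> = 3 * (\<integral>\<^sup>+x. ennreal (?A x) \<partial>lborel) + 3 * (\<integral>\<^sup>+x. ennreal (?B x) \<partial>lborel)
        + 3 * (\<integral>\<^sup>+x. ennreal (?C x) \<partial>lborel)"
      using conv_diff[OF gl fl moll_test, of t] t0
      by (simp add: nn_integral_add nn_integral_cmult flip: conv_diff[OF gl fl moll_test, of t])
    also have "\<dots> \<le> 3 * ennreal (e / 9) + 3 * ennreal (e / 9) + 3 * ennreal (e / 9)"
      using Ale Ble Cle by (intro add_mono mult_left_mono) auto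
    also have "\<dots> = ennreal e"
      using e by (simp flip: ennreal_plus ennreal_mult'' ennreal_numeral)
    finally show "(\<integral>\<^sup>+x. ennreal ((conv (moll t) f x - f x)\<^sup>2) \<partial>lborel) \<le> ennreal e" .
  qed
qed

lemma ennreal_square_le:
  assumes "(x::ennreal)\<^sup>2 \<le> (ennreal c)\<^sup>2" "c \<ge> 0"
  shows "x \<le> ennreal c"
proof (cases x)
  case (real r)
  then have "ennreal (r\<^sup>2) \<le> ennreal (c\<^sup>2)" using assms by (simp add: ennreal_power)
  then have "r\<^sup>2 \<le> c\<^sup>2" by simp
  then show ?thesis using real assms power2_le_imp_le by (simp add: ennreal_leI)
next
  case top
  then have "(top::ennreal) \<le> ennreal (c\<^sup>2)" using assms by (simp add: ennreal_power power2_eq_square ennreal_mult_top ennreal_mult)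
  then show ?thesis using top_unique ennreal_neq_top by blast
qed

section \<open>Truncated Riesz potentials as superpositions of averages\<close>

context bump begin

text \<open>In the length r = 1/t the weight dt/t^2 is dr, so averages over all radii between 1/b
  and 1/a are added up. Without truncation the kernel would be a multiple of 1/|z|^2, the Riesz
  kernel of order one in dimension three.\<close>

definition spread :: "real \<Rightarrow> real \<Rightarrow> (real^3 \<Rightarrow> ennreal) \<Rightarrow> real^3 \<Rightarrow> ennreal" where
  "spread a b f x = (\<integral>\<^sup>+t. ennreal (1 / t\<^sup>2) * indicator {a..b} t * avg t f x \<partial>lborel)"

lemma weight_nn_integral:
  assumes "0 < a" "a \<le> b"
  shows "(\<integral>\<^sup>+t. ennreal (1 / t\<^sup>2) * indicator {a..b} t \<partial>lborel) \<le> ennreal (1 / a)"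
proof -
  have "(\<integral>\<^sup>+t. ennreal (1 / t\<^sup>2) * indicator {a..b} t \<partial>lborel) = ennreal (- 1 / b - - 1 / a)"
    using assms by (intro nn_integral_FTC_Icc) (auto intro!: derivative_eq_intros simp: power2_eq_square)
  also have "\<dots> \<le> ennreal (1 / a)"
    using assms by (intro ennreal_leI) auto
  finally show ?thesis .
qed

lemma spread_measurable [measurable]:
  assumes [measurable]: "f \<in> borel_measurable borel"
  shows "spread a b f \<in> borel_measurable borel"
  unfolding spread_def by measurable

lemma spread_const_le:
  assumes "0 < a" "a \<le> b"
  shows "spread a b (\<lambda>_. c) x \<le> ennreal (1 / a) * c"
proof -
  have "spread a b (\<lambda>_. c) x = (\<integral>\<^sup>+t. ennreal (1 / t\<^sup>2) * indicator {a..b} t * c \<partial>lborel)"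
    unfolding spread_def using assms by (intro nn_integral_cong) (auto simp: indicator_def avg_const)
  also have "\<dots> \<le> ennreal (1 / a) * c"
    using weight_nn_integral[OF assms] by (simp add: nn_integral_multc mult_right_mono)
  finally show ?thesis .
qed

lemma spread_mono: "(\<And>y. f y \<le> g y) \<Longrightarrow> spread a b f x \<le> spread a b g x"
  unfolding spread_def by (intro nn_integral_mono mult_left_mono avg_mono) auto

lemma spread_add:
  assumes [measurable]: "f \<in> borel_measurable borel" "g \<in> borel_measurable borel"
  shows "spread a b (\<lambda>y. f y + g y) x = spread a b f x + spread a b g x"
  unfolding spread_def by (simp add: avg_add distrib_left nn_integral_add)

lemma spread_nn_integral:
  assumes [measurable]: "f \<in> borel_measurable borel" and ab: "0 < a" "a \<le> b"
  shows "(\<integral>\<^sup>+x. spread a b f x \<partial>lborel) \<le> ennreal (1 / a) * (\<integral>\<^sup>+x. f x \<partial>lborel)"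
proof -
  have "(\<integral>\<^sup>+x. spread a b f x \<partial>lborel)
      = (\<integral>\<^sup>+t. \<integral>\<^sup>+x. ennreal (1 / t\<^sup>2) * indicator {a..b} t * avg t f x \<partial>lborel \<partial>lborel)"
    unfolding spread_def by (rule lborel_pair.Fubini') simp
  also have "\<dots> = (\<integral>\<^sup>+t. ennreal (1 / t\<^sup>2) * indicator {a..b} t * (\<integral>\<^sup>+x. f x \<partial>lborel) \<partial>lborel)"
    using ab by (intro nn_integral_cong) (auto simp: indicator_def nn_integral_cmult avg_nn_integral)
  also have "\<dots> \<le> ennreal (1 / a) * (\<integral>\<^sup>+x. f x \<partial>lborel)"
    using weight_nn_integral[OF ab] by (simp add: nn_integral_multc mult_right_mono)
  finally show ?thesis .
qed

text \<open>Cauchy-Schwarz for the measure dt/t^2, whose mass on [a, b] is at most 1/a, followed by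
  Jensen's inequality for each average.\<close>

lemma spread_square:
  assumes [measurable]: "f \<in> borel_measurable borel" and ab: "0 < a" "a \<le> b"
  shows "(spread a b f x)\<^sup>2 \<le> ennreal (1 / a) * spread a b (\<lambda>y. (f y)\<^sup>2) x"
proof -
  let ?w = "\<lambda>t. ennreal (1 / t) * indicator {a..b} t"
  have w: "?w t * ?w t = ennreal (1 / t\<^sup>2) * indicator {a..b} t" for t
    using ab by (auto simp: indicator_def power2_eq_square simp flip: ennreal_mult)
  have w2: "(?w t)\<^sup>2 = ennreal (1 / t\<^sup>2) * indicator {a..b} t" for t
    unfolding power2_eq_square[of "?w t"] w ..
  have w3: "(?w t * c)\<^sup>2 = ennreal (1 / t\<^sup>2) * indicator {a..b} t * c\<^sup>2" for t c
    unfolding power_mult_distrib[of "?w t"] w2 ..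
  have "(spread a b f x)\<^sup>2 = (\<integral>\<^sup>+t. ?w t * (?w t * avg t f x) \<partial>lborel)\<^sup>2"
    unfolding spread_def w[symmetric] by (simp only: mult.assoc)
  also have "\<dots> \<le> (\<integral>\<^sup>+t. (?w t)\<^sup>2 \<partial>lborel) * (\<integral>\<^sup>+t. (?w t * avg t f x)\<^sup>2 \<partial>lborel)"
    by (rule Cauchy_Schwarz_nn_integral) auto
  also have "\<dots> = (\<integral>\<^sup>+t. ennreal (1 / t\<^sup>2) * indicator {a..b} t \<partial>lborel)
      * (\<integral>\<^sup>+t. ennreal (1 / t\<^sup>2) * indicator {a..b} t * (avg t f x)\<^sup>2 \<partial>lborel)"
    by (simp only: w2 w3)
  also have "\<dots> \<le> ennreal (1 / a) * spread a b (\<lambda>y. (f y)\<^sup>2) x"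
  proof (rule mult_mono[OF weight_nn_integral[OF ab]])
    show "(\<integral>\<^sup>+t. ennreal (1 / t\<^sup>2) * indicator {a..b} t * (avg t f x)\<^sup>2 \<partial>lborel) \<le> spread a b (\<lambda>y. (f y)\<^sup>2) x"
      unfolding spread_def
    proof (rule nn_integral_mono)
      show "ennreal (1 / t\<^sup>2) * indicator {a..b} t * (avg t f x)\<^sup>2
          \<le> ennreal (1 / t\<^sup>2) * indicator {a..b} t * avg t (\<lambda>y. (f y)\<^sup>2) x" for t
        using ab by (auto simp: indicator_def intro!: mult_left_mono avg_square)
    qed
  qed auto
  finally show ?thesis .
qed

lemma spread_square_nn_integral:
  assumes [measurable]: "f \<in> borel_measurable borel" and ab: "0 < a" "a \<le> b"
  shows "(\<integral>\<^sup>+x. (spread a b f x)\<^sup>2 \<partial>lborel) \<le> ennreal (1 / a\<^sup>2) * (\<integral>\<^sup>+x. (f x)\<^sup>2 \<partial>lborel)"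
proof -
  have "(\<integral>\<^sup>+x. (spread a b f x)\<^sup>2 \<partial>lborel) \<le> (\<integral>\<^sup>+x. ennreal (1 / a) * spread a b (\<lambda>y. (f y)\<^sup>2) x \<partial>lborel)"
    by (intro nn_integral_mono spread_square ab) simp
  also have "\<dots> = ennreal (1 / a) * (\<integral>\<^sup>+x. spread a b (\<lambda>y. (f y)\<^sup>2) x \<partial>lborel)"
    by (rule nn_integral_cmult) simp
  also have "\<dots> \<le> ennreal (1 / a) * (ennreal (1 / a) * (\<integral>\<^sup>+x. (f x)\<^sup>2 \<partial>lborel))"
    by (intro mult_left_mono spread_nn_integral ab) auto
  also have "\<dots> = ennreal (1 / a\<^sup>2) * (\<integral>\<^sup>+x. (f x)\<^sup>2 \<partial>lborel)"
    using ab by (simp add: power2_eq_square flip: mult.assoc ennreal_mult)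
  finally show ?thesis .
qed

text \<open>An average with parameter t of a function of L^2 norm N is at most sqrt(t^3 phi_max) N.
  Against dt/t^2 this leaves t^(-1/2), which is integrable at 0, so the bound depends on
  \<open>b\<close> alone and \<open>a\<close> may tend to 0 later.\<close>

lemma spread_le:
  assumes [measurable]: "f \<in> borel_measurable borel" and ab: "0 < a" "a \<le> b"
    and N: "N \<ge> 0" "(\<integral>\<^sup>+y. (f y)\<^sup>2 \<partial>lborel) \<le> ennreal (N\<^sup>2)"
  shows "spread a b f x \<le> ennreal (2 * sqrt (b * phi_max) * N)"
proof -
  have avg: "avg t f x \<le> ennreal (sqrt (t ^ 3 * phi_max) * N)" if t: "t > 0" for t
  proof -
    have "(avg t f x)\<^sup>2 \<le> ennreal (t ^ 3 * phi_max) * ennreal (N\<^sup>2)"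
      using avg_square_le[OF assms(1) t, of x] N(2) by (meson mult_left_mono order_trans zero_le)
    also have "\<dots> = (ennreal (sqrt (t ^ 3 * phi_max) * N))\<^sup>2"
      using t phi_max N by (simp add: ennreal_power power_mult_distrib flip: ennreal_mult)
    finally show ?thesis
      by (rule ennreal_square_le) (use t phi_max N in auto)
  qed
  have "spread a b f x \<le> (\<integral>\<^sup>+t. ennreal (sqrt phi_max * N) * (ennreal (1 / sqrt t) * indicator {a..b} t) \<partial>lborel)"
    unfolding spread_def
  proof (rule nn_integral_mono)
    fix t
    show "ennreal (1 / t\<^sup>2) * indicator {a..b} t * avg t f x
        \<le> ennreal (sqrt phi_max * N) * (ennreal (1 / sqrt t) * indicator {a..b} t)"
    proof (cases "t \<in> {a..b}")
      case True
      then have t: "t > 0" using ab by auto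
      have "sqrt (t ^ 3) = t * sqrt t"
        using t by (simp add: power3_eq_cube real_sqrt_mult)
      then have "1 / t\<^sup>2 * sqrt (t ^ 3) = 1 / t * sqrt t"
        using t by (simp add: power2_eq_square)
      also have "\<dots> = 1 / sqrt t"
        using t by (simp add: field_simps)
      finally have s: "1 / t\<^sup>2 * sqrt (t ^ 3) = 1 / sqrt t" .
      have r: "1 / t\<^sup>2 * (sqrt (t ^ 3 * phi_max) * N) = (sqrt phi_max * N) * (1 / sqrt t)"
      proof -
        have "1 / t\<^sup>2 * (sqrt (t ^ 3 * phi_max) * N) = (1 / t\<^sup>2 * sqrt (t ^ 3)) * (sqrt phi_max * N)"
          by (simp only: real_sqrt_mult mult.assoc)
        then show ?thesis unfolding s by (simp only: mult.commute)
      qed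
      have "ennreal (1 / t\<^sup>2) * avg t f x \<le> ennreal (1 / t\<^sup>2) * ennreal (sqrt (t ^ 3 * phi_max) * N)"
        by (intro mult_left_mono avg t) auto
      also have "\<dots> = ennreal (1 / t\<^sup>2 * (sqrt (t ^ 3 * phi_max) * N))"
        by (rule ennreal_mult'[symmetric]) simp
      also have "\<dots> = ennreal (sqrt phi_max * N) * ennreal (1 / sqrt t)"
        unfolding r by (rule ennreal_mult'') (use t in simp)
      finally show ?thesis using True by simp
    qed simp
  qed
  also have "\<dots> = ennreal (sqrt phi_max * N) * (\<integral>\<^sup>+t. ennreal (1 / sqrt t) * indicator {a..b} t \<partial>lborel)"
    by (rule nn_integral_cmult) simp
  also have "(\<integral>\<^sup>+t. ennreal (1 / sqrt t) * indicator {a..b} t \<partial>lborel) = ennreal (2 * sqrt b - 2 * sqrt a)"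
    using ab by (intro nn_integral_FTC_Icc) (auto intro!: derivative_eq_intros simp: field_simps)
  also have "ennreal (sqrt phi_max * N) * \<dots> \<le> ennreal (sqrt phi_max * N) * ennreal (2 * sqrt b)"
    using ab by (intro mult_left_mono ennreal_leI) auto
  also have "\<dots> = ennreal (2 * sqrt (b * phi_max) * N)"
    using ab by (subst ennreal_mult''[symmetric]) (auto simp: real_sqrt_mult mult_ac)
  finally show ?thesis .
qed

lemma partial_ray_psi:
  assumes "0 < a" "a \<le> b"
  shows "partial j (ray a b 0 psi) = (\<lambda>x. - x $ j * ray a b 2 phi x)"
proof
  fix x
  have "partial j (ray a b 0 psi) x = (\<integral>t. indicator {a..b} t * t ^ 1 * (- (t *\<^sub>R x) $ j * phi (t *\<^sub>R x)) \<partial>lborel)"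
    using assms psi_test psi_partial by (subst partial_ray) (auto simp: ray_def)
  also have "\<dots> = (\<integral>t. - x $ j * (indicator {a..b} t * t ^ 2 * phi (t *\<^sub>R x)) \<partial>lborel)"
    by (intro Bochner_Integration.integral_cong) (auto simp: power2_eq_square)
  finally show "partial j (ray a b 0 psi) x = - x $ j * ray a b 2 phi x"
    by (simp add: ray_def)
qed

text \<open>Since the gradient is -x times \<open>ray a b 2 phi\<close>, the Laplacian is minus the
  integral of 3 t^2 phi(t x) + t^3 x . grad phi(t x), that is of the t-derivative of t^3 phi(t x).
  The dimension 3 is exactly the factor m + 1 of \<open>ray_FTC\<close> for m = 2.\<close>

lemma laplacian_ray_psi:
  assumes "0 < a" "a \<le> b"
  shows "(\<Sum>j\<in>UNIV. partial j (partial j (ray a b 0 psi)) x) = moll a x - moll b x"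
proof -
  have s: "smooth (ray a b 2 phi)" using assms phi_test by (auto intro: smooth_ray)
  have "partial j (partial j (ray a b 0 psi)) x = - ray a b 2 phi x - x $ j * ray a b 3 (partial j phi) x" for j
  proof -
    have "partial j (partial j (ray a b 0 psi)) x = partial j (\<lambda>x. (- x $ j) * ray a b 2 phi x) x"
      using assms by (simp add: partial_ray_psi)
    also have "\<dots> = (- x $ j) * partial j (ray a b 2 phi) x + partial j (\<lambda>x. - x $ j) x * ray a b 2 phi x"
      by (intro partial_mult smooth_differentiable s smooth_uminus smooth_nth)
    also have "partial j (\<lambda>x. - x $ j) x = -1"
      by (subst partial_uminus) (auto simp: partial_nth smooth_differentiable)
    also have "partial j (ray a b 2 phi) x = ray a b 3 (partial j phi) x"
      using assms phi_test by (subst partial_ray) (auto simp: numeral_3_eq_3)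
    finally show ?thesis by simp
  qed
  then have "(\<Sum>j\<in>UNIV. partial j (partial j (ray a b 0 psi)) x)
      = - (3 * ray a b 2 phi x + (\<Sum>j\<in>UNIV. x $ j * ray a b 3 (partial j phi) x))"
    by (simp add: sum_subtractf sum_negf)
  also have "\<dots> = moll a x - moll b x"
    using ray_FTC[of phi a b 2 x] assms phi_test by (auto simp: moll_def numeral_3_eq_3)
  finally show ?thesis .
qed

lemma ray_psi_test:
  assumes "0 < a" "a \<le> b"
  shows "ray a b 0 psi \<in> test_functions"
proof -
  obtain R where R: "\<And>x. norm x > R \<Longrightarrow> psi x = 0" using psi_test by (auto simp: test_iff)
  show ?thesis
  proof (rule testI)
    show "smooth (ray a b 0 psi)" using assms psi_test by (auto intro: smooth_ray)
    fix x :: "real^3" assume "norm x > \<bar>R\<bar> / a"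
    then have x: "\<bar>R\<bar> < a * norm x" using assms by (simp add: field_simps)
    have "indicator {a..b} t * t ^ 0 * psi (t *\<^sub>R x) = 0" for t
    proof (cases "t \<in> {a..b}")
      case True
      then have "a * norm x \<le> \<bar>t\<bar> * norm x" by (intro mult_right_mono) auto
      then show ?thesis using x by (intro mult_eq_0_iff[THEN iffD2] disjI2 R) simp
    qed simp
    then have "(\<lambda>t. indicator {a..b} t * t ^ 0 * psi (t *\<^sub>R x)) = (\<lambda>t. 0)" by (simp only: fun_eq_iff simp_thms)
    then show "ray a b 0 psi x = 0" by (simp only: ray_def Bochner_Integration.integral_zero)
  qed
qed

lemma partial_ray_psi_le:
  assumes "0 < a" "a \<le> b"
  shows "ennreal \<bar>partial j (ray a b 0 psi) z\<bar>
    \<le> (\<integral>\<^sup>+t. ennreal (1 / t\<^sup>2) * indicator {a..b} t * ennreal (moll t z) \<partial>lborel)"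
proof -
  have int: "integrable lborel (\<lambda>t. - z $ j * (indicator {a..b} t * t ^ 2 * phi (t *\<^sub>R z)))"
    using ray_integrable[of phi a b 2 z] assms phi_test by auto
  have "ennreal \<bar>partial j (ray a b 0 psi) z\<bar> = ennreal (norm (\<integral>t. - z $ j * (indicator {a..b} t * t ^ 2 * phi (t *\<^sub>R z)) \<partial>lborel))"
    using assms by (simp add: partial_ray_psi ray_def)
  also have "\<dots> \<le> (\<integral>\<^sup>+t. ennreal (norm (- z $ j * (indicator {a..b} t * t ^ 2 * phi (t *\<^sub>R z)))) \<partial>lborel)"
    by (rule integral_norm_bound_ennreal[OF int])
  also have "\<dots> \<le> (\<integral>\<^sup>+t. ennreal (1 / t\<^sup>2) * indicator {a..b} t * ennreal (moll t z) \<partial>lborel)"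
  proof (rule nn_integral_mono)
    fix t
    show "ennreal (norm (- z $ j * (indicator {a..b} t * t ^ 2 * phi (t *\<^sub>R z))))
      \<le> ennreal (1 / t\<^sup>2) * indicator {a..b} t * ennreal (moll t z)"
    proof (cases "t \<in> {a..b}")
      case True
      then have t: "t > 0" using assms by auto
      have "\<bar>z $ j\<bar> * t ^ 2 * phi (t *\<^sub>R z) \<le> t * phi (t *\<^sub>R z)"
      proof (cases "norm (t *\<^sub>R z) > 1")
        case False
        then have "t * norm z \<le> 1" using t by simp
        moreover have "t * \<bar>z $ j\<bar> \<le> t * norm z"
          using t by (intro mult_left_mono component_le_norm_cart) auto
        ultimately have "t * \<bar>z $ j\<bar> \<le> 1"
          by linarith
        then have "(t * \<bar>z $ j\<bar>) * (t * phi (t *\<^sub>R z)) \<le> 1 * (t * phi (t *\<^sub>R z))"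
          using t phi_nonneg by (intro mult_right_mono) auto
        then show ?thesis by (simp add: power2_eq_square mult_ac)
      qed (simp add: phi_eq_0)
      also have "\<dots> = 1 / t\<^sup>2 * moll t z"
        using t by (simp add: moll_def power2_eq_square power3_eq_cube)
      finally show ?thesis
        using True t phi_nonneg by (simp add: abs_mult ennreal_leI flip: ennreal_mult')
    qed simp
  qed
  finally show ?thesis .
qed

end

subsection \<open>Fields with square-integrable curl\<close>

lemma abs_conv_le:
  "ennreal \<bar>conv K f x\<bar> \<le> (\<integral>\<^sup>+y. ennreal \<bar>K (x - y)\<bar> * ennreal \<bar>f y\<bar> \<partial>lborel)"
proof (cases "integrable lborel (\<lambda>y. f y * K (x - y))")
  case True
  have "ennreal \<bar>conv K f x\<bar> \<le> (\<integral>\<^sup>+y. norm (f y * K (x - y)) \<partial>lborel)"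
    using integral_norm_bound_ennreal[OF True] by (simp add: conv_def)
  also have "\<dots> = (\<integral>\<^sup>+y. ennreal \<bar>K (x - y)\<bar> * ennreal \<bar>f y\<bar> \<partial>lborel)"
    by (intro nn_integral_cong) (simp add: abs_mult ennreal_mult mult.commute)
  finally show ?thesis .
qed (simp add: conv_def not_integrable_integral_eq)

lemma test_reflect:
  assumes "K \<in> test_functions"
  shows "(\<lambda>y. K (x - y)) \<in> test_functions" and "partial j (\<lambda>y. K (x - y)) = (\<lambda>y. - partial j K (x - y))"
proof -
  have *: "(\<lambda>y. K (x - y)) = (\<lambda>y. K ((-1) *\<^sub>R y + x))" by simp
  show "(\<lambda>y. K (x - y)) \<in> test_functions" unfolding * using assms by (intro test_affine) auto
  show "partial j (\<lambda>y. K (x - y)) = (\<lambda>y. - partial j K (x - y))"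
    using partial_affine[of K "-1" _ x j] assms by (simp add: fun_eq_iff smooth_differentiable test_smooth)
qed

text \<open>The curl is kept as an antisymmetric matrix instead of a vector, so that renaming the
  indices of a double sum does the work of vector calculus. Both differential conditions are imposed
  against test functions, as no derivative of \<open>v\<close> is given as a function.\<close>

locale curl_system = bump +
  fixes v :: "3 \<Rightarrow> real^3 \<Rightarrow> real" and W :: "3 \<Rightarrow> 3 \<Rightarrow> real^3 \<Rightarrow> real"
  assumes v_borel [measurable]: "v i \<in> borel_measurable borel"
    and v_L2_loc: "integrable lborel (\<lambda>x. indicator (cball 0 R) x * (v i x)\<^sup>2)"
    and W_borel [measurable]: "W j i \<in> borel_measurable borel"
    and W_L2: "integrable lborel (\<lambda>x. (W j i x)\<^sup>2)"
    and W_antisym: "W i j x = - W j i x"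
    and weak_div: "\<theta> \<in> test_functions \<Longrightarrow> (\<Sum>j\<in>UNIV. \<integral>x. v j x * partial j \<theta> x \<partial>lborel) = 0"
    and weak_curl: "\<theta> \<in> test_functions \<Longrightarrow>
      (\<integral>x. v i x * partial j \<theta> x \<partial>lborel) - (\<integral>x. v j x * partial i \<theta> x \<partial>lborel) = - (\<integral>x. W j i x * \<theta> x \<partial>lborel)"
begin

lemma v_loc_int: "loc_int (v i)"
  using v_borel v_L2_loc by (rule square_int_loc_int)

lemma W_loc_int: "loc_int (W j i)"
  using W_borel W_L2 by (rule integrable_square_loc_int)

text \<open>The weak form of: the Laplacian of v_i is the sum over j of d_j W_ji plus d_i of the
  divergence, which vanishes. Exchanging the two derivatives of \<theta> is what makes the
  divergence appear.\<close>

lemma weak_laplacian: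
  assumes "\<theta> \<in> test_functions"
  shows "(\<integral>x. v i x * (\<Sum>j\<in>UNIV. partial j (partial j \<theta>) x) \<partial>lborel) = - (\<Sum>j\<in>UNIV. \<integral>x. W j i x * partial j \<theta> x \<partial>lborel)"
proof -
  have "(\<integral>x. v i x * (\<Sum>j\<in>UNIV. partial j (partial j \<theta>) x) \<partial>lborel)
      = (\<Sum>j\<in>UNIV. \<integral>x. v i x * partial j (partial j \<theta>) x \<partial>lborel)"
    unfolding sum_distrib_left using assms
    by (intro Bochner_Integration.integral_sum loc_int_test v_loc_int test_partial)
  also have "\<dots> = (\<Sum>j\<in>UNIV. (\<integral>x. v j x * partial j (partial i \<theta>) x \<partial>lborel) - (\<integral>x. W j i x * partial j \<theta> x \<partial>lborel))"
  proof (rule sum.cong[OF refl])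
    fix j
    have "partial i (partial j \<theta>) = partial j (partial i \<theta>)"
      using assms by (intro ext partial_commute) auto
    then show "(\<integral>x. v i x * partial j (partial j \<theta>) x \<partial>lborel)
        = (\<integral>x. v j x * partial j (partial i \<theta>) x \<partial>lborel) - (\<integral>x. W j i x * partial j \<theta> x \<partial>lborel)"
      using weak_curl[OF test_partial[OF assms], of i j j] by simp
  qed
  also have "\<dots> = - (\<Sum>j\<in>UNIV. \<integral>x. W j i x * partial j \<theta> x \<partial>lborel)"
    using weak_div[OF test_partial[OF assms]] by (simp add: sum_subtractf)
  finally show ?thesis .
qed

definition V :: "real \<Rightarrow> 3 \<Rightarrow> real^3 \<Rightarrow> real" where
  "V t i = conv (moll t) (v i)"

definition Wabs :: "real^3 \<Rightarrow> ennreal" where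
  "Wabs x = (\<Sum>i\<in>UNIV. \<Sum>j\<in>UNIV. ennreal \<bar>W j i x\<bar>)"

lemma Wabs_measurable [measurable]: "Wabs \<in> borel_measurable borel"
  unfolding Wabs_def by measurable

lemma V_smooth: "t \<noteq> 0 \<Longrightarrow> smooth (V t i)"
  unfolding V_def by (intro smooth_conv v_loc_int moll_test)

lemma V_measurable [measurable]: "V t i \<in> borel_measurable borel"
  unfolding V_def conv_def by measurable

text \<open>The test function is the truncated potential, reflected and centred at \<open>x\<close>.
  Its Laplacian is the difference of the two averaging kernels; \<open>weak_laplacian\<close> trades
  it for first derivatives of the potential paired with \<open>W\<close>, and the gradient bound
  turns these into averages of |W|.\<close>

lemma V_diff:
  assumes ab: "0 < a" "a \<le> b"
  shows "ennreal \<bar>V a i x - V b i x\<bar> \<le> spread a b Wabs x"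
proof -
  let ?\<Psi> = "ray a b 0 psi"
  let ?\<theta> = "\<lambda>y. ?\<Psi> (x - y)"
  have t: "?\<Psi> \<in> test_functions" using ab by (rule ray_psi_test)
  have "V a i x - V b i x = (\<integral>y. v i y * (moll a (x - y) - moll b (x - y)) \<partial>lborel)"
    using conv_integrable[OF v_loc_int moll_test] ab by (simp add: V_def conv_def right_diff_distrib)
  also have "\<dots> = (\<integral>y. v i y * (\<Sum>j\<in>UNIV. partial j (partial j ?\<theta>) y) \<partial>lborel)"
  proof (rule Bochner_Integration.integral_cong[OF refl])
    fix y
    have "partial j (partial j ?\<theta>) y = partial j (partial j ?\<Psi>) (x - y)" for j
    proof -
      have "partial j (partial j ?\<theta>) y = - partial j (\<lambda>y. partial j ?\<Psi> (x - y)) y"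
        using test_reflect[OF t] test_reflect(1)[OF test_partial[OF t]]
        by (simp add: partial_uminus smooth_differentiable test_smooth)
      then show ?thesis by (simp add: test_reflect(2)[OF test_partial[OF t]])
    qed
    then show "v i y * (moll a (x - y) - moll b (x - y)) = v i y * (\<Sum>j\<in>UNIV. partial j (partial j ?\<theta>) y)"
      using laplacian_ray_psi[OF ab] by simp
  qed
  also have "\<dots> = - (\<Sum>j\<in>UNIV. \<integral>y. W j i y * partial j ?\<theta> y \<partial>lborel)"
    by (rule weak_laplacian[OF test_reflect(1)[OF t]])
  also have "\<dots> = (\<Sum>j\<in>UNIV. conv (partial j ?\<Psi>) (W j i) x)"
    by (simp add: test_reflect(2)[OF t] conv_def sum_negf)
  finally have "ennreal \<bar>V a i x - V b i x\<bar> \<le> ennreal (\<Sum>j\<in>UNIV. \<bar>conv (partial j ?\<Psi>) (W j i) x\<bar>)"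
    by (intro ennreal_leI) (simp add: sum_abs)
  also have "\<dots> = (\<Sum>j\<in>UNIV. ennreal \<bar>conv (partial j ?\<Psi>) (W j i) x\<bar>)"
    by (simp add: sum_ennreal)
  also have "\<dots> \<le> (\<Sum>j\<in>UNIV. \<integral>\<^sup>+y. ennreal \<bar>partial j ?\<Psi> (x - y)\<bar> * ennreal \<bar>W j i y\<bar> \<partial>lborel)"
    by (intro sum_mono abs_conv_le)
  also have "\<dots> \<le> (\<Sum>j\<in>UNIV. \<integral>\<^sup>+y. (\<integral>\<^sup>+t. ennreal (1 / t\<^sup>2) * indicator {a..b} t * ennreal (moll t (x - y)) \<partial>lborel) * ennreal \<bar>W j i y\<bar> \<partial>lborel)"
    by (intro sum_mono nn_integral_mono mult_right_mono partial_ray_psi_le ab) auto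
  also have "\<dots> = (\<integral>\<^sup>+y. (\<integral>\<^sup>+t. ennreal (1 / t\<^sup>2) * indicator {a..b} t * ennreal (moll t (x - y)) \<partial>lborel) * (\<Sum>j\<in>UNIV. ennreal \<bar>W j i y\<bar>) \<partial>lborel)"
    unfolding sum_distrib_left by (rule nn_integral_sum[symmetric]) (simp add: moll_def)
  also have "\<dots> \<le> (\<integral>\<^sup>+y. (\<integral>\<^sup>+t. ennreal (1 / t\<^sup>2) * indicator {a..b} t * ennreal (moll t (x - y)) \<partial>lborel) * Wabs y \<partial>lborel)"
  proof (intro nn_integral_mono mult_left_mono)
    show "(\<Sum>j\<in>UNIV. ennreal \<bar>W j i y\<bar>) \<le> Wabs y" for y
      unfolding Wabs_def by (rule member_le_sum) (auto intro: sum_nonneg)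
  qed auto
  also have "\<dots> = (\<integral>\<^sup>+y. \<integral>\<^sup>+t. ennreal (1 / t\<^sup>2) * indicator {a..b} t * ennreal (moll t (x - y)) * Wabs y \<partial>lborel \<partial>lborel)"
    by (intro nn_integral_cong nn_integral_multc[symmetric]) (simp add: moll_def)
  also have "\<dots> = (\<integral>\<^sup>+t. \<integral>\<^sup>+y. ennreal (1 / t\<^sup>2) * indicator {a..b} t * ennreal (moll t (x - y)) * Wabs y \<partial>lborel \<partial>lborel)"
    by (rule lborel_pair.Fubini') (simp add: moll_def)
  also have "\<dots> = spread a b Wabs x"
    unfolding spread_def avg_def
    by (intro nn_integral_cong) (simp add: nn_integral_cmult mult.assoc moll_def)
  finally show ?thesis .
qed

text \<open>An upper bound for the L^2 norm of \<open>Wabs\<close>. The summand 1 keeps it positive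
  even when there is no vorticity.\<close>

definition wnorm :: real where
  "wnorm = sqrt (enn2real (\<integral>\<^sup>+x. (Wabs x)\<^sup>2 \<partial>lborel)) + 1"

lemma wnorm: "wnorm > 0" "(\<integral>\<^sup>+x. (Wabs x)\<^sup>2 \<partial>lborel) \<le> ennreal (wnorm\<^sup>2)"
proof -
  have sq: "(\<Sum>i\<in>S. f i)\<^sup>2 \<le> real (card S) * (\<Sum>i\<in>S. (f i)\<^sup>2)" for f :: "3 \<Rightarrow> real" and S
    using Cauchy_Schwarz_ineq_sum[of "\<lambda>i. 1" f S] by simp
  have "(Wabs x)\<^sup>2 \<le> ennreal (\<Sum>i\<in>UNIV. \<Sum>j\<in>UNIV. 9 * (W j i x)\<^sup>2)" for x
  proof -
    have "Wabs x = ennreal (\<Sum>i\<in>UNIV. \<Sum>j\<in>UNIV. \<bar>W j i x\<bar>)"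
      by (simp add: Wabs_def sum_ennreal sum_nonneg)
    moreover have "(\<Sum>i\<in>UNIV. \<Sum>j\<in>UNIV. \<bar>W j i x\<bar>)\<^sup>2 \<le> (\<Sum>i\<in>UNIV. \<Sum>j\<in>UNIV. 9 * (W j i x)\<^sup>2)"
    proof -
      have "(\<Sum>i\<in>UNIV. \<Sum>j\<in>UNIV. \<bar>W j i x\<bar>)\<^sup>2 \<le> 3 * (\<Sum>i\<in>UNIV. (\<Sum>j\<in>UNIV. \<bar>W j i x\<bar>)\<^sup>2)"
        using sq[of "\<lambda>i. \<Sum>j\<in>UNIV. \<bar>W j i x\<bar>" UNIV] by simp
      also have "\<dots> \<le> 3 * (\<Sum>i\<in>UNIV. 3 * (\<Sum>j\<in>UNIV. (W j i x)\<^sup>2))"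
        using sq[of "\<lambda>j. \<bar>W j _ x\<bar>" UNIV] by (intro mult_left_mono sum_mono) auto
      finally show ?thesis by (simp add: sum_distrib_left)
    qed
    ultimately show ?thesis
      by (simp add: ennreal_power sum_nonneg ennreal_leI)
  qed
  then have "(\<integral>\<^sup>+x. (Wabs x)\<^sup>2 \<partial>lborel) \<le> (\<integral>\<^sup>+x. ennreal (\<Sum>i\<in>UNIV. \<Sum>j\<in>UNIV. 9 * (W j i x)\<^sup>2) \<partial>lborel)"
    by (intro nn_integral_mono)
  also have "\<dots> < \<infinity>"
    using W_L2 by (subst nn_integral_eq_integral) (auto simp: sum_nonneg)
  finally have fin: "(\<integral>\<^sup>+x. (Wabs x)\<^sup>2 \<partial>lborel) < \<infinity>" .
  show "wnorm > 0" unfolding wnorm_def by (smt (verit) real_sqrt_ge_zero enn2real_nonneg)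
  let ?I = "enn2real (\<integral>\<^sup>+x. (Wabs x)\<^sup>2 \<partial>lborel)"
  have "?I = (sqrt ?I)\<^sup>2" by simp
  also have "\<dots> \<le> wnorm\<^sup>2" unfolding wnorm_def by (intro power_mono) auto
  finally show "(\<integral>\<^sup>+x. (Wabs x)\<^sup>2 \<partial>lborel) \<le> ennreal (wnorm\<^sup>2)"
    using fin by (metis ennreal_enn2real ennreal_leI infinity_ennreal_def)
qed

lemma V_diff_le:
  assumes "0 < a" "a \<le> b"
  shows "\<bar>V a i x - V b i x\<bar> \<le> 2 * sqrt (b * phi_max) * wnorm"
proof -
  have "ennreal \<bar>V a i x - V b i x\<bar> \<le> ennreal (2 * sqrt (b * phi_max) * wnorm)"
    using V_diff[OF assms] spread_le[OF Wabs_measurable assms less_imp_le[OF wnorm(1)] wnorm(2)] by (rule order_trans)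
  then show ?thesis
    using assms phi_max(1) wnorm(1) by (subst (asm) ennreal_le_iff) auto
qed

text \<open>Uniform in \<open>b\<close>, so that \<open>b\<close> may tend to infinity, whereas
  \<open>V_diff_le\<close> is uniform in \<open>a\<close>, which may tend to 0.\<close>

lemma V_diff_L2:
  assumes "0 < a" "a \<le> b"
  shows "(\<integral>\<^sup>+x. ennreal ((V a i x - V b i x)\<^sup>2) \<partial>lborel) \<le> ennreal ((wnorm / a)\<^sup>2)"
proof -
  have "ennreal ((V a i x - V b i x)\<^sup>2) \<le> (spread a b Wabs x)\<^sup>2" for x
    using power_mono[OF V_diff[OF assms, of i x], of 2] by (simp add: ennreal_power)
  then have "(\<integral>\<^sup>+x. ennreal ((V a i x - V b i x)\<^sup>2) \<partial>lborel) \<le> (\<integral>\<^sup>+x. (spread a b Wabs x)\<^sup>2 \<partial>lborel)"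
    by (intro nn_integral_mono)
  also have "\<dots> \<le> ennreal (1 / a\<^sup>2) * (\<integral>\<^sup>+x. (Wabs x)\<^sup>2 \<partial>lborel)"
    by (intro spread_square_nn_integral assms Wabs_measurable)
  also have "\<dots> \<le> ennreal (1 / a\<^sup>2) * ennreal (wnorm\<^sup>2)"
    by (intro mult_left_mono wnorm) auto
  also have "\<dots> = ennreal ((wnorm / a)\<^sup>2)"
    by (simp add: power_divide flip: ennreal_mult)
  finally show ?thesis .
qed

end

text \<open>Monotone convergence along balls; it lets global bounds be proved where only local
  square integrability is at hand.\<close>

lemma nn_integral_le_of_cball:
  fixes f :: "real^3 \<Rightarrow> ennreal"
  assumes [measurable]: "f \<in> borel_measurable borel"
    and le: "\<And>n::nat. (\<integral>\<^sup>+x. f x * indicator (cball 0 (real n)) x \<partial>lborel) \<le> C"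
  shows "(\<integral>\<^sup>+x. f x \<partial>lborel) \<le> C"
proof -
  have "(SUP n::nat. f x * indicator (cball 0 (real n)) x) = f x" for x
  proof (rule antisym)
    show "(SUP n::nat. f x * indicator (cball 0 (real n)) x) \<le> f x"
      by (intro SUP_least) (auto simp: indicator_def)
    obtain n where "norm x \<le> real n" using real_arch_simple by blast
    then show "f x \<le> (SUP n::nat. f x * indicator (cball 0 (real n)) x)"
      by (intro SUP_upper2[of n]) auto
  qed
  then have "(\<integral>\<^sup>+x. f x \<partial>lborel) = (\<integral>\<^sup>+x. (SUP n::nat. f x * indicator (cball 0 (real n)) x) \<partial>lborel)"
    by simp
  also have "\<dots> = (SUP n::nat. \<integral>\<^sup>+x. f x * indicator (cball 0 (real n)) x \<partial>lborel)"
    by (rule nn_integral_monotone_convergence_SUP)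
      (auto intro!: incseq_SucI le_funI mult_left_mono simp: indicator_def)
  also have "\<dots> \<le> C" using le by (intro SUP_least)
  finally show ?thesis .
qed

lemma square_add_le: "((a::real) + b)\<^sup>2 \<le> 2 * a\<^sup>2 + 2 * b\<^sup>2"
  using zero_le_power2[of "a - b"] by (simp add: power2_eq_square algebra_simps)

context curl_system begin

text \<open>The limit b -> infinity in \<open>V_diff_L2\<close>. Only a truncation of
  \<open>v\<close> is square integrable, so \<open>V b\<close> is shown to converge to
  \<open>v\<close> on each ball of radius n, using \<open>v\<close> cut off at radius n + 1; the
  difference \<open>V a - v\<close> is nevertheless globally in L^2.\<close>

lemma V_minus_v_L2:
  assumes a: "a > 0"
  shows "(\<integral>\<^sup>+x. ennreal ((V a i x - v i x)\<^sup>2) \<partial>lborel) \<le> ennreal (2 * (wnorm / a)\<^sup>2)"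
proof (rule nn_integral_le_of_cball)
  fix n :: nat
  define f where "f x = indicator (cball 0 (real n + 1)) x * v i x" for x
  have [measurable]: "f \<in> borel_measurable borel"
    unfolding f_def by (intro borel_measurable_times v_borel borel_measurable_indicator) auto
  have "(f x)\<^sup>2 = indicator (cball 0 (real n + 1)) x * (v i x)\<^sup>2" for x
    by (auto simp: f_def indicator_def)
  then have "integrable lborel (\<lambda>x. (f x)\<^sup>2)"
    using v_L2_loc[of "real n + 1" i] by simp
  note T = conv_moll_tendsto_L2[OF \<open>f \<in> _\<close> this]
  show "(\<integral>\<^sup>+x. ennreal ((V a i x - v i x)\<^sup>2) * indicator (cball 0 (real n)) x \<partial>lborel) \<le> ennreal (2 * (wnorm / a)\<^sup>2)"
  proof (rule ennreal_le_epsilon)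
    fix e :: real assume e: "e > 0"
    obtain T where T: "T \<ge> 1" "\<And>t. t \<ge> T \<Longrightarrow> (\<integral>\<^sup>+x. ennreal ((conv (moll t) f x - f x)\<^sup>2) \<partial>lborel) \<le> ennreal (e / 2)"
      using T[of "e / 2"] e by auto
    \<comment> \<open>At least T for the convergence and at least \<open>a\<close> for
      \<open>V_diff_L2\<close>. As T is at least 1, the kernel of \<open>V b\<close> has radius at
      most 1 and sees only the truncated \<open>f\<close> from points of the ball of radius
      n.\<close>
    define b where "b = max T a"
    have b: "b \<ge> T" "b \<ge> 1" "b \<ge> a" "b > 0" using T a by (auto simp: b_def)
    have eq: "V b i x - v i x = conv (moll b) f x - f x" if "norm x \<le> real n" for x
    proof -
      have "v i y * moll b (x - y) = f y * moll b (x - y)" for y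
      proof (cases "norm (x - y) > 1 / b")
        case False
        have "1 / b \<le> 1" using b by simp
        then have "norm y \<le> real n + 1" using False that norm_triangle_ineq4[of x "x - y"] by simp
        then show ?thesis by (simp add: f_def)
      qed (use moll_eq_0 b in simp)
      then have "V b i x = conv (moll b) f x"
        unfolding V_def conv_def by (intro Bochner_Integration.integral_cong refl)
      then show ?thesis using that by (simp add: f_def)
    qed
    have "ennreal ((V a i x - v i x)\<^sup>2) * indicator (cball 0 (real n)) x
        \<le> 2 * ennreal ((V a i x - V b i x)\<^sup>2) + 2 * ennreal ((conv (moll b) f x - f x)\<^sup>2)" for x
    proof (cases "norm x \<le> real n")
      case True
      have "(V a i x - v i x)\<^sup>2 \<le> 2 * (V a i x - V b i x)\<^sup>2 + 2 * (conv (moll b) f x - f x)\<^sup>2"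
        unfolding eq[OF True, symmetric] using square_add_le[of "V a i x - V b i x" "V b i x - v i x"] by simp
      then have "ennreal ((V a i x - v i x)\<^sup>2) \<le> ennreal (2 * (V a i x - V b i x)\<^sup>2 + 2 * (conv (moll b) f x - f x)\<^sup>2)"
        by (rule ennreal_leI)
      with True show ?thesis by (simp add: ennreal_mult'')
    qed simp
    then have "(\<integral>\<^sup>+x. ennreal ((V a i x - v i x)\<^sup>2) * indicator (cball 0 (real n)) x \<partial>lborel)
        \<le> (\<integral>\<^sup>+x. 2 * ennreal ((V a i x - V b i x)\<^sup>2) + 2 * ennreal ((conv (moll b) f x - f x)\<^sup>2) \<partial>lborel)"
      by (intro nn_integral_mono)
    also have "\<dots> = 2 * (\<integral>\<^sup>+x. ennreal ((V a i x - V b i x)\<^sup>2) \<partial>lborel) + 2 * (\<integral>\<^sup>+x. ennreal ((conv (moll b) f x - f x)\<^sup>2) \<partial>lborel)"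
      by (simp add: nn_integral_add nn_integral_cmult conv_def)
    also have "\<dots> \<le> 2 * ennreal ((wnorm / a)\<^sup>2) + 2 * ennreal (e / 2)"
      by (intro add_mono mult_left_mono V_diff_L2 T b a) auto
    also have "\<dots> = ennreal (2 * (wnorm / a)\<^sup>2) + ennreal e"
      using e by (simp add: ennreal_mult'' flip: ennreal_mult'' ennreal_numeral)
    finally show "(\<integral>\<^sup>+x. ennreal ((V a i x - v i x)\<^sup>2) * indicator (cball 0 (real n)) x \<partial>lborel)
        \<le> ennreal (2 * (wnorm / a)\<^sup>2) + ennreal e" .
  qed
qed simp

end

section \<open>Decay of the averages at large scales\<close>

text \<open>Temperedness is recorded as \<open>poly_growth\<close>: the pairings of \<open>v\<close>
  with the translates of the single test function \<open>moll 1\<close> grow polynomially.\<close>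

locale decaying_curl_system = curl_system +
  assumes level_sets: "s > 0 \<Longrightarrow> emeasure lborel {x. \<bar>v i x\<bar> > s} < \<infinity>"
    and poly_growth: "\<exists>C N. \<forall>x. \<bar>V 1 i x\<bar> \<le> C * (1 + norm x) ^ N"
begin

text \<open>The residual \<open>v - V 1\<close> is globally in L^2, so its averages over balls of
  radius 1/t are O(t^(3/2)). Questions about \<open>V t\<close> for small t thereby reduce to
  averages of the smooth field \<open>V 1\<close>.\<close>

lemma conv_resid_le:
  assumes t: "t > 0"
  shows "\<bar>conv (moll t) (\<lambda>x. v i x - V 1 i x) x\<bar> \<le> sqrt (t ^ 3 * phi_max * 2) * wnorm"
proof -
  have "(ennreal \<bar>conv (moll t) (\<lambda>x. v i x - V 1 i x) x\<bar>)\<^sup>2 \<le> (avg t (\<lambda>y. ennreal \<bar>v i y - V 1 i y\<bar>) x)\<^sup>2"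
    by (intro power_mono conv_moll_le_avg t) auto
  also have "\<dots> \<le> ennreal (t ^ 3 * phi_max) * (\<integral>\<^sup>+y. (ennreal \<bar>v i y - V 1 i y\<bar>)\<^sup>2 \<partial>lborel)"
    by (intro avg_square_le t) simp
  also have "\<dots> \<le> ennreal (t ^ 3 * phi_max) * ennreal (2 * wnorm\<^sup>2)"
    using V_minus_v_L2[of 1 i] by (intro mult_left_mono) (auto simp: power2_commute ennreal_power)
  also have "\<dots> = ennreal ((sqrt (t ^ 3 * phi_max * 2) * wnorm)\<^sup>2)"
    using t phi_max(1) by (simp add: power_mult_distrib mult_ac flip: ennreal_mult)
  also have "\<dots> = (ennreal (sqrt (t ^ 3 * phi_max * 2) * wnorm))\<^sup>2"
    using t phi_max(1) wnorm(1) by (simp add: ennreal_power)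
  finally have "ennreal \<bar>conv (moll t) (\<lambda>x. v i x - V 1 i x) x\<bar> \<le> ennreal (sqrt (t ^ 3 * phi_max * 2) * wnorm)"
    by (rule ennreal_square_le) (use t phi_max(1) wnorm(1) in auto)
  then show ?thesis
    using t phi_max(1) wnorm(1) by (subst (asm) ennreal_le_iff) auto
qed

text \<open>Where |V 1| exceeds s, either |v| exceeds s/2 or the difference is at least s/2. The
  second set is finite by Markov's inequality for the square of \<open>V 1 - v\<close>.\<close>

lemma V1_level_sets:
  assumes s: "s > 0"
  shows "emeasure lborel {x. \<bar>V 1 i x\<bar> > s} < \<infinity>"
proof -
  let ?r = "\<lambda>x. ennreal ((V 1 i x - v i x)\<^sup>2)"
  have "{x. \<bar>V 1 i x\<bar> > s} \<subseteq> {x. \<bar>v i x\<bar> > s / 2} \<union> {x \<in> UNIV. 1 \<le> ennreal (4 / s\<^sup>2) * ?r x}"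
  proof
    fix x assume x: "x \<in> {x. \<bar>V 1 i x\<bar> > s}"
    show "x \<in> {x. \<bar>v i x\<bar> > s / 2} \<union> {x \<in> UNIV. 1 \<le> ennreal (4 / s\<^sup>2) * ?r x}"
    proof (cases "\<bar>v i x\<bar> > s / 2")
      case False
      then have "s / 2 \<le> \<bar>V 1 i x - v i x\<bar>"
        using x abs_triangle_ineq2[of "V 1 i x" "v i x"] by auto
      then have "(s / 2)\<^sup>2 \<le> \<bar>V 1 i x - v i x\<bar>\<^sup>2" using s by (intro power_mono) auto
      then have "1 \<le> 4 / s\<^sup>2 * (V 1 i x - v i x)\<^sup>2" using s by (simp add: power_divide field_simps)
      then show ?thesis using ennreal_leI[of 1] by (simp flip: ennreal_mult'')
    qed simp
  qed
  then have "emeasure lborel {x. \<bar>V 1 i x\<bar> > s}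
      \<le> emeasure lborel ({x. \<bar>v i x\<bar> > s / 2} \<union> {x \<in> UNIV. 1 \<le> ennreal (4 / s\<^sup>2) * ?r x})"
    by (rule emeasure_mono) measurable
  also have "\<dots> \<le> emeasure lborel {x. \<bar>v i x\<bar> > s / 2} + emeasure lborel {x \<in> UNIV. 1 \<le> ennreal (4 / s\<^sup>2) * ?r x}"
    by (rule emeasure_subadditive) measurable
  also have "emeasure lborel {x \<in> UNIV. 1 \<le> ennreal (4 / s\<^sup>2) * ?r x} \<le> ennreal (4 / s\<^sup>2) * (\<integral>\<^sup>+x. ?r x * indicator UNIV x \<partial>lborel)"
    using nn_integral_Markov_inequality[of ?r UNIV lborel "ennreal (4 / s\<^sup>2)"] by simp
  also have "emeasure lborel {x. \<bar>v i x\<bar> > s / 2} + ennreal (4 / s\<^sup>2) * (\<integral>\<^sup>+x. ?r x * indicator UNIV x \<partial>lborel) < \<infinity>"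
    using level_sets[of "s / 2" i] s V_minus_v_L2[of 1 i]
    by (auto simp: ennreal_mult_less_top le_less_trans)
  finally show ?thesis by (auto intro: add_mono)
qed

text \<open>Off the level set the average is at most s. On it the kernel is at most t^3 phi_max, the
  field at most B, and the measure is finite.\<close>

lemma conv_V1_le:
  assumes t: "t > 0" and s: "s > 0" and B: "\<And>y. norm (x - y) \<le> 1 / t \<Longrightarrow> \<bar>V 1 i y\<bar> \<le> B"
  shows "\<bar>conv (moll t) (V 1 i) x\<bar> \<le> s + B * t ^ 3 * phi_max * measure lborel {x. \<bar>V 1 i x\<bar> > s}"
proof -
  let ?A = "{x. \<bar>V 1 i x\<bar> > s}"
  have B0: "B \<ge> 0" using B[of x] t by (smt (verit) divide_nonneg_nonneg norm_zero right_minus_eq)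
  have Vl: "loc_int (V 1 i)" by (intro test_loc_int V_smooth) simp
  have mi: "integrable lborel (\<lambda>y. moll t (x - y))"
    using conv_integrable[OF test_loc_int[OF smooth_const[of 1]] moll_test[of t]] t by simp
  have one: "(\<integral>y. moll t (x - y) \<partial>lborel) = 1"
    using moll_nn_integral(1)[OF t, of x] moll_nonneg[OF t] by (simp add: integral_eq_nn_integral)
  have ii: "integrable lborel (\<lambda>y. indicator ?A y :: real)"
    using V1_level_sets[OF s, of i] by (intro integrable_real_indicator) auto
  have "\<bar>conv (moll t) (V 1 i) x\<bar> \<le> (\<integral>y. s * moll t (x - y) + B * t ^ 3 * phi_max * indicator ?A y \<partial>lborel)"
    unfolding conv_def
  proof (rule order_trans[OF integral_abs_bound integral_mono])
    show "integrable lborel (\<lambda>y. \<bar>V 1 i y * moll t (x - y)\<bar>)"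
      using conv_integrable[OF Vl moll_test] t by auto
    show "integrable lborel (\<lambda>y. s * moll t (x - y) + B * t ^ 3 * phi_max * indicator ?A y)"
      using mi ii by auto
    fix y
    have m: "0 \<le> moll t (x - y)" "moll t (x - y) \<le> t ^ 3 * phi_max"
      using t phi_nonneg phi_max(2) by (auto simp: moll_def)
    show "\<bar>V 1 i y * moll t (x - y)\<bar> \<le> s * moll t (x - y) + B * t ^ 3 * phi_max * indicator ?A y"
    proof (cases "norm (x - y) > 1 / t")
      case True
      then show ?thesis using moll_eq_0[OF t] B0 t phi_max(1) by simp
    next
      case False
      show ?thesis
      proof (cases "y \<in> ?A")
        case True
        have "\<bar>V 1 i y\<bar> * moll t (x - y) \<le> B * (t ^ 3 * phi_max)"
          using False B m B0 by (intro mult_mono) auto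
        moreover have "0 \<le> s * moll t (x - y)" using s m by simp
        ultimately show ?thesis using True m by (simp add: abs_mult mult.assoc)
      next
        case False
        then have "\<bar>V 1 i y\<bar> * moll t (x - y) \<le> s * moll t (x - y)"
          using m by (intro mult_right_mono) auto
        then show ?thesis using False m by (simp add: abs_mult)
      qed
    qed
  qed
  also have "\<dots> = s + B * t ^ 3 * phi_max * measure lborel ?A"
    using mi ii one by simp
  finally show ?thesis .
qed

lemma V_split: "t > 0 \<Longrightarrow> V t i x = conv (moll t) (V 1 i) x + conv (moll t) (\<lambda>x. v i x - V 1 i x) x"
  using conv_diff[of "v i" "V 1 i" "moll t" x] v_loc_int test_loc_int[OF V_smooth, of 1 i] moll_test[of t]
  by (simp add: V_def)

text \<open>With R = 1 + |x|, averaging over radius R changes \<open>V 1\<close> by a bounded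
  amount, since \<open>V_diff_le\<close> is uniform for scales up to 1. In the average, the level
  set contributes R^(N+1) times the kernel bound R^-3; the gain is three powers, of which one is
  recorded.\<close>

lemma growth_drop:
  assumes "\<And>x. \<bar>V 1 i x\<bar> \<le> C * (1 + norm x) ^ Suc N"
  shows "\<exists>C'. \<forall>x. \<bar>V 1 i x\<bar> \<le> C' * (1 + norm x) ^ N"
proof -
  define m where "m = measure lborel {x. \<bar>V 1 i x\<bar> > 1}"
  \<comment> \<open>Collects what does not grow: the change from \<open>V t\<close> to
    \<open>V 1\<close>, the average of the residual, and the level 1 itself.\<close>
  define C0 where "C0 = 2 * sqrt phi_max * wnorm + sqrt (phi_max * 2) * wnorm + 1"
  have C0: "C0 \<ge> 0" using phi_max(1) wnorm(1) by (simp add: C0_def)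
  have C: "C \<ge> 0" using assms[of 0] by simp
  have "\<bar>V 1 i x\<bar> \<le> (C0 + C * 3 ^ Suc N * phi_max * m) * (1 + norm x) ^ N" for x
  proof -
    define R where "R = 1 + norm x"
    have R: "R \<ge> 1" by (simp add: R_def)
    define t where "t = 1 / R"
    have t: "0 < t" "t \<le> 1" using R by (auto simp: t_def)
    have "\<bar>V t i x - V 1 i x\<bar> \<le> 2 * sqrt phi_max * wnorm"
      using V_diff_le[of t 1] t by simp
    moreover have "\<bar>conv (moll t) (\<lambda>x. v i x - V 1 i x) x\<bar> \<le> sqrt (phi_max * 2) * wnorm"
    proof -
      have "t ^ 3 * phi_max * 2 \<le> 1 * phi_max * 2"
        using t phi_max(1) by (intro mult_right_mono power_le_one) auto
      then have "sqrt (t ^ 3 * phi_max * 2) * wnorm \<le> sqrt (phi_max * 2) * wnorm"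
        using wnorm(1) by (intro mult_right_mono) auto
      then show ?thesis using conv_resid_le[OF t(1), of i x] by linarith
    qed
    moreover have "\<bar>conv (moll t) (V 1 i) x\<bar> \<le> 1 + C * (3 * R) ^ Suc N * t ^ 3 * phi_max * m"
      unfolding m_def
    proof (rule conv_V1_le[OF t(1) zero_less_one])
      fix y assume "norm (x - y) \<le> 1 / t"
      then have "norm y \<le> norm x + R" using norm_triangle_ineq4[of x "x - y"] by (simp add: t_def)
      moreover have "norm x = R - 1" by (simp add: R_def)
      ultimately have "1 + norm y \<le> 3 * R" using R by linarith
      then have "C * (1 + norm y) ^ Suc N \<le> C * (3 * R) ^ Suc N"
        using C by (intro mult_left_mono power_mono) auto
      then show "\<bar>V 1 i y\<bar> \<le> C * (3 * R) ^ Suc N" using assms[of y] by linarith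
    qed
    moreover have "C * (3 * R) ^ Suc N * t ^ 3 * phi_max * m \<le> C * 3 ^ Suc N * phi_max * m * R ^ N"
    proof -
      have "R ^ Suc N * t ^ 3 = R ^ N * t ^ 2"
        using R by (simp add: t_def power3_eq_cube power2_eq_square)
      also have "\<dots> \<le> R ^ N * 1"
        using t R by (intro mult_left_mono power_le_one) auto
      finally have "(C * 3 ^ Suc N * phi_max * m) * (R ^ Suc N * t ^ 3) \<le> (C * 3 ^ Suc N * phi_max * m) * R ^ N"
        using C phi_max(1) by (intro mult_left_mono) (auto simp: m_def)
      then show ?thesis by (simp add: power_mult_distrib mult_ac)
    qed
    ultimately have "\<bar>V 1 i x\<bar> \<le> C0 + C * 3 ^ Suc N * phi_max * m * R ^ N"
      using V_split[OF t(1), of i x] unfolding C0_def by linarith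
    also have "C0 \<le> C0 * R ^ N" using C0 R by (simp add: mult_le_cancel_left1 not_less)
    finally show ?thesis by (simp add: algebra_simps R_def)
  qed
  then show ?thesis by blast
qed

lemma V1_bounded: "\<exists>B. \<forall>x. \<bar>V 1 i x\<bar> \<le> B"
proof -
  obtain C N where "\<forall>x. \<bar>V 1 i x\<bar> \<le> C * (1 + norm x) ^ N"
    using poly_growth by blast
  then show ?thesis
  proof (induction N arbitrary: C)
    case (Suc N)
    then show ?case using growth_drop[of i C N] by blast
  qed auto
qed

text \<open>At the fixed level e/2 the exceptional set has finite measure and the field is bounded,
  so its contribution decays like t^3 and that of the residual like t^(3/2).\<close>

lemma V_tendsto_0: "((\<lambda>t. V t i x) \<longlongrightarrow> 0) (at_right 0)"
proof (rule tendstoI)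
  fix e :: real assume e: "e > 0"
  obtain B where B: "\<And>x. \<bar>V 1 i x\<bar> \<le> B" using V1_bounded by blast
  let ?m = "measure lborel {x. \<bar>V 1 i x\<bar> > e / 2}"
  let ?h = "\<lambda>t. B * t ^ 3 * phi_max * ?m + sqrt (t ^ 3 * phi_max * 2) * wnorm"
  have "(?h \<longlongrightarrow> B * 0 ^ 3 * phi_max * ?m + sqrt (0 ^ 3 * phi_max * 2) * wnorm) (at_right 0)"
    by (intro tendsto_intros)
  then have "(?h \<longlongrightarrow> 0) (at_right 0)" by simp
  then have "\<forall>\<^sub>F t in at_right 0. ?h t < e / 2"
    using e by (intro order_tendstoD) auto
  moreover have "\<forall>\<^sub>F t in at_right 0. (0::real) < t"
    by (rule eventually_at_right_less)
  ultimately show "\<forall>\<^sub>F t in at_right 0. dist (V t i x) 0 < e"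
  proof eventually_elim
    case (elim t)
    have "\<bar>conv (moll t) (V 1 i) x\<bar> \<le> e / 2 + B * t ^ 3 * phi_max * ?m"
      using B e elim by (intro conv_V1_le) auto
    then show ?case
      using elim conv_resid_le[OF elim(2), of i x] V_split[OF elim(2), of i x] by (simp add: dist_real_def)
  qed
qed

text \<open>The limit a -> 0 in \<open>V_diff_le\<close>, whose right-hand side does not involve
  \<open>a\<close>.\<close>

lemma V_le:
  assumes b: "b > 0"
  shows "\<bar>V b i x\<bar> \<le> 2 * sqrt (b * phi_max) * wnorm"
proof (rule tendsto_upperbound)
  show "((\<lambda>t. \<bar>V t i x - V b i x\<bar>) \<longlongrightarrow> \<bar>V b i x\<bar>) (at_right 0)"
    using tendsto_rabs[OF tendsto_diff[OF V_tendsto_0[of i x] tendsto_const[of "V b i x"]]] by simp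
  have "\<forall>\<^sub>F t in at_right 0. t \<in> {0<..<b}"
    using b by (rule eventually_at_right_real)
  then show "\<forall>\<^sub>F t in at_right 0. \<bar>V t i x - V b i x\<bar> \<le> 2 * sqrt (b * phi_max) * wnorm"
    by eventually_elim (auto intro: V_diff_le)
qed simp

end

section \<open>Bounds in L^6 and on balls\<close>

lemma power6_layer_cake:
  assumes "u \<ge> 0"
  shows "(\<integral>\<^sup>+s. ennreal (6 * s ^ 5) * indicator {0..u} s \<partial>lborel) = ennreal (u ^ 6)"
proof -
  have "(\<integral>\<^sup>+s. ennreal (6 * s ^ 5) * indicator {0..u} s \<partial>lborel) = ennreal (u ^ 6 - 0 ^ 6)"
    using assms by (intro nn_integral_FTC_Icc) (auto intro!: derivative_eq_intros)
  then show ?thesis by simp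
qed

lemma pred_cball [measurable]: "Measurable.pred borel (\<lambda>x. x \<in> cball a R)"
  unfolding pred_def using borel_closed[OF closed_cball[of a R]] by (simp add: cball_def)

text \<open>Layer cake formula: the sixth power is the integral of 6 s^5 up to |f|, and the two
  integrations are exchanged.\<close>

lemma nn_integral_power6:
  fixes f :: "real^3 \<Rightarrow> real"
  assumes [measurable]: "f \<in> borel_measurable borel"
  shows "(\<integral>\<^sup>+x. ennreal ((f x) ^ 6) \<partial>lborel)
    = (\<integral>\<^sup>+s. ennreal (6 * s ^ 5) * indicator {0..} s * emeasure lborel {x. s \<le> \<bar>f x\<bar>} \<partial>lborel)"
proof -
  have "(\<integral>\<^sup>+x. ennreal ((f x) ^ 6) \<partial>lborel) = (\<integral>\<^sup>+x. \<integral>\<^sup>+s. ennreal (6 * s ^ 5) * indicator {0..\<bar>f x\<bar>} s \<partial>lborel \<partial>lborel)"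
    by (simp add: power6_layer_cake)
  also have "\<dots> = (\<integral>\<^sup>+x. \<integral>\<^sup>+s. ennreal (6 * s ^ 5) * indicator {0..} s * indicator {x. s \<le> \<bar>f x\<bar>} x \<partial>lborel \<partial>lborel)"
    by (intro nn_integral_cong) (auto simp: indicator_def)
  also have "\<dots> = (\<integral>\<^sup>+s. \<integral>\<^sup>+x. ennreal (6 * s ^ 5) * indicator {0..} s * indicator {x. s \<le> \<bar>f x\<bar>} x \<partial>lborel \<partial>lborel)"
    by (rule lborel_pair.Fubini') measurable
  also have "\<dots> = (\<integral>\<^sup>+s. ennreal (6 * s ^ 5) * indicator {0..} s * emeasure lborel {x. s \<le> \<bar>f x\<bar>} \<partial>lborel)"
    by (intro nn_integral_cong) (simp add: nn_integral_cmult_indicator)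
  finally show ?thesis .
qed

context decaying_curl_system begin

definition K0 :: real where "K0 = 2 * sqrt phi_max * wnorm"

lemma K0: "K0 > 0" "b > 0 \<Longrightarrow> \<bar>V b i x\<bar> \<le> K0 * sqrt b"
  using V_le[of b i x] phi_max(1) wnorm(1) by (auto simp: K0_def real_sqrt_mult mult_ac)

definition wabs :: "real^3 \<Rightarrow> real" where
  "wabs x = (\<Sum>i\<in>UNIV. \<Sum>j\<in>UNIV. \<bar>W j i x\<bar>)"

lemma wabs_nonneg: "wabs x \<ge> 0"
  by (simp add: wabs_def sum_nonneg)

lemma Wabs_eq: "Wabs x = ennreal (wabs x)"
  by (simp add: Wabs_def wabs_def sum_ennreal sum_nonneg)

lemma wabs_measurable [measurable]: "wabs \<in> borel_measurable borel"
  unfolding wabs_def by measurable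

lemma wabs_square_integral: "(\<integral>\<^sup>+x. ennreal ((wabs x)\<^sup>2) \<partial>lborel) \<le> ennreal (wnorm\<^sup>2)"
  using wnorm(2) by (simp add: Wabs_eq ennreal_power wabs_nonneg)

text \<open>Cutting the vorticity at height \<open>s\<^sup>3/(16 K0\<^sup>2)\<close> and choosing the scale \<open>s\<^sup>2/(4 K0\<^sup>2)\<close> makes the
  bounded part of the vorticity and the average both contribute less than \<open>s\<close>.\<close>

lemma V_distribution:
  assumes g: "g > 0" and s: "s > 0"
  shows "emeasure lborel {x. s \<le> \<bar>V g i x\<bar>}
    \<le> ennreal (16 * K0\<^sup>2 / s ^ 3) * (\<integral>\<^sup>+x. Wabs x * indicator {x. s ^ 3 < 16 * K0\<^sup>2 * wabs x} x \<partial>lborel)"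
proof -
  define \<beta> where "\<beta> = (s / (2 * K0))\<^sup>2"
  have \<beta>: "\<beta> > 0" using s K0(1) by (simp add: \<beta>_def)
  have sq: "sqrt \<beta> = s / (2 * K0)" unfolding \<beta>_def using s K0(1) by simp
  have V\<beta>: "\<bar>V \<beta> i x\<bar> \<le> s / 2" for x
    using K0(2)[OF \<beta>, of i x] K0(1) sq by simp
  show ?thesis
  proof (cases "\<beta> < g")
    \<comment> \<open>For g at most \<open>\<beta>\<close> the pointwise bound by K0 sqrt(g) already
      stays below s/2, and the level set is empty.\<close>
    case False
    have "\<not> s \<le> \<bar>V g i x\<bar>" for x
    proof -
      have "K0 * sqrt g \<le> K0 * sqrt \<beta>" using False K0(1) by (intro mult_left_mono) auto
      also have "\<dots> = s / 2" using K0(1) sq by simp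
      finally have "\<bar>V g i x\<bar> \<le> s / 2" using K0(2)[OF g, of i x] by linarith
      then show ?thesis using s by linarith
    qed
    then show ?thesis by simp
  next
    case True
    define hgt where "hgt = s * \<beta> / 4"
    have hgt: "hgt > 0" using s \<beta> by (simp add: hgt_def)
    let ?W1 = "\<lambda>x. Wabs x * indicator {x. hgt < wabs x} x"
    have hgt_eq: "{x. hgt < wabs x} = {x. s ^ 3 < 16 * K0\<^sup>2 * wabs x}"
      using K0(1) by (auto simp: hgt_def \<beta>_def power_divide power2_eq_square power3_eq_cube field_simps)
    have [measurable]: "?W1 \<in> borel_measurable borel" by measurable
    have "{x. s \<le> \<bar>V g i x\<bar>} \<subseteq> {x \<in> UNIV. 1 \<le> ennreal (4 / s) * spread \<beta> g ?W1 x}"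
    proof
      fix x assume "x \<in> {x. s \<le> \<bar>V g i x\<bar>}"
      then have "s / 2 \<le> \<bar>V \<beta> i x - V g i x\<bar>"
        using V\<beta>[of x] abs_triangle_ineq2[of "V g i x" "V \<beta> i x"] by (auto simp: abs_minus_commute)
      then have "ennreal (s / 2) \<le> spread \<beta> g Wabs x"
        using V_diff[of \<beta> g i x] True \<beta> by (meson ennreal_leI less_imp_le order_trans)
      also have "\<dots> \<le> spread \<beta> g (\<lambda>x. ?W1 x + ennreal hgt) x"
        by (rule spread_mono) (auto simp: indicator_def Wabs_eq ennreal_leI)
      also have "\<dots> = spread \<beta> g ?W1 x + spread \<beta> g (\<lambda>x. ennreal hgt) x"
        by (rule spread_add) auto
      also have "\<dots> \<le> spread \<beta> g ?W1 x + ennreal (1 / \<beta>) * ennreal hgt"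
        using True \<beta> by (intro add_left_mono spread_const_le) auto
      also have "ennreal (1 / \<beta>) * ennreal hgt = ennreal (s / 4)"
        using \<beta> hgt by (simp add: hgt_def flip: ennreal_mult')
      finally have *: "ennreal (s / 2) \<le> spread \<beta> g ?W1 x + ennreal (s / 4)" .
      \<comment> \<open>The average with parameter \<open>\<beta>\<close> used up s/2 and the
        bounded vorticity s/4. The large part of the vorticity must supply the remaining s/4, which
        is the threshold for Markov's inequality.\<close>
      have "1 \<le> ennreal (4 / s) * spread \<beta> g ?W1 x"
      proof (cases "spread \<beta> g ?W1 x")
        case (real r)
        with * have "s / 2 \<le> r + s / 4"
          using s by (simp flip: ennreal_plus)
        then have "1 \<le> 4 / s * r" using s by (simp add: field_simps)
        then show ?thesis using real s ennreal_leI[of 1] by (simp flip: ennreal_mult')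
      next
        case top
        then show ?thesis using s by (simp add: ennreal_mult_top)
      qed
      then show "x \<in> {x \<in> UNIV. 1 \<le> ennreal (4 / s) * spread \<beta> g ?W1 x}" by simp
    qed
    then have "emeasure lborel {x. s \<le> \<bar>V g i x\<bar>} \<le> emeasure lborel {x \<in> UNIV. 1 \<le> ennreal (4 / s) * spread \<beta> g ?W1 x}"
      by (rule emeasure_mono) measurable
    also have "\<dots> \<le> ennreal (4 / s) * (\<integral>\<^sup>+x. spread \<beta> g ?W1 x \<partial>lborel)"
      using nn_integral_Markov_inequality[of "spread \<beta> g ?W1" UNIV lborel "ennreal (4 / s)"] by simp
    also have "\<dots> \<le> ennreal (4 / s) * (ennreal (1 / \<beta>) * (\<integral>\<^sup>+x. ?W1 x \<partial>lborel))"
      using True \<beta> by (intro mult_left_mono spread_nn_integral) auto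
    also have "\<dots> = ennreal (4 / s * (1 / \<beta>)) * (\<integral>\<^sup>+x. ?W1 x \<partial>lborel)"
      unfolding mult.assoc[symmetric, of _ _ "\<integral>\<^sup>+x. ?W1 x \<partial>lborel"]
      using s by (subst ennreal_mult'[symmetric]) auto
    also have "4 / s * (1 / \<beta>) = 16 * K0\<^sup>2 / s ^ 3"
      using s K0(1) by (simp add: \<beta>_def power_divide power2_eq_square power3_eq_cube)
    finally show ?thesis by (simp add: hgt_eq)
  qed
qed

definition K6 :: real where "K6 = 512 * K0 ^ 4 * wnorm\<^sup>2"

text \<open>Inserting \<open>V_distribution\<close> into the layer cake leaves 96 K0^2 s^2 on the
  region s^3 < 16 K0^2 |W|. Integrating in s first gives 32 K0^2 times 16 K0^2 |W|, which accounts
  for the 512 in \<open>K6\<close>, and then the integral of |W|^2. The bound is uniform in the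
  scale.\<close>

lemma V_L6:
  assumes g: "g > 0"
  shows "(\<integral>\<^sup>+x. ennreal ((V g i x) ^ 6) \<partial>lborel) \<le> ennreal K6"
proof -
  have "(\<integral>\<^sup>+x. ennreal ((V g i x) ^ 6) \<partial>lborel)
      = (\<integral>\<^sup>+s. ennreal (6 * s ^ 5) * indicator {0..} s * emeasure lborel {x. s \<le> \<bar>V g i x\<bar>} \<partial>lborel)"
    by (rule nn_integral_power6) simp
  also have "\<dots> \<le> (\<integral>\<^sup>+s. \<integral>\<^sup>+x. ennreal (96 * K0\<^sup>2 * s\<^sup>2) * indicator {0..} s
      * (Wabs x * indicator {x. s ^ 3 < 16 * K0\<^sup>2 * wabs x} x) \<partial>lborel \<partial>lborel)"
  proof (rule nn_integral_mono)
    fix s :: real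
    show "ennreal (6 * s ^ 5) * indicator {0..} s * emeasure lborel {x. s \<le> \<bar>V g i x\<bar>}
      \<le> (\<integral>\<^sup>+x. ennreal (96 * K0\<^sup>2 * s\<^sup>2) * indicator {0..} s
      * (Wabs x * indicator {x. s ^ 3 < 16 * K0\<^sup>2 * wabs x} x) \<partial>lborel)"
    proof (cases "s > 0")
      case True
      let ?I = "\<integral>\<^sup>+x. Wabs x * indicator {x. s ^ 3 < 16 * K0\<^sup>2 * wabs x} x \<partial>lborel"
      have "ennreal (6 * s ^ 5) * emeasure lborel {x. s \<le> \<bar>V g i x\<bar>} \<le> ennreal (6 * s ^ 5) * (ennreal (16 * K0\<^sup>2 / s ^ 3) * ?I)"
        by (intro mult_left_mono V_distribution g True) auto
      also have "\<dots> = ennreal (6 * s ^ 5 * (16 * K0\<^sup>2 / s ^ 3)) * ?I"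
        unfolding mult.assoc[symmetric, of _ _ ?I] using True by (subst ennreal_mult'[symmetric]) auto
      also have "6 * s ^ 5 * (16 * K0\<^sup>2 / s ^ 3) = 96 * K0\<^sup>2 * s\<^sup>2"
        using True by (simp add: power2_eq_square power3_eq_cube eval_nat_numeral)
      finally show ?thesis using True by (simp add: nn_integral_cmult)
    next
      case False
      then show ?thesis by (cases "s = 0") auto
    qed
  qed
  also have "\<dots> = (\<integral>\<^sup>+x. \<integral>\<^sup>+s. ennreal (96 * K0\<^sup>2 * s\<^sup>2) * indicator {0..} s
      * (Wabs x * indicator {x. s ^ 3 < 16 * K0\<^sup>2 * wabs x} x) \<partial>lborel \<partial>lborel)"
    by (rule lborel_pair.Fubini') measurable
  also have "\<dots> \<le> (\<integral>\<^sup>+x. Wabs x * ennreal (512 * K0 ^ 4 * wabs x) \<partial>lborel)"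
  proof (rule nn_integral_mono)
    fix x
    let ?r = "root 3 (16 * K0\<^sup>2 * wabs x)"
    have r: "?r \<ge> 0" "?r ^ 3 = 16 * K0\<^sup>2 * wabs x" using wabs_nonneg[of x] by auto
    have "(\<integral>\<^sup>+s. ennreal (96 * K0\<^sup>2 * s\<^sup>2) * indicator {0..} s
      * (Wabs x * indicator {x. s ^ 3 < 16 * K0\<^sup>2 * wabs x} x) \<partial>lborel)
      \<le> (\<integral>\<^sup>+s. Wabs x * (ennreal (96 * K0\<^sup>2 * s\<^sup>2) * indicator {0..?r} s) \<partial>lborel)"
    proof (rule nn_integral_mono)
      fix s :: real
      have "s \<le> ?r" if "s ^ 3 < 16 * K0\<^sup>2 * wabs x"
        using that r by (metis linorder_not_le power_mono less_imp_le not_less)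
      then show "ennreal (96 * K0\<^sup>2 * s\<^sup>2) * indicator {0..} s * (Wabs x * indicator {x. s ^ 3 < 16 * K0\<^sup>2 * wabs x} x)
        \<le> Wabs x * (ennreal (96 * K0\<^sup>2 * s\<^sup>2) * indicator {0..?r} s)"
        by (auto simp: indicator_def mult_ac)
    qed
    also have "\<dots> = Wabs x * (\<integral>\<^sup>+s. ennreal (96 * K0\<^sup>2 * s\<^sup>2) * indicator {0..?r} s \<partial>lborel)"
      by (rule nn_integral_cmult) simp
    also have "(\<integral>\<^sup>+s. ennreal (96 * K0\<^sup>2 * s\<^sup>2) * indicator {0..?r} s \<partial>lborel) = ennreal (32 * K0\<^sup>2 * ?r ^ 3 - 32 * K0\<^sup>2 * 0 ^ 3)"
      using r by (intro nn_integral_FTC_Icc) (auto intro!: derivative_eq_intros)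
    also have "32 * K0\<^sup>2 * ?r ^ 3 - 32 * K0\<^sup>2 * 0 ^ 3 = 512 * K0 ^ 4 * wabs x"
      unfolding r(2) by (simp add: power2_eq_square eval_nat_numeral)
    finally show "(\<integral>\<^sup>+s. ennreal (96 * K0\<^sup>2 * s\<^sup>2) * indicator {0..} s
      * (Wabs x * indicator {x. s ^ 3 < 16 * K0\<^sup>2 * wabs x} x) \<partial>lborel) \<le> Wabs x * ennreal (512 * K0 ^ 4 * wabs x)" .
  qed
  also have "\<dots> = (\<integral>\<^sup>+x. ennreal (512 * K0 ^ 4) * ennreal ((wabs x)\<^sup>2) \<partial>lborel)"
    by (intro nn_integral_cong) (simp add: Wabs_eq power2_eq_square wabs_nonneg mult_ac flip: ennreal_mult)
  also have "\<dots> = ennreal (512 * K0 ^ 4) * (\<integral>\<^sup>+x. ennreal ((wabs x)\<^sup>2) \<partial>lborel)"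
    by (rule nn_integral_cmult) simp
  also have "\<dots> \<le> ennreal (512 * K0 ^ 4) * ennreal (wnorm\<^sup>2)"
    by (intro mult_left_mono wabs_square_integral) auto
  also have "\<dots> = ennreal K6"
    using K0(1) by (simp add: K6_def flip: ennreal_mult)
  finally show ?thesis .
qed

lemma V_minus_v_tendsto:
  "(\<lambda>n. \<integral>\<^sup>+x. ennreal ((V (real (Suc n)) i x - v i x)\<^sup>2) \<partial>lborel) \<longlonglongrightarrow> 0"
proof (rule tendsto_sandwich[OF _ _ tendsto_const])
  show "\<forall>\<^sub>F n in sequentially. (\<integral>\<^sup>+x. ennreal ((V (real (Suc n)) i x - v i x)\<^sup>2) \<partial>lborel) \<le> ennreal (2 * (wnorm / real (Suc n))\<^sup>2)"
    by (intro always_eventually allI V_minus_v_L2) simp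
  have "(\<lambda>n. wnorm / real (Suc n)) \<longlonglongrightarrow> 0"
    using LIMSEQ_Suc[OF lim_const_over_n] by simp
  then have "(\<lambda>n. 2 * (wnorm / real (Suc n))\<^sup>2) \<longlonglongrightarrow> 2 * 0\<^sup>2"
    by (intro tendsto_intros)
  then show "(\<lambda>n. ennreal (2 * (wnorm / real (Suc n))\<^sup>2)) \<longlonglongrightarrow> 0"
    using tendsto_ennrealI by fastforce
qed simp

lemma V_minus_v_integrable: "a > 0 \<Longrightarrow> integrable lborel (\<lambda>x. (V a i x - v i x)\<^sup>2)"
  using V_minus_v_L2[of a i] by (intro integrableI_nonneg) (auto simp: le_less_trans)

text \<open>A subsequence of the averages converges to \<open>v\<close> almost everywhere because
  the differences tend to 0 in L^2; Fatou's lemma transfers the uniform bound.\<close>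

lemma v_L6: "(\<integral>\<^sup>+x. ennreal ((v i x) ^ 6) \<partial>lborel) \<le> ennreal K6"
proof -
  have "(\<lambda>n. \<integral>x. (V (real (Suc n)) i x - v i x)\<^sup>2 \<partial>lborel) \<longlonglongrightarrow> 0"
  proof -
    have "(\<lambda>n. enn2real (\<integral>\<^sup>+x. ennreal ((V (real (Suc n)) i x - v i x)\<^sup>2) \<partial>lborel)) \<longlonglongrightarrow> 0"
      by (rule tendsto_enn2real[where l = 0, simplified, OF V_minus_v_tendsto])
    then show ?thesis by (simp add: integral_eq_nn_integral)
  qed
  then obtain r :: "nat \<Rightarrow> nat" where r: "strict_mono r"
    "AE x in lborel. (\<lambda>n. (V (real (Suc (r n))) i x - v i x)\<^sup>2) \<longlonglongrightarrow> 0"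
    using tendsto_L1_AE_subseq[of lborel "\<lambda>n x. (V (real (Suc n)) i x - v i x)\<^sup>2"] V_minus_v_integrable by auto
  have "AE x in lborel. ennreal ((v i x) ^ 6) \<le> liminf (\<lambda>n. ennreal ((V (real (Suc (r n))) i x) ^ 6))"
    using r(2)
  proof eventually_elim
    case (elim x)
    then have "(\<lambda>n. sqrt ((V (real (Suc (r n))) i x - v i x)\<^sup>2)) \<longlonglongrightarrow> sqrt 0"
      by (rule tendsto_real_sqrt)
    then have "(\<lambda>n. V (real (Suc (r n))) i x - v i x) \<longlonglongrightarrow> 0"
      by (simp add: tendsto_rabs_zero_iff)
    then have "(\<lambda>n. V (real (Suc (r n))) i x) \<longlonglongrightarrow> v i x"
      by (simp add: LIM_zero_iff)
    then have "(\<lambda>n. ennreal ((V (real (Suc (r n))) i x) ^ 6)) \<longlonglongrightarrow> ennreal ((v i x) ^ 6)"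
      by (intro tendsto_ennrealI tendsto_intros)
    then have "liminf (\<lambda>n. ennreal ((V (real (Suc (r n))) i x) ^ 6)) = ennreal ((v i x) ^ 6)"
      by (rule lim_imp_Liminf[OF trivial_limit_sequentially])
    then show ?case by (rule eq_refl[OF sym])
  qed
  then have "(\<integral>\<^sup>+x. ennreal ((v i x) ^ 6) \<partial>lborel) \<le> (\<integral>\<^sup>+x. liminf (\<lambda>n. ennreal ((V (real (Suc (r n))) i x) ^ 6)) \<partial>lborel)"
    by (rule nn_integral_mono_AE)
  also have "\<dots> \<le> liminf (\<lambda>n. \<integral>\<^sup>+x. ennreal ((V (real (Suc (r n))) i x) ^ 6) \<partial>lborel)"
    by (rule nn_integral_liminf) simp
  also have "\<dots> \<le> ennreal K6"
    by (rule Liminf_le) (auto intro!: always_eventually V_L6 simp del: of_nat_Suc)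
  finally show ?thesis .
qed

definition K2 :: real where
  "K2 = 4 * wnorm\<^sup>2 + 2 * K0\<^sup>2 * unit_ball_vol 3"

text \<open>The averaging length is matched to the ball: \<open>v - V (1/R)\<close> has L^2 norm
  O(R), and |V (1/R)| is at most K0 R^(-1/2), whose square over a volume of order R^3 again gives
  R^2.\<close>

lemma v_L2_ball:
  assumes R: "R > 0"
  shows "(\<integral>\<^sup>+x. ennreal ((v i x)\<^sup>2) * indicator (cball 0 R) x \<partial>lborel) \<le> ennreal (K2 * R\<^sup>2)"
proof -
  have "ennreal ((v i x)\<^sup>2) * indicator (cball 0 R) x
      \<le> 2 * ennreal ((V (1 / R) i x - v i x)\<^sup>2) + ennreal (2 * K0\<^sup>2 / R) * indicator (cball 0 R) x" for x
  proof (cases "norm x \<le> R")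
    case True
    have "\<bar>V (1 / R) i x\<bar>\<^sup>2 \<le> (K0 * sqrt (1 / R))\<^sup>2"
      using R by (intro power_mono K0) auto
    then have V: "(V (1 / R) i x)\<^sup>2 \<le> K0\<^sup>2 / R"
      using R by (simp add: power_mult_distrib)
    have "(v i x)\<^sup>2 \<le> 2 * (V (1 / R) i x - v i x)\<^sup>2 + 2 * (V (1 / R) i x)\<^sup>2"
      using square_add_le[of "v i x - V (1 / R) i x" "V (1 / R) i x"] by (simp add: power2_commute)
    then have "(v i x)\<^sup>2 \<le> 2 * (V (1 / R) i x - v i x)\<^sup>2 + 2 * K0\<^sup>2 / R" using V by simp
    then have "ennreal ((v i x)\<^sup>2) \<le> ennreal (2 * (V (1 / R) i x - v i x)\<^sup>2 + 2 * K0\<^sup>2 / R)"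
      by (rule ennreal_leI)
    then show ?thesis using True R by (simp add: ennreal_mult'')
  qed simp
  then have "(\<integral>\<^sup>+x. ennreal ((v i x)\<^sup>2) * indicator (cball 0 R) x \<partial>lborel)
      \<le> (\<integral>\<^sup>+x. 2 * ennreal ((V (1 / R) i x - v i x)\<^sup>2) + ennreal (2 * K0\<^sup>2 / R) * indicator (cball 0 R) x \<partial>lborel)"
    by (intro nn_integral_mono)
  also have "\<dots> = 2 * (\<integral>\<^sup>+x. ennreal ((V (1 / R) i x - v i x)\<^sup>2) \<partial>lborel) + ennreal (2 * K0\<^sup>2 / R) * emeasure lborel (cball (0::real^3) R)"
    by (simp add: nn_integral_add nn_integral_cmult nn_integral_cmult_indicator)
  also have "\<dots> \<le> 2 * ennreal (2 * (wnorm / (1 / R))\<^sup>2) + ennreal (2 * K0\<^sup>2 / R) * ennreal (unit_ball_vol 3 * R ^ 3)"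
    using R by (intro add_mono mult_left_mono V_minus_v_L2) (auto simp: emeasure_cball)
  also have "\<dots> = ennreal (2 * (2 * (wnorm / (1 / R))\<^sup>2) + 2 * K0\<^sup>2 / R * (unit_ball_vol 3 * R ^ 3))"
    using R by (simp add: ennreal_mult'' flip: ennreal_mult'' ennreal_numeral ennreal_plus)
  also have "2 * (2 * (wnorm / (1 / R))\<^sup>2) + 2 * K0\<^sup>2 / R * (unit_ball_vol 3 * R ^ 3) = K2 * R\<^sup>2"
    using R by (simp add: K2_def power2_eq_square power3_eq_cube algebra_simps)
  finally show ?thesis .
qed

end

subsection \<open>The energy identity\<close>

lemma Cauchy_Schwarz_integral:
  fixes f g :: "real^3 \<Rightarrow> real"
  assumes [measurable]: "f \<in> borel_measurable borel" "g \<in> borel_measurable borel"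
    and int: "integrable lborel (\<lambda>x. (f x)\<^sup>2)" "integrable lborel (\<lambda>x. (g x)\<^sup>2)"
  shows integrable_mult_L2: "integrable lborel (\<lambda>x. f x * g x)"
    and abs_integral_mult_le: "\<bar>\<integral>x. f x * g x \<partial>lborel\<bar> \<le> sqrt (\<integral>x. (f x)\<^sup>2 \<partial>lborel) * sqrt (\<integral>x. (g x)\<^sup>2 \<partial>lborel)"
proof -
  let ?F = "\<integral>x. (f x)\<^sup>2 \<partial>lborel" and ?G = "\<integral>x. (g x)\<^sup>2 \<partial>lborel"
  have "(\<integral>\<^sup>+x. ennreal \<bar>f x\<bar> * ennreal \<bar>g x\<bar> \<partial>lborel)\<^sup>2
      \<le> (\<integral>\<^sup>+x. (ennreal \<bar>f x\<bar>)\<^sup>2 \<partial>lborel) * (\<integral>\<^sup>+x. (ennreal \<bar>g x\<bar>)\<^sup>2 \<partial>lborel)"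
    by (rule Cauchy_Schwarz_nn_integral) auto
  also have "\<dots> = ennreal ?F * ennreal ?G"
    using int by (simp add: ennreal_power nn_integral_eq_integral)
  also have "\<dots> = (ennreal (sqrt ?F * sqrt ?G))\<^sup>2"
    by (simp add: ennreal_power power_mult_distrib flip: ennreal_mult)
  finally have le: "(\<integral>\<^sup>+x. ennreal \<bar>f x\<bar> * ennreal \<bar>g x\<bar> \<partial>lborel) \<le> ennreal (sqrt ?F * sqrt ?G)"
    by (rule ennreal_square_le) simp
  then have le': "(\<integral>\<^sup>+x. ennreal (norm (f x * g x)) \<partial>lborel) \<le> ennreal (sqrt ?F * sqrt ?G)"
    by (simp add: abs_mult ennreal_mult)
  then show int: "integrable lborel (\<lambda>x. f x * g x)"
    by (intro integrableI_bounded) (auto simp: le_less_trans)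
  have "ennreal \<bar>\<integral>x. f x * g x \<partial>lborel\<bar> \<le> ennreal (sqrt ?F * sqrt ?G)"
    using order_trans[OF integral_norm_bound_ennreal[OF int] le'] by simp
  then show "\<bar>\<integral>x. f x * g x \<partial>lborel\<bar> \<le> sqrt ?F * sqrt ?G"
    by (subst (asm) ennreal_le_iff) auto
qed

section \<open>Limits of products of locally square-integrable functions\<close>

definition L2_loc :: "(real^3 \<Rightarrow> real) \<Rightarrow> bool" where
  "L2_loc f \<longleftrightarrow> f \<in> borel_measurable borel \<and> (\<forall>R. integrable lborel (\<lambda>x. indicator (cball 0 R) x * (f x)\<^sup>2))"

lemma L2_loc_mult_test:
  assumes "L2_loc f" "g \<in> test_functions"
  shows "integrable lborel (\<lambda>x. (f x * g x)\<^sup>2)"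
proof -
  have "loc_int (\<lambda>x. (f x)\<^sup>2)" using assms(1) by (auto simp: L2_loc_def loc_int_def)
  moreover have "(\<lambda>x. g x * g x) \<in> test_functions" using assms(2) by (intro test_mult_left) auto
  ultimately show ?thesis
    using loc_int_test[of "\<lambda>x. (f x)\<^sup>2" "\<lambda>x. g x * g x"] by (simp add: power2_eq_square mult_ac)
qed

lemma L2_loc_mult_loc_int:
  assumes "L2_loc f" "L2_loc g"
  shows "loc_int (\<lambda>x. f x * g x)"
  unfolding loc_int_def
proof (intro conjI allI)
  have [measurable]: "f \<in> borel_measurable borel" "g \<in> borel_measurable borel"
    using assms by (auto simp: L2_loc_def)
  show "(\<lambda>x. f x * g x) \<in> borel_measurable borel" by measurable
  fix R
  show "integrable lborel (\<lambda>x. indicator (cball 0 R) x * (f x * g x))"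
  proof (rule Bochner_Integration.integrable_bound)
    show "integrable lborel (\<lambda>x. indicator (cball 0 R) x * (f x)\<^sup>2 + indicator (cball 0 R) x * (g x)\<^sup>2)"
      using assms by (auto simp: L2_loc_def)
    have "\<bar>a * b\<bar> \<le> a\<^sup>2 + b\<^sup>2" for a b :: real
      using sum_squares_bound[of "\<bar>a\<bar>" "\<bar>b\<bar>"] by (auto simp: abs_mult intro: order_trans[rotated])
    then show "AE x in lborel. norm (indicator (cball 0 R) x * (f x * g x))
        \<le> norm (indicator (cball 0 R) x * (f x)\<^sup>2 + indicator (cball 0 R) x * (g x)\<^sup>2)"
      by (intro AE_I2) (auto simp: indicator_def add_nonneg_nonneg)
  qed measurable
qed

lemma smooth_L2_loc: "smooth f \<Longrightarrow> L2_loc f"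
  using test_loc_int[of "\<lambda>x. f x * f x"] smooth_borel
  by (auto simp: L2_loc_def loc_int_def power2_eq_square)

lemma L2_imp_L2_loc: "f \<in> borel_measurable borel \<Longrightarrow> integrable lborel (\<lambda>x. (f x)\<^sup>2) \<Longrightarrow> L2_loc f"
  using integrable_mult_indicator[of "cball 0 _" lborel "\<lambda>x. (f x)\<^sup>2"] by (auto simp: L2_loc_def)

text \<open>Only the differences have to be square integrable: \<open>v\<close> itself is not known
  to lie in L^2, while \<open>V t - v\<close> does.\<close>

definition tends_L2 :: "(nat \<Rightarrow> real^3 \<Rightarrow> real) \<Rightarrow> (real^3 \<Rightarrow> real) \<Rightarrow> bool" where
  "tends_L2 F f \<longleftrightarrow> (\<forall>n. integrable lborel (\<lambda>x. (F n x - f x)\<^sup>2)) \<and> (\<lambda>n. \<integral>x. (F n x - f x)\<^sup>2 \<partial>lborel) \<longlonglongrightarrow> 0"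

lemma tends_L2_sqrt: "tends_L2 F f \<Longrightarrow> (\<lambda>n. sqrt (\<integral>x. (F n x - f x)\<^sup>2 \<partial>lborel)) \<longlonglongrightarrow> 0"
  unfolding tends_L2_def using tendsto_real_sqrt[of _ 0] by auto

lemma tends_L2_const: "tends_L2 (\<lambda>n. f) f"
  by (simp add: tends_L2_def)

text \<open>FH - fh is (F - f)(H - h) + (F - f) h + (H - h) f. In each term Cauchy-Schwarz applies
  once the test function localises the factors h and f, which are square integrable only
  locally.\<close>

lemma tends_L2_product:
  assumes F: "tends_L2 F f" "\<And>n. L2_loc (F n)" "L2_loc f"
    and H: "tends_L2 H h" "\<And>n. L2_loc (H n)" "L2_loc h" and \<theta>: "\<theta> \<in> test_functions"
  shows "(\<lambda>n. \<integral>x. F n x * H n x * \<theta> x \<partial>lborel) \<longlonglongrightarrow> (\<integral>x. f x * h x * \<theta> x \<partial>lborel)"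
proof -
  have [measurable]: "F n \<in> borel_measurable borel" "f \<in> borel_measurable borel"
    "H n \<in> borel_measurable borel" "h \<in> borel_measurable borel" "\<theta> \<in> borel_measurable borel" for n
    using F H \<theta> smooth_borel by (auto simp: L2_loc_def)
  obtain B where B: "B \<ge> 0" "\<And>x. \<bar>\<theta> x\<bar> \<le> B" using test_bounded[OF \<theta>] by blast
  let ?Fn = "\<lambda>n. sqrt (\<integral>x. (F n x - f x)\<^sup>2 \<partial>lborel)" and ?Hn = "\<lambda>n. sqrt (\<integral>x. (H n x - h x)\<^sup>2 \<partial>lborel)"
    and ?f = "sqrt (\<integral>x. (f x * \<theta> x)\<^sup>2 \<partial>lborel)" and ?h = "sqrt (\<integral>x. (h x * \<theta> x)\<^sup>2 \<partial>lborel)"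
  have Fi: "integrable lborel (\<lambda>x. (F n x - f x)\<^sup>2)" and Hi: "integrable lborel (\<lambda>x. (H n x - h x)\<^sup>2)" for n
    using F H by (auto simp: tends_L2_def)
  have H\<theta>: "integrable lborel (\<lambda>x. ((H n x - h x) * \<theta> x)\<^sup>2)"
      "sqrt (\<integral>x. ((H n x - h x) * \<theta> x)\<^sup>2 \<partial>lborel) \<le> B * ?Hn n" for n
  proof -
    have le: "((H n x - h x) * \<theta> x)\<^sup>2 \<le> B\<^sup>2 * (H n x - h x)\<^sup>2" for x
    proof -
      have "\<bar>(H n x - h x) * \<theta> x\<bar>\<^sup>2 \<le> (\<bar>H n x - h x\<bar> * B)\<^sup>2"
        unfolding abs_mult by (intro power_mono mult_left_mono B) auto
      then show ?thesis by (simp add: power_mult_distrib mult.commute)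
    qed
    show i: "integrable lborel (\<lambda>x. ((H n x - h x) * \<theta> x)\<^sup>2)"
      by (rule Bochner_Integration.integrable_bound[OF integrable_mult_right[OF Hi[of n], of "B\<^sup>2"]]) (use le in auto)
    have "(\<integral>x. ((H n x - h x) * \<theta> x)\<^sup>2 \<partial>lborel) \<le> (\<integral>x. B\<^sup>2 * (H n x - h x)\<^sup>2 \<partial>lborel)"
      using le i Hi by (intro integral_mono) auto
    then have "sqrt (\<integral>x. ((H n x - h x) * \<theta> x)\<^sup>2 \<partial>lborel) \<le> sqrt (B\<^sup>2 * (\<integral>x. (H n x - h x)\<^sup>2 \<partial>lborel))"
      by simp
    then show "sqrt (\<integral>x. ((H n x - h x) * \<theta> x)\<^sup>2 \<partial>lborel) \<le> B * ?Hn n"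
      using B by (simp add: real_sqrt_mult)
  qed
  have f\<theta>: "integrable lborel (\<lambda>x. (f x * \<theta> x)\<^sup>2)" and h\<theta>: "integrable lborel (\<lambda>x. (h x * \<theta> x)\<^sup>2)"
    using F H \<theta> by (auto intro: L2_loc_mult_test)
  have bound: "\<bar>(\<integral>x. F n x * H n x * \<theta> x \<partial>lborel) - (\<integral>x. f x * h x * \<theta> x \<partial>lborel)\<bar>
      \<le> ?Fn n * (B * ?Hn n) + ?Fn n * ?h + ?Hn n * ?f" for n
  proof -
    have i1: "integrable lborel (\<lambda>x. (F n x - f x) * ((H n x - h x) * \<theta> x))"
      and i2: "integrable lborel (\<lambda>x. (F n x - f x) * (h x * \<theta> x))"
      and i3: "integrable lborel (\<lambda>x. (H n x - h x) * (f x * \<theta> x))"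
      using Fi Hi H\<theta> f\<theta> h\<theta> by (auto intro!: integrable_mult_L2)
    have i4: "integrable lborel (\<lambda>x. F n x * H n x * \<theta> x)" "integrable lborel (\<lambda>x. f x * h x * \<theta> x)"
      using F H \<theta> by (auto intro!: loc_int_test L2_loc_mult_loc_int)
    have "(\<integral>x. F n x * H n x * \<theta> x \<partial>lborel) - (\<integral>x. f x * h x * \<theta> x \<partial>lborel)
        = (\<integral>x. (F n x - f x) * ((H n x - h x) * \<theta> x) + (F n x - f x) * (h x * \<theta> x) + (H n x - h x) * (f x * \<theta> x) \<partial>lborel)"
      using i4 by (subst Bochner_Integration.integral_diff[symmetric]) (auto simp: algebra_simps intro!: Bochner_Integration.integral_cong)
    also have "\<dots> = (\<integral>x. (F n x - f x) * ((H n x - h x) * \<theta> x) \<partial>lborel) + (\<integral>x. (F n x - f x) * (h x * \<theta> x) \<partial>lborel)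
        + (\<integral>x. (H n x - h x) * (f x * \<theta> x) \<partial>lborel)"
      using i1 i2 i3 by simp
    finally have eq: "(\<integral>x. F n x * H n x * \<theta> x \<partial>lborel) - (\<integral>x. f x * h x * \<theta> x \<partial>lborel) = \<dots>" .
    have "\<bar>\<integral>x. (F n x - f x) * ((H n x - h x) * \<theta> x) \<partial>lborel\<bar> \<le> ?Fn n * (B * ?Hn n)"
      by (rule order_trans[OF abs_integral_mult_le mult_left_mono]) (use Fi H\<theta> in auto)
    moreover have "\<bar>\<integral>x. (F n x - f x) * (h x * \<theta> x) \<partial>lborel\<bar> \<le> ?Fn n * ?h"
      by (rule abs_integral_mult_le) (use Fi h\<theta> in auto)
    moreover have "\<bar>\<integral>x. (H n x - h x) * (f x * \<theta> x) \<partial>lborel\<bar> \<le> ?Hn n * ?f"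
      by (rule abs_integral_mult_le) (use Hi f\<theta> in auto)
    ultimately show ?thesis unfolding eq by linarith
  qed
  have "(\<lambda>n. ?Fn n * (B * ?Hn n) + ?Fn n * ?h + ?Hn n * ?f) \<longlonglongrightarrow> 0 * (B * 0) + 0 * ?h + 0 * ?f"
    by (intro tendsto_intros tends_L2_sqrt F H)
  then have "(\<lambda>n. ?Fn n * (B * ?Hn n) + ?Fn n * ?h + ?Hn n * ?f) \<longlonglongrightarrow> 0"
    by (simp only: mult_zero_left add_0)
  then have "(\<lambda>n. (\<integral>x. F n x * H n x * \<theta> x \<partial>lborel) - (\<integral>x. f x * h x * \<theta> x \<partial>lborel)) \<longlonglongrightarrow> 0"
    by (rule Lim_null_comparison[rotated]) (intro always_eventually allI, unfold real_norm_def, rule bound)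
  then show ?thesis by (simp add: LIM_zero_iff)
qed

lemma (in bump) tends_L2_conv:
  assumes [measurable]: "f \<in> borel_measurable borel" and int: "integrable lborel (\<lambda>x. (f x)\<^sup>2)"
  shows "tends_L2 (\<lambda>n. conv (moll (real (Suc n))) f) f"
proof -
  have L: "L2_loc (conv (moll (real (Suc n))) f)" for n
    by (intro smooth_L2_loc smooth_conv integrable_square_loc_int assms moll_test) simp
  then have [measurable]: "conv (moll (real (Suc n))) f \<in> borel_measurable borel" for n
    by (simp add: L2_loc_def)
  have fin: "(\<integral>\<^sup>+x. ennreal ((f x)\<^sup>2) \<partial>lborel) < \<infinity>"
    using int by (simp add: nn_integral_eq_integral)
  have i: "integrable lborel (\<lambda>x. (conv (moll (real (Suc n))) f x - f x)\<^sup>2)" for n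
  proof -
    have "integrable lborel (\<lambda>x. (conv (moll (real (Suc n))) f x)\<^sup>2)"
      using conv_moll_L2[of f "real (Suc n)"] fin by (intro integrableI_nonneg) (auto simp: le_less_trans simp del: of_nat_Suc)
    then have "integrable lborel (\<lambda>x. 2 * (conv (moll (real (Suc n))) f x)\<^sup>2 + 2 * (f x)\<^sup>2)"
      using int by simp
    then show ?thesis
    proof (rule Bochner_Integration.integrable_bound)
      show "AE x in lborel. norm ((conv (moll (real (Suc n))) f x - f x)\<^sup>2) \<le> norm (2 * (conv (moll (real (Suc n))) f x)\<^sup>2 + 2 * (f x)\<^sup>2)"
        using square_add_le[of "conv (moll (real (Suc n))) f _" "- f _"] by (intro AE_I2) simp
    qed measurable
  qed
  have "(\<lambda>n. \<integral>x. (conv (moll (real (Suc n))) f x - f x)\<^sup>2 \<partial>lborel) \<longlonglongrightarrow> 0"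
  proof (rule LIMSEQ_I)
    fix e :: real assume e: "e > 0"
    obtain T where T: "T \<ge> 1" "\<And>t. t \<ge> T \<Longrightarrow> (\<integral>\<^sup>+x. ennreal ((conv (moll t) f x - f x)\<^sup>2) \<partial>lborel) \<le> ennreal (e / 2)"
      using conv_moll_tendsto_L2[OF assms(1) int, of "e / 2"] e by auto
    obtain N where N: "T \<le> real N" using real_arch_simple by blast
    have "norm ((\<integral>x. (conv (moll (real (Suc n))) f x - f x)\<^sup>2 \<partial>lborel) - 0) < e" if "n \<ge> N" for n
    proof -
      have "(\<integral>\<^sup>+x. ennreal ((conv (moll (real (Suc n))) f x - f x)\<^sup>2) \<partial>lborel) \<le> ennreal (e / 2)"
        using that N by (intro T) auto
      then have "ennreal (\<integral>x. (conv (moll (real (Suc n))) f x - f x)\<^sup>2 \<partial>lborel) \<le> ennreal (e / 2)"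
        by (subst (asm) nn_integral_eq_integral[OF i]) auto
      then have "(\<integral>x. (conv (moll (real (Suc n))) f x - f x)\<^sup>2 \<partial>lborel) \<le> e / 2"
        using e by (subst (asm) ennreal_le_iff) auto
      then show ?thesis using e by simp
    qed
    then show "\<exists>N. \<forall>n\<ge>N. norm ((\<integral>x. (conv (moll (real (Suc n))) f x - f x)\<^sup>2 \<partial>lborel) - 0) < e" by blast
  qed
  with i show ?thesis by (simp add: tends_L2_def)
qed

section \<open>Mollified fields and the convection term\<close>

context decaying_curl_system begin

abbreviation Vn :: "nat \<Rightarrow> 3 \<Rightarrow> real^3 \<Rightarrow> real" where "Vn n \<equiv> V (real (Suc n))"
abbreviation Wn :: "nat \<Rightarrow> 3 \<Rightarrow> 3 \<Rightarrow> real^3 \<Rightarrow> real" where "Wn n j i \<equiv> conv (moll (real (Suc n))) (W j i)"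

lemma Vn_smooth: "smooth (Vn n i)"
  by (rule V_smooth) simp

lemma v_L2_locI: "L2_loc (v i)"
  by (simp add: L2_loc_def v_L2_loc)

lemma W_L2_locI: "L2_loc (W j i)"
  by (simp add: L2_imp_L2_loc W_L2)

lemma Wn_L2_locI: "L2_loc (Wn n j i)"
  by (intro smooth_L2_loc smooth_conv W_loc_int moll_test) simp

lemma Vn_tends: "tends_L2 (\<lambda>n. Vn n i) (v i)"
proof -
  have "(\<lambda>n. enn2real (\<integral>\<^sup>+x. ennreal ((Vn n i x - v i x)\<^sup>2) \<partial>lborel)) \<longlonglongrightarrow> 0"
    by (rule tendsto_enn2real[where l = 0, simplified, OF V_minus_v_tendsto])
  then show ?thesis
    by (simp add: tends_L2_def V_minus_v_integrable integral_eq_nn_integral)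
qed

lemma Wn_tends: "tends_L2 (\<lambda>n. Wn n j i) (W j i)"
  by (intro tends_L2_conv W_L2) simp

lemma curl_V:
  assumes "t \<noteq> 0"
  shows "partial j (V t i) x - partial i (V t j) x = conv (moll t) (W j i) x"
proof -
  have m: "moll t \<in> test_functions" using assms by (rule moll_test)
  have "partial j (V t i) x = - (\<integral>y. v i y * partial j (\<lambda>y. moll t (x - y)) y \<partial>lborel)" for i j
    unfolding V_def partial_conv[OF v_loc_int m] by (simp add: conv_def test_reflect(2)[OF m])
  then show ?thesis
    using weak_curl[OF test_reflect(1)[OF m], of i j x] by (simp add: conv_def)
qed

lemma div_V:
  assumes "t \<noteq> 0"
  shows "(\<Sum>j\<in>UNIV. partial j (V t j) x) = 0"
proof -
  have m: "moll t \<in> test_functions" using assms by (rule moll_test)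
  have "partial j (V t i) x = - (\<integral>y. v i y * partial j (\<lambda>y. moll t (x - y)) y \<partial>lborel)" for i j
    unfolding V_def partial_conv[OF v_loc_int m] by (simp add: conv_def test_reflect(2)[OF m])
  then show ?thesis
    using weak_div[OF test_reflect(1)[OF m], of x] by (simp add: sum_negf)
qed

text \<open>Lamb's form of the convection: summed over j, V_j d_j V_i - V_j d_i V_j equals V_j W_ji,
  and the extra term of the product rule contains the divergence. Integration by parts moves the
  derivatives onto \<theta>.\<close>

lemma Vn_convection:
  assumes \<theta>: "\<theta> \<in> test_functions"
  shows "(\<Sum>j\<in>UNIV. \<integral>x. Vn n j x * Vn n i x * partial j \<theta> x \<partial>lborel)
    - 1/2 * (\<Sum>j\<in>UNIV. \<integral>x. Vn n j x * Vn n j x * partial i \<theta> x \<partial>lborel)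
    = - (\<Sum>j\<in>UNIV. \<integral>x. Vn n j x * Wn n j i x * \<theta> x \<partial>lborel)"
proof -
  let ?V = "Vn n"
  have V: "smooth (?V j)" for j by (rule Vn_smooth)
  have p: "partial k (\<lambda>x. ?V j x * ?V i x) x = ?V j x * partial k (?V i) x + partial k (?V j) x * ?V i x" for i j k x
    by (intro partial_mult smooth_differentiable V)
  have "(\<Sum>j\<in>UNIV. \<integral>x. ?V j x * ?V i x * partial j \<theta> x \<partial>lborel) - 1/2 * (\<Sum>j\<in>UNIV. \<integral>x. ?V j x * ?V j x * partial i \<theta> x \<partial>lborel)
    = (\<Sum>j\<in>UNIV. - (\<integral>x. (?V j x * partial j (?V i) x + partial j (?V j) x * ?V i x) * \<theta> x \<partial>lborel)
        + (\<integral>x. ?V j x * partial i (?V j) x * \<theta> x \<partial>lborel))"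
  proof -
    have "(\<integral>x. ?V j x * ?V i x * partial k \<theta> x \<partial>lborel) = - (\<integral>x. (?V j x * partial k (?V i) x + partial k (?V j) x * ?V i x) * \<theta> x \<partial>lborel)" for i j k
      using integration_by_parts[OF \<theta> smooth_mult[OF V V], of j i k] unfolding p .
    moreover have "(\<integral>x. (?V j x * partial i (?V j) x + partial i (?V j) x * ?V j x) * \<theta> x \<partial>lborel) = 2 * (\<integral>x. ?V j x * partial i (?V j) x * \<theta> x \<partial>lborel)" for j
      unfolding Bochner_Integration.integral_mult_right_zero[symmetric]
      by (rule Bochner_Integration.integral_cong) (auto simp: algebra_simps)
    ultimately show ?thesis
      by (simp add: sum_negf sum.distrib sum_subtractf flip: sum_distrib_left)
  qed
  also have "\<dots> = (\<Sum>j\<in>UNIV. - (\<integral>x. (?V j x * Wn n j i x * \<theta> x + partial j (?V j) x * (?V i x * \<theta> x)) \<partial>lborel))"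
  proof (rule sum.cong[OF refl])
    fix j
    have i1: "integrable lborel (\<lambda>x. (?V j x * partial j (?V i) x + partial j (?V j) x * ?V i x) * \<theta> x)"
      and i2: "integrable lborel (\<lambda>x. ?V j x * partial i (?V j) x * \<theta> x)"
      by (intro test_integrable test_mult_left smooth_add smooth_mult V smooth_partial \<theta>)+
    have W: "partial j (?V i) x - partial i (?V j) x = Wn n j i x" for x
      by (rule curl_V) simp
    have "- (\<integral>x. (?V j x * partial j (?V i) x + partial j (?V j) x * ?V i x) * \<theta> x \<partial>lborel) + (\<integral>x. ?V j x * partial i (?V j) x * \<theta> x \<partial>lborel)
       = - (\<integral>x. (?V j x * partial j (?V i) x + partial j (?V j) x * ?V i x) * \<theta> x - ?V j x * partial i (?V j) x * \<theta> x \<partial>lborel)"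
      using i1 i2 by simp
    also have "\<dots> = - (\<integral>x. (?V j x * Wn n j i x * \<theta> x + partial j (?V j) x * (?V i x * \<theta> x)) \<partial>lborel)"
      unfolding W[symmetric] by (simp add: algebra_simps)
    finally show "- (\<integral>x. (?V j x * partial j (?V i) x + partial j (?V j) x * ?V i x) * \<theta> x \<partial>lborel) + (\<integral>x. ?V j x * partial i (?V j) x * \<theta> x \<partial>lborel)
      = - (\<integral>x. (?V j x * Wn n j i x * \<theta> x + partial j (?V j) x * (?V i x * \<theta> x)) \<partial>lborel)" .
  qed
  also have "\<dots> = - (\<Sum>j\<in>UNIV. \<integral>x. ?V j x * Wn n j i x * \<theta> x \<partial>lborel) - (\<integral>x. (\<Sum>j\<in>UNIV. partial j (?V j) x) * (?V i x * \<theta> x) \<partial>lborel)"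
  proof -
    have W: "smooth (Wn n j i)" for j by (intro smooth_conv W_loc_int moll_test) simp
    have i1: "integrable lborel (\<lambda>x. ?V j x * Wn n j i x * \<theta> x)" and i2: "integrable lborel (\<lambda>x. partial j (?V j) x * (?V i x * \<theta> x))" for j
      by (intro test_integrable test_mult_left smooth_mult V W smooth_partial \<theta>)+
    show ?thesis
      unfolding sum_distrib_right using i1 i2
      by (simp add: sum_negf sum_subtractf Bochner_Integration.integral_sum)
  qed
  also have "\<dots> = - (\<Sum>j\<in>UNIV. \<integral>x. ?V j x * Wn n j i x * \<theta> x \<partial>lborel)"
    by (simp add: div_V)
  finally show ?thesis .
qed

text \<open>The identity contains products of two factors and no derivative of \<open>v\<close>, so
  L^2 convergence carries it over from the mollified field, where the classical computation is
  legitimate.\<close>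

lemma v_convection:
  assumes \<theta>: "\<theta> \<in> test_functions"
  shows "(\<Sum>j\<in>UNIV. \<integral>x. v j x * v i x * partial j \<theta> x \<partial>lborel)
    - 1/2 * (\<Sum>j\<in>UNIV. \<integral>x. v j x * v j x * partial i \<theta> x \<partial>lborel)
    = - (\<Sum>j\<in>UNIV. \<integral>x. v j x * W j i x * \<theta> x \<partial>lborel)"
proof (rule LIMSEQ_unique)
  note L = Vn_tends smooth_L2_loc[OF Vn_smooth] v_L2_locI Wn_tends Wn_L2_locI W_L2_locI
  show "(\<lambda>n. (\<Sum>j\<in>UNIV. \<integral>x. Vn n j x * Vn n i x * partial j \<theta> x \<partial>lborel)
    - 1/2 * (\<Sum>j\<in>UNIV. \<integral>x. Vn n j x * Vn n j x * partial i \<theta> x \<partial>lborel))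
    \<longlonglongrightarrow> (\<Sum>j\<in>UNIV. \<integral>x. v j x * v i x * partial j \<theta> x \<partial>lborel)
    - 1/2 * (\<Sum>j\<in>UNIV. \<integral>x. v j x * v j x * partial i \<theta> x \<partial>lborel)"
    by (intro tendsto_intros tends_L2_product L test_partial \<theta>)
  show "(\<lambda>n. (\<Sum>j\<in>UNIV. \<integral>x. Vn n j x * Vn n i x * partial j \<theta> x \<partial>lborel)
    - 1/2 * (\<Sum>j\<in>UNIV. \<integral>x. Vn n j x * Vn n j x * partial i \<theta> x \<partial>lborel))
    \<longlonglongrightarrow> - (\<Sum>j\<in>UNIV. \<integral>x. v j x * W j i x * \<theta> x \<partial>lborel)"
    unfolding Vn_convection[OF \<theta>] by (intro tendsto_intros tends_L2_product L \<theta>)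
qed

end

lemma integral_double_sum:
  fixes f :: "3 \<Rightarrow> 3 \<Rightarrow> real^3 \<Rightarrow> real"
  assumes "\<And>i j. integrable lborel (f i j)"
  shows "(\<integral>x. (\<Sum>i\<in>UNIV. \<Sum>j\<in>UNIV. f i j x) \<partial>lborel) = (\<Sum>i\<in>UNIV. \<Sum>j\<in>UNIV. \<integral>x. f i j x \<partial>lborel)"
  using assms by (simp add: Bochner_Integration.integral_sum)

section \<open>Energy identity for the stationary system\<close>

text \<open>\<open>G\<close> stands for the gradient of Q. In \<open>momentum\<close> the pressure
  gradient is written as \<open>G\<close> minus the gradient of |v|^2/2, so the pressure no longer
  appears; that \<open>G\<close> is a gradient is retained as \<open>G_curl\<close>.\<close>

locale ns_system = decaying_curl_system +
  fixes \<nu> :: real and G :: "3 \<Rightarrow> real^3 \<Rightarrow> real"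
  assumes \<nu>: "\<nu> > 0"
    and G_borel [measurable]: "G i \<in> borel_measurable borel"
    and G_int: "integrable lborel (\<lambda>x. \<bar>G i x\<bar> powr (6/5))"
    and G_curl: "\<theta> \<in> test_functions \<Longrightarrow> (\<integral>x. G i x * partial j \<theta> x \<partial>lborel) = (\<integral>x. G j x * partial i \<theta> x \<partial>lborel)"
    and momentum: "\<theta> \<in> test_functions \<Longrightarrow>
      - \<nu> * (\<integral>x. v i x * (\<Sum>j\<in>UNIV. partial j (partial j \<theta>) x) \<partial>lborel)
      - (\<Sum>j\<in>UNIV. \<integral>x. v j x * v i x * partial j \<theta> x \<partial>lborel)
      + 1/2 * (\<Sum>j\<in>UNIV. \<integral>x. v j x * v j x * partial i \<theta> x \<partial>lborel)
      + (\<integral>x. G i x * \<theta> x \<partial>lborel) = 0"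
begin

lemma G_loc_int: "loc_int (G i)"
  unfolding loc_int_def
proof (intro conjI allI)
  fix R
  have int: "integrable lborel (\<lambda>x. indicator (cball 0 R) x + indicator (cball 0 R) x * \<bar>G i x\<bar> powr (6/5))"
    using integrable_mult_indicator[OF _ G_int[of i], of "cball 0 R"] emeasure_lborel_cball_finite[of "0::real^3" R] by auto
  have "\<bar>a\<bar> \<le> 1 + \<bar>a\<bar> powr (6/5)" for a :: real
  proof (cases "\<bar>a\<bar> \<ge> 1")
    case True
    then have "\<bar>a\<bar> powr 1 \<le> \<bar>a\<bar> powr (6/5)" by (intro powr_mono) auto
    then show ?thesis using True by simp
  qed (use powr_ge_zero[of "\<bar>a\<bar>" "6/5"] in linarith)
  then have "AE x in lborel. norm (indicator (cball 0 R) x * G i x)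
      \<le> norm (indicator (cball 0 R) x + indicator (cball 0 R) x * \<bar>G i x\<bar> powr (6/5))"
    by (intro AE_I2) (auto simp: indicator_def)
  then show "integrable lborel (\<lambda>x. indicator (cball 0 R) x * G i x)"
    by (rule Bochner_Integration.integrable_bound[OF int, rotated]) measurable
qed simp

lemma vorticity_equation:
  assumes \<theta>: "\<theta> \<in> test_functions"
  shows "\<nu> * (\<Sum>j\<in>UNIV. \<integral>x. W j i x * partial j \<theta> x \<partial>lborel) + (\<Sum>j\<in>UNIV. \<integral>x. v j x * W j i x * \<theta> x \<partial>lborel)
    + (\<integral>x. G i x * \<theta> x \<partial>lborel) = 0"
  using momentum[OF \<theta>, of i] v_convection[OF \<theta>, of i] weak_laplacian[OF \<theta>, of i] by simp

lemma sixth_power_bound: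
  assumes [measurable]: "f \<in> borel_measurable borel" and "(\<integral>\<^sup>+x. ennreal ((f x) ^ 6) \<partial>lborel) \<le> ennreal K" "K \<ge> 0"
  shows "integrable lborel (\<lambda>x. (f x :: real) ^ 6)" "(\<integral>x. (f x) ^ 6 \<partial>(lborel :: (real^3) measure)) \<le> K"
proof -
  show i: "integrable lborel (\<lambda>x. (f x) ^ 6)"
    using assms by (intro integrableI_nonneg) (auto simp: le_less_trans)
  have "ennreal (\<integral>x. (f x) ^ 6 \<partial>lborel) \<le> ennreal K"
    using assms(2) i by (simp add: nn_integral_eq_integral)
  then show "(\<integral>x. (f x) ^ 6 \<partial>lborel) \<le> K" using assms(3) by (subst (asm) ennreal_le_iff) auto
qed

lemma K6_nonneg: "K6 \<ge> 0"
  by (simp add: K6_def)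

lemma diff_L6:
  "integrable lborel (\<lambda>x. (Vn n i x - v i x) ^ 6)" "(\<integral>x. (Vn n i x - v i x) ^ 6 \<partial>lborel) \<le> 64 * K6"
proof -
  note V6 = sixth_power_bound[OF V_measurable V_L6 K6_nonneg, of "real (Suc n)" i, simplified of_nat_0_less_iff zero_less_Suc]
  note v6 = sixth_power_bound[OF v_borel v_L6 K6_nonneg]
  \<comment> \<open>The convexity bound with constant 2^5, obtained by first squaring and then
    cubing; two such terms give 64 K6.\<close>
  have le: "(a - b) ^ 6 \<le> 32 * a ^ 6 + 32 * b ^ 6" for a b :: real
  proof -
    have "(a - b)\<^sup>2 \<le> 2 * a\<^sup>2 + 2 * b\<^sup>2" using square_add_le[of a "- b"] by simp
    then have "((a - b)\<^sup>2) ^ 3 \<le> (2 * a\<^sup>2 + 2 * b\<^sup>2) ^ 3" by (intro power_mono) auto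
    also have "\<dots> \<le> 32 * (a\<^sup>2) ^ 3 + 32 * (b\<^sup>2) ^ 3"
    proof -
      have cube: "(2 * s + 2 * t) ^ 3 \<le> 32 * s ^ 3 + 32 * t ^ 3" if "s \<ge> 0" "t \<ge> 0" for s t :: real
      proof -
        have "32 * s ^ 3 + 32 * t ^ 3 - (2 * s + 2 * t) ^ 3 = 24 * ((s + t) * (s - t)\<^sup>2)"
          by (simp add: power2_eq_square power3_eq_cube algebra_simps)
        moreover have "0 \<le> 24 * ((s + t) * (s - t)\<^sup>2)" using that by simp
        ultimately show ?thesis by linarith
      qed
      show ?thesis by (rule cube) simp_all
    qed
    finally show ?thesis by (simp flip: power_mult)
  qed
  have i: "integrable lborel (\<lambda>x. 32 * (Vn n i x) ^ 6 + 32 * (v i x) ^ 6)"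
    using V6(1) v6(1) by simp
  show j: "integrable lborel (\<lambda>x. (Vn n i x - v i x) ^ 6)"
    by (rule Bochner_Integration.integrable_bound[OF i]) (use le in \<open>auto simp del: of_nat_Suc\<close>)
  have "(\<integral>x. (Vn n i x - v i x) ^ 6 \<partial>lborel) \<le> (\<integral>x. 32 * (Vn n i x) ^ 6 + 32 * (v i x) ^ 6 \<partial>lborel)"
    using i j le by (intro integral_mono) auto
  also have "\<dots> \<le> 64 * K6" using V6 v6[of i] by (simp del: of_nat_Suc)
  finally show "(\<integral>x. (Vn n i x - v i x) ^ 6 \<partial>lborel) \<le> 64 * K6" .
qed

text \<open>As \<open>W\<close> is in L^2, it suffices to control v u chi in L^2, where u = Vn - v.
  Its square is bounded by a multiple of u times u v^2: the first factor is small in L^2, the second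
  bounded in L^2 by the sixth powers.\<close>

lemma cubic_estimate:
  assumes chi: "chi \<in> test_functions" and B: "B \<ge> 0" "\<And>x. \<bar>chi x\<bar> \<le> B"
  shows "integrable lborel (\<lambda>x. W j i x * (v j x * (Vn n i x - v i x) * chi x))"
    "\<bar>\<integral>x. W j i x * (v j x * (Vn n i x - v i x) * chi x) \<partial>lborel\<bar>
     \<le> sqrt (\<integral>x. (W j i x)\<^sup>2 \<partial>lborel) * sqrt (B\<^sup>2 * (sqrt (\<integral>x. (Vn n i x - v i x)\<^sup>2 \<partial>lborel) * sqrt (65 * K6)))"
proof -
  let ?u = "\<lambda>x. Vn n i x - v i x"
  have [measurable]: "chi \<in> borel_measurable borel" using chi smooth_borel by auto
  note v6 = sixth_power_bound[OF v_borel v_L6 K6_nonneg, of j]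
  have u2: "integrable lborel (\<lambda>x. (?u x)\<^sup>2)" using Vn_tends by (simp add: tends_L2_def)
  have mixed: "a\<^sup>2 * b ^ 4 \<le> a ^ 6 + b ^ 6" for a b :: real
  proof (cases "a\<^sup>2 \<le> b\<^sup>2")
    case True
    then have "a\<^sup>2 * b ^ 4 \<le> b\<^sup>2 * b ^ 4" by (intro mult_right_mono) auto
    also have "\<dots> = b ^ 6" by (simp flip: power_add)
    finally show ?thesis by (simp add: add_increasing)
  next
    case False
    then have "(b\<^sup>2)\<^sup>2 \<le> (a\<^sup>2)\<^sup>2" by (intro power_mono[of "b\<^sup>2" "a\<^sup>2"]) simp_all
    moreover have "(b\<^sup>2)\<^sup>2 = b ^ 4" "(a\<^sup>2)\<^sup>2 = a ^ 4" by (simp_all flip: power_mult)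
    ultimately have "a\<^sup>2 * b ^ 4 \<le> a\<^sup>2 * a ^ 4" by (intro mult_left_mono) simp_all
    also have "\<dots> = a ^ 6" by (simp flip: power_add)
    finally show ?thesis by (simp add: add_increasing2)
  qed
  \<comment> \<open>The constant is 64 + 1: the sixth power of u contributes 64 K6 and that of v
    contributes K6.\<close>
  have uv: "integrable lborel (\<lambda>x. (?u x * (v j x)\<^sup>2)\<^sup>2)" "(\<integral>x. (?u x * (v j x)\<^sup>2)\<^sup>2 \<partial>lborel) \<le> 65 * K6"
  proof -
    have i: "integrable lborel (\<lambda>x. (?u x) ^ 6 + (v j x) ^ 6)" using diff_L6(1)[of n i] v6(1) by simp
    have le: "(?u x * (v j x)\<^sup>2)\<^sup>2 \<le> (?u x) ^ 6 + (v j x) ^ 6" for x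
      using mixed[of "?u x" "v j x"] by (simp add: power_mult_distrib flip: power_mult)
    show j: "integrable lborel (\<lambda>x. (?u x * (v j x)\<^sup>2)\<^sup>2)"
      by (rule Bochner_Integration.integrable_bound[OF i]) (use le in \<open>auto simp del: of_nat_Suc\<close>)
    have "(\<integral>x. (?u x * (v j x)\<^sup>2)\<^sup>2 \<partial>lborel) \<le> (\<integral>x. (?u x) ^ 6 + (v j x) ^ 6 \<partial>lborel)"
      using i j le by (intro integral_mono) auto
    also have "\<dots> \<le> 65 * K6" using diff_L6[of n i] v6 by (simp del: of_nat_Suc)
    finally show "(\<integral>x. (?u x * (v j x)\<^sup>2)\<^sup>2 \<partial>lborel) \<le> 65 * K6" .
  qed
  have prod: "integrable lborel (\<lambda>x. ?u x * (?u x * (v j x)\<^sup>2))"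
    "(\<integral>x. ?u x * (?u x * (v j x)\<^sup>2) \<partial>lborel) \<le> sqrt (\<integral>x. (?u x)\<^sup>2 \<partial>lborel) * sqrt (65 * K6)"
  proof -
    show "integrable lborel (\<lambda>x. ?u x * (?u x * (v j x)\<^sup>2))"
      by (intro integrable_mult_L2 u2 uv) simp_all
    have "\<bar>\<integral>x. ?u x * (?u x * (v j x)\<^sup>2) \<partial>lborel\<bar> \<le> sqrt (\<integral>x. (?u x)\<^sup>2 \<partial>lborel) * sqrt (\<integral>x. (?u x * (v j x)\<^sup>2)\<^sup>2 \<partial>lborel)"
      by (intro abs_integral_mult_le u2 uv) simp_all
    also have "\<dots> \<le> sqrt (\<integral>x. (?u x)\<^sup>2 \<partial>lborel) * sqrt (65 * K6)"
      by (intro mult_left_mono real_sqrt_le_mono uv) simp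
    finally show "(\<integral>x. ?u x * (?u x * (v j x)\<^sup>2) \<partial>lborel) \<le> sqrt (\<integral>x. (?u x)\<^sup>2 \<partial>lborel) * sqrt (65 * K6)" by linarith
  qed
  have le: "(v j x * ?u x * chi x)\<^sup>2 \<le> B\<^sup>2 * (?u x * (?u x * (v j x)\<^sup>2))" for x
  proof -
    have "\<bar>chi x\<bar>\<^sup>2 \<le> B\<^sup>2" by (intro power_mono B) auto
    then have "(v j x * ?u x)\<^sup>2 * (chi x)\<^sup>2 \<le> (v j x * ?u x)\<^sup>2 * B\<^sup>2" by (intro mult_left_mono) auto
    then show ?thesis by (simp add: power_mult_distrib power2_eq_square mult_ac)
  qed
  have sq: "integrable lborel (\<lambda>x. (v j x * ?u x * chi x)\<^sup>2)"
    by (rule Bochner_Integration.integrable_bound[OF integrable_mult_right[OF prod(1), of "B\<^sup>2"]])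
      (use le in \<open>auto simp del: of_nat_Suc intro: order_trans[OF _ abs_ge_self]\<close>)
  have sq_le: "(\<integral>x. (v j x * ?u x * chi x)\<^sup>2 \<partial>lborel) \<le> B\<^sup>2 * (sqrt (\<integral>x. (?u x)\<^sup>2 \<partial>lborel) * sqrt (65 * K6))"
  proof -
    have "(\<integral>x. (v j x * ?u x * chi x)\<^sup>2 \<partial>lborel) \<le> (\<integral>x. B\<^sup>2 * (?u x * (?u x * (v j x)\<^sup>2)) \<partial>lborel)"
      using sq prod(1) le by (intro integral_mono integrable_mult_right) auto
    also have "\<dots> = B\<^sup>2 * (\<integral>x. ?u x * (?u x * (v j x)\<^sup>2) \<partial>lborel)" by simp
    also have "\<dots> \<le> B\<^sup>2 * (sqrt (\<integral>x. (?u x)\<^sup>2 \<partial>lborel) * sqrt (65 * K6))"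
      by (intro mult_left_mono prod) simp
    finally show ?thesis .
  qed
  show "integrable lborel (\<lambda>x. W j i x * (v j x * ?u x * chi x))"
    by (intro integrable_mult_L2 W_L2 sq) simp_all
  have "\<bar>\<integral>x. W j i x * (v j x * ?u x * chi x) \<partial>lborel\<bar>
      \<le> sqrt (\<integral>x. (W j i x)\<^sup>2 \<partial>lborel) * sqrt (\<integral>x. (v j x * ?u x * chi x)\<^sup>2 \<partial>lborel)"
    by (intro abs_integral_mult_le W_L2 sq) simp_all
  also have "\<dots> \<le> sqrt (\<integral>x. (W j i x)\<^sup>2 \<partial>lborel) * sqrt (B\<^sup>2 * (sqrt (\<integral>x. (?u x)\<^sup>2 \<partial>lborel) * sqrt (65 * K6)))"
    by (intro mult_left_mono real_sqrt_le_mono sq_le) simp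
  finally show "\<bar>\<integral>x. W j i x * (v j x * ?u x * chi x) \<partial>lborel\<bar>
      \<le> sqrt (\<integral>x. (W j i x)\<^sup>2 \<partial>lborel) * sqrt (B\<^sup>2 * (sqrt (\<integral>x. (?u x)\<^sup>2 \<partial>lborel) * sqrt (65 * K6)))" .
qed

lemma cubic_tendsto_0:
  assumes chi: "chi \<in> test_functions"
  shows "(\<lambda>n. \<integral>x. W j i x * (v j x * (Vn n i x - v i x) * chi x) \<partial>lborel) \<longlonglongrightarrow> 0"
proof -
  obtain B where B: "B \<ge> 0" "\<And>x. \<bar>chi x\<bar> \<le> B" using test_bounded[OF chi] by blast
  have "(\<lambda>n. sqrt (\<integral>x. (W j i x)\<^sup>2 \<partial>lborel) * sqrt (B\<^sup>2 * (sqrt (\<integral>x. (Vn n i x - v i x)\<^sup>2 \<partial>lborel) * sqrt (65 * K6))))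
      \<longlonglongrightarrow> sqrt (\<integral>x. (W j i x)\<^sup>2 \<partial>lborel) * sqrt (B\<^sup>2 * (0 * sqrt (65 * K6)))"
    by (intro tendsto_intros tends_L2_sqrt Vn_tends)
  then have "(\<lambda>n. sqrt (\<integral>x. (W j i x)\<^sup>2 \<partial>lborel) * sqrt (B\<^sup>2 * (sqrt (\<integral>x. (Vn n i x - v i x)\<^sup>2 \<partial>lborel) * sqrt (65 * K6))))
      \<longlonglongrightarrow> 0"
    by (simp only: mult_zero_left mult_zero_right real_sqrt_zero)
  then show ?thesis
    by (rule Lim_null_comparison[rotated])
      (intro always_eventually allI, unfold real_norm_def, rule cubic_estimate(2)[OF chi B])
qed

text \<open>The vorticity equation tested with the mollified field times the cutoff. Its terms are
  the dissipation, a boundary term with the derivative on the cutoff, the cubic error and the work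
  of \<open>G\<close>.\<close>

lemma energy_identity:
  assumes chi: "chi \<in> test_functions"
  shows "\<nu> / 2 * (\<Sum>i\<in>UNIV. \<Sum>j\<in>UNIV. \<integral>x. Wn n j i x * W j i x * chi x \<partial>lborel)
    + \<nu> * (\<Sum>i\<in>UNIV. \<Sum>j\<in>UNIV. \<integral>x. Vn n i x * W j i x * partial j chi x \<partial>lborel)
    + (\<Sum>i\<in>UNIV. \<Sum>j\<in>UNIV. \<integral>x. W j i x * (v j x * (Vn n i x - v i x) * chi x) \<partial>lborel)
    + (\<Sum>i\<in>UNIV. \<integral>x. G i x * (Vn n i x * chi x) \<partial>lborel) = 0"
proof -
  let ?\<theta> = "\<lambda>i x. Vn n i x * chi x"
  have V: "smooth (Vn n i)" for i by (rule Vn_smooth)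
  have t: "?\<theta> i \<in> test_functions" for i by (intro test_mult_left chi V)
  obtain B where B: "B \<ge> 0" "\<And>x. \<bar>chi x\<bar> \<le> B" using test_bounded[OF chi] by blast
  have p: "partial j (?\<theta> i) x = Vn n i x * partial j chi x + partial j (Vn n i) x * chi x" for i j x
    using chi V by (intro partial_mult smooth_differentiable) auto
  have tp: "(\<lambda>x. partial j (Vn n i) x * chi x) \<in> test_functions" "(\<lambda>x. Vn n i x * partial j chi x) \<in> test_functions" for i j
    by (intro test_mult_left test_partial chi V smooth_partial)+
  let ?D = "\<lambda>i j k l. \<integral>x. W j i x * (partial k (Vn n l) x * chi x) \<partial>lborel"
  have split: "(\<integral>x. W j i x * partial j (?\<theta> i) x \<partial>lborel) = (\<integral>x. Vn n i x * W j i x * partial j chi x \<partial>lborel) + ?D i j j i" for i j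
  proof -
    have "(\<integral>x. W j i x * partial j (?\<theta> i) x \<partial>lborel)
        = (\<integral>x. W j i x * (Vn n i x * partial j chi x) + W j i x * (partial j (Vn n i) x * chi x) \<partial>lborel)"
      unfolding p distrib_left ..
    also have "\<dots> = (\<integral>x. W j i x * (Vn n i x * partial j chi x) \<partial>lborel) + ?D i j j i"
      by (intro Bochner_Integration.integral_add loc_int_test W_loc_int tp)
    finally show ?thesis by (simp add: mult_ac)
  qed
  \<comment> \<open>Renaming the indices and using the antisymmetry of \<open>W\<close> exchanges
    d_j V_i and d_i V_j up to sign. The viscous sum is therefore half its pairing with the curl of
    V, whence the factor 1/2.\<close>
  have swap: "(\<Sum>i\<in>UNIV. \<Sum>j\<in>UNIV. ?D i j j i) = - (\<Sum>i\<in>UNIV. \<Sum>j\<in>UNIV. ?D i j i j)"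
  proof -
    have "(\<Sum>i\<in>UNIV. \<Sum>j\<in>UNIV. ?D i j j i) = (\<Sum>i\<in>UNIV. \<Sum>j\<in>UNIV. ?D j i i j)"
      by (rule sum.swap)
    also have "\<dots> = (\<Sum>i\<in>UNIV. \<Sum>j\<in>UNIV. - ?D i j i j)"
    proof (intro sum.cong refl)
      fix i j
      have "W i j x * c = - (W j i x * c)" for x c
        using W_antisym[of i j x] by simp
      then show "?D j i i j = - ?D i j i j"
        by (simp only: Bochner_Integration.integral_minus)
    qed
    finally show ?thesis by (simp add: sum_negf)
  qed
  have curl: "?D i j j i - ?D i j i j = (\<integral>x. Wn n j i x * W j i x * chi x \<partial>lborel)" for i j
  proof -
    have "?D i j j i - ?D i j i j = (\<integral>x. W j i x * (partial j (Vn n i) x * chi x) - W j i x * (partial i (Vn n j) x * chi x) \<partial>lborel)"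
      by (intro Bochner_Integration.integral_diff[symmetric] loc_int_test W_loc_int tp)
    also have "\<dots> = (\<integral>x. Wn n j i x * W j i x * chi x \<partial>lborel)"
    proof (rule Bochner_Integration.integral_cong[OF refl])
      fix x
      have "partial j (Vn n i) x - partial i (Vn n j) x = Wn n j i x" by (rule curl_V) simp
      then show "W j i x * (partial j (Vn n i) x * chi x) - W j i x * (partial i (Vn n j) x * chi x) = Wn n j i x * W j i x * chi x"
        by (simp add: algebra_simps flip: \<open>partial j (Vn n i) x - partial i (Vn n j) x = Wn n j i x\<close>)
    qed
    finally show ?thesis .
  qed
  have A: "(\<Sum>i\<in>UNIV. \<Sum>j\<in>UNIV. ?D i j j i) = 1/2 * (\<Sum>i\<in>UNIV. \<Sum>j\<in>UNIV. \<integral>x. Wn n j i x * W j i x * chi x \<partial>lborel)"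
  proof -
    have "(\<Sum>i\<in>UNIV. \<Sum>j\<in>UNIV. \<integral>x. Wn n j i x * W j i x * chi x \<partial>lborel)
        = (\<Sum>i\<in>UNIV. \<Sum>j\<in>UNIV. ?D i j j i) - (\<Sum>i\<in>UNIV. \<Sum>j\<in>UNIV. ?D i j i j)"
      by (simp only: curl[symmetric] sum_subtractf)
    then show ?thesis using swap by linarith
  qed
  \<comment> \<open>The double sum of v_j W_ji v_i vanishes pointwise by antisymmetry. Subtracting
    it replaces V by V - v, the factor that will tend to 0.\<close>
  have C: "(\<Sum>i\<in>UNIV. \<Sum>j\<in>UNIV. \<integral>x. v j x * W j i x * ?\<theta> i x \<partial>lborel)
      = (\<Sum>i\<in>UNIV. \<Sum>j\<in>UNIV. \<integral>x. W j i x * (v j x * (Vn n i x - v i x) * chi x) \<partial>lborel)"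
  proof -
    have "(\<Sum>i\<in>UNIV. \<Sum>j\<in>UNIV. \<integral>x. v j x * W j i x * ?\<theta> i x \<partial>lborel)
      = (\<integral>x. (\<Sum>i\<in>UNIV. \<Sum>j\<in>UNIV. v j x * W j i x * ?\<theta> i x) \<partial>lborel)"
      by (intro integral_double_sum[symmetric] loc_int_test L2_loc_mult_loc_int v_L2_locI W_L2_locI t)
    also have "\<dots> = (\<integral>x. (\<Sum>i\<in>UNIV. \<Sum>j\<in>UNIV. W j i x * (v j x * (Vn n i x - v i x) * chi x)) \<partial>lborel)"
    proof (rule Bochner_Integration.integral_cong[OF refl])
      fix x
      have "(\<Sum>i\<in>UNIV. \<Sum>j\<in>UNIV. v j x * W j i x * v i x) = (\<Sum>i\<in>UNIV. \<Sum>j\<in>UNIV. v i x * W i j x * v j x)"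
        by (rule sum.swap)
      also have "\<dots> = - (\<Sum>i\<in>UNIV. \<Sum>j\<in>UNIV. v j x * W j i x * v i x)"
        unfolding sum_negf[symmetric]
      proof (intro sum.cong refl)
        show "v i x * W i j x * v j x = - (v j x * W j i x * v i x)" for i j
          using W_antisym[of i j x] by simp
      qed
      finally have 0: "(\<Sum>i\<in>UNIV. \<Sum>j\<in>UNIV. v j x * W j i x * v i x) = 0" by linarith
      have "(\<Sum>i\<in>UNIV. \<Sum>j\<in>UNIV. W j i x * (v j x * (Vn n i x - v i x) * chi x))
        = (\<Sum>i\<in>UNIV. \<Sum>j\<in>UNIV. v j x * W j i x * ?\<theta> i x - v j x * W j i x * v i x * chi x)"
        by (intro sum.cong refl) (simp add: algebra_simps)
      also have "\<dots> = (\<Sum>i\<in>UNIV. \<Sum>j\<in>UNIV. v j x * W j i x * ?\<theta> i x) - (\<Sum>i\<in>UNIV. \<Sum>j\<in>UNIV. v j x * W j i x * v i x) * chi x"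
        by (simp only: sum_subtractf sum_distrib_right)
      finally show "(\<Sum>i\<in>UNIV. \<Sum>j\<in>UNIV. v j x * W j i x * ?\<theta> i x) = (\<Sum>i\<in>UNIV. \<Sum>j\<in>UNIV. W j i x * (v j x * (Vn n i x - v i x) * chi x))"
        using 0 by simp
    qed
    also have "\<dots> = (\<Sum>i\<in>UNIV. \<Sum>j\<in>UNIV. \<integral>x. W j i x * (v j x * (Vn n i x - v i x) * chi x) \<partial>lborel)"
      by (intro integral_double_sum cubic_estimate(1)[OF chi B])
    finally show ?thesis .
  qed
  have "0 = (\<Sum>i\<in>UNIV. \<nu> * (\<Sum>j\<in>UNIV. \<integral>x. W j i x * partial j (?\<theta> i) x \<partial>lborel) + (\<Sum>j\<in>UNIV. \<integral>x. v j x * W j i x * ?\<theta> i x \<partial>lborel)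
    + (\<integral>x. G i x * ?\<theta> i x \<partial>lborel))"
    using vorticity_equation[OF t] by simp
  also have "\<dots> = \<nu> * (\<Sum>i\<in>UNIV. \<Sum>j\<in>UNIV. \<integral>x. W j i x * partial j (?\<theta> i) x \<partial>lborel)
    + (\<Sum>i\<in>UNIV. \<Sum>j\<in>UNIV. \<integral>x. v j x * W j i x * ?\<theta> i x \<partial>lborel) + (\<Sum>i\<in>UNIV. \<integral>x. G i x * ?\<theta> i x \<partial>lborel)"
    by (simp only: sum.distrib sum_distrib_left)
  also have "(\<Sum>i\<in>UNIV. \<Sum>j\<in>UNIV. \<integral>x. W j i x * partial j (?\<theta> i) x \<partial>lborel)
    = (\<Sum>i\<in>UNIV. \<Sum>j\<in>UNIV. \<integral>x. Vn n i x * W j i x * partial j chi x \<partial>lborel)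
      + 1/2 * (\<Sum>i\<in>UNIV. \<Sum>j\<in>UNIV. \<integral>x. Wn n j i x * W j i x * chi x \<partial>lborel)"
    by (simp only: split sum.distrib A)
  finally show ?thesis unfolding C by (simp add: distrib_left)
qed

end

subsection \<open>The energy estimate\<close>

text \<open>Young's inequality for the dual exponents 6/5 and 6 with constants 1, for which
  comparing r with s^(1/5) suffices. The parameter l shifts weight onto the factor in L^(6/5); it is
  sent to 0 after the tail of \<open>G\<close> has been removed.\<close>

lemma mult_le_powr_sixth:
  fixes a b l :: real
  assumes "a \<ge> 0" "b \<ge> 0" "l > 0"
  shows "a * b \<le> l powr (- (6/5)) * a powr (6/5) + l ^ 6 * b ^ 6"
proof -
  have young: "s * r \<le> s powr (6/5) + r ^ 6" if "s \<ge> 0" "r \<ge> 0" for s r :: real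
  proof (cases "r \<le> s powr (1/5)")
    case True
    have "s * r \<le> s * s powr (1/5)" using True that by (intro mult_left_mono) auto
    also have "\<dots> = s powr (6/5)"
      using that powr_add[of s 1 "1/5"] by (cases "s = 0") auto
    finally show ?thesis using that by (simp add: add_increasing2)
  next
    case False
    then have "(s powr (1/5)) ^ 5 \<le> r ^ 5" using that by (intro power_mono) auto
    moreover have "(s powr (1/5)) ^ 5 = s"
      using that by (cases "s = 0") (auto simp: powr_powr simp flip: powr_realpow)
    ultimately have "s * r \<le> r ^ 5 * r" using that by (intro mult_right_mono) auto
    also have "\<dots> = r ^ 6" by (simp add: eval_nat_numeral mult_ac)
    finally show ?thesis by (simp add: add_increasing)
  qed
  have "a * b = (a / l) * (l * b)" using assms by simp
  also have "\<dots> \<le> (a / l) powr (6/5) + (l * b) ^ 6" using assms by (intro young) auto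
  also have "\<dots> = l powr (- (6/5)) * a powr (6/5) + l ^ 6 * b ^ 6"
    using assms powr_divide[of a l "6/5"] powr_minus_divide[of l "6/5"] by (simp add: power_mult_distrib)
  finally show ?thesis .
qed

lemma partial_locally_const:
  assumes "open S" "x \<in> S" "\<And>y. y \<in> S \<Longrightarrow> f y = c"
  shows "partial i f x = 0"
proof -
  have "((\<lambda>x. c) has_derivative (\<lambda>h. 0)) (at x)" by simp
  then have "(f has_derivative (\<lambda>h. 0)) (at x)"
    by (rule has_derivative_transform_within_open[OF _ assms(1,2)]) (simp add: assms(3))
  then show ?thesis by (simp add: partial_eqI)
qed

lemma (in bump) cutoff_exists:
  obtains \<eta> where "\<eta> \<in> test_functions" "\<And>x. \<eta> x \<ge> 0" "\<And>x. norm x \<le> 1 \<Longrightarrow> \<eta> x = 1" "\<And>x. norm x > 2 \<Longrightarrow> \<eta> x = 0"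
proof -
  \<comment> \<open>\<open>moll 2\<close> averages over radius 1/2, so the mollified indicator of
    the ball of radius 3/2 is 1 on the unit ball and 0 beyond radius 2.\<close>
  define f :: "real^3 \<Rightarrow> real" where "f = indicator (cball 0 (3/2))"
  have fb: "f \<in> borel_measurable borel" unfolding f_def by (intro borel_measurable_indicator) auto
  have "integrable lborel (f :: real^3 \<Rightarrow> real)"
    unfolding f_def using emeasure_lborel_cball_finite[of "0::real^3" "3/2"] by simp
  then have fl: "loc_int f"
    using integrable_mult_indicator[of "cball 0 _" lborel f] fb by (auto simp: loc_int_def)
  define \<eta> where "\<eta> = conv (moll 2) f"
  have one: "(\<integral>y. moll 2 (x - y) \<partial>lborel) = 1" for x
    using moll_nn_integral(1)[of 2 x] moll_nonneg[of 2] by (simp add: integral_eq_nn_integral)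
  have eq1: "\<eta> x = 1" if "norm x \<le> 1" for x
  proof -
    have "f y * moll 2 (x - y) = moll 2 (x - y)" for y
    proof (cases "norm (x - y) > 1 / 2")
      case False
      then have "norm y \<le> 3/2" using that norm_triangle_ineq4[of x "x - y"] by simp
      then show ?thesis by (simp add: f_def)
    qed (simp add: moll_eq_0)
    then have "\<eta> x = (\<integral>y. moll 2 (x - y) \<partial>lborel)"
      unfolding \<eta>_def conv_def by (intro Bochner_Integration.integral_cong refl)
    then show ?thesis using one by simp
  qed
  have eq0: "\<eta> x = 0" if "norm x > 2" for x
  proof -
    have "f y * moll 2 (x - y) = 0" for y
    proof (cases "norm (x - y) > 1 / 2")
      case False
      then have "norm y > 3/2" using that norm_triangle_ineq[of y "x - y"] by simp
      then show ?thesis by (simp add: f_def)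
    qed (simp add: moll_eq_0)
    then have "(\<lambda>y. f y * moll 2 (x - y)) = (\<lambda>y. 0)" by (simp only: fun_eq_iff simp_thms)
    then show ?thesis by (simp add: \<eta>_def conv_def)
  qed
  show thesis
  proof (rule that[of \<eta>])
    show "\<eta> \<in> test_functions"
      using eq0 fl by (intro testI[of _ 2]) (auto simp: \<eta>_def intro!: smooth_conv moll_test)
    show "\<eta> x \<ge> 0" for x
      unfolding \<eta>_def conv_def f_def using moll_nonneg[of 2]
      by (intro Bochner_Integration.integral_nonneg) auto
  qed (use eq0 eq1 in auto)
qed

section \<open>The stream tensor and the flux of \<open>\<nabla>Q\<close>\<close>

context ns_system begin

text \<open>A divergence-free field in three dimensions is a closed 2-form, for which the homotopy
  operator carries the weight t and a contraction with x. \<open>U\<close> is its integral before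
  the contraction.\<close>

definition U :: "nat \<Rightarrow> 3 \<Rightarrow> real^3 \<Rightarrow> real" where
  "U n i = ray 0 1 1 (Vn n i)"

lemma U_smooth: "smooth (U n i)"
  unfolding U_def by (intro smooth_ray Vn_smooth) auto

text \<open>The homotopy operator of the Poincare lemma exhibits the divergence-free field \<open>V\<close> as the
  divergence of an antisymmetric tensor.\<close>

lemma stream_tensor:
  "(\<Sum>j\<in>UNIV. partial j (\<lambda>x. x $ j * U n i x - x $ i * U n j x) x) = Vn n i x"
proof -
  have pU: "partial j (U n i) x = ray 0 1 2 (partial j (Vn n i)) x" for i j
    unfolding U_def by (subst partial_ray) (simp_all add: Vn_smooth numeral_2_eq_2 del: of_nat_Suc)
  have int: "integrable lborel (\<lambda>t. indicator {0..1} t * t ^ 2 * partial j (Vn n j) (t *\<^sub>R x))" for j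
    by (intro ray_integrable smooth_partial Vn_smooth) auto
  have "(\<Sum>j\<in>UNIV. ray 0 1 2 (partial j (Vn n j)) x)
      = (\<integral>t. (\<Sum>j\<in>UNIV. indicator {0..1} t * t ^ 2 * partial j (Vn n j) (t *\<^sub>R x)) \<partial>lborel)"
    unfolding ray_def using int by (intro Bochner_Integration.integral_sum[symmetric])
  also have "\<dots> = 0"
    by (simp add: div_V flip: sum_distrib_left del: of_nat_Suc)
  finally have div: "(\<Sum>j\<in>UNIV. partial j (U n j) x) = 0" by (simp only: pU)
  have "partial j (\<lambda>x. x $ j * U n i x - x $ i * U n j x) x
      = U n i x + x $ j * partial j (U n i) x - (if i = j then U n j x else 0) - x $ i * partial j (U n j) x" for j
  proof -
    have "partial j (\<lambda>x. x $ j * U n i x - x $ i * U n j x) x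
      = partial j (\<lambda>x. x $ j * U n i x) x - partial j (\<lambda>x. x $ i * U n j x) x"
      by (intro partial_diff smooth_differentiable smooth_mult smooth_nth U_smooth)
    also have "partial j (\<lambda>x. x $ j * U n i x) x = x $ j * partial j (U n i) x + U n i x"
      by (subst partial_mult) (simp_all add: smooth_differentiable U_smooth partial_nth)
    also have "partial j (\<lambda>x. x $ i * U n j x) x = x $ i * partial j (U n j) x + (if i = j then U n j x else 0)"
      by (subst partial_mult) (auto simp: smooth_differentiable U_smooth partial_nth)
    finally show ?thesis by simp
  qed
  then have "(\<Sum>j\<in>UNIV. partial j (\<lambda>x. x $ j * U n i x - x $ i * U n j x) x)
      = 3 * U n i x + (\<Sum>j\<in>UNIV. x $ j * partial j (U n i) x) - U n i x - x $ i * (\<Sum>j\<in>UNIV. partial j (U n j) x)"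
    by (simp add: sum.distrib sum_subtractf sum_distrib_left)
  also have "\<dots> = 2 * U n i x + (\<Sum>j\<in>UNIV. x $ j * ray 0 1 2 (partial j (Vn n i)) x)"
    unfolding div unfolding pU by simp
  also have "\<dots> = Vn n i x"
    using ray_FTC[OF Vn_smooth[of n i], of 0 1 1 x] by (simp add: U_def numeral_2_eq_2)
  finally show ?thesis .
qed

text \<open>Write B for the stream tensor. Antisymmetry of B together with \<open>G_curl\<close>
  makes the sum of the pairings of G_i with d_j (B_ji chi) equal to its own negative. By the product
  rule and \<open>stream_tensor\<close> the work of \<open>G\<close> on V then reduces to the terms
  with the derivative on the cutoff.\<close>

lemma G_flux:
  assumes chi: "chi \<in> test_functions"
  shows "(\<Sum>i\<in>UNIV. \<integral>x. G i x * (Vn n i x * chi x) \<partial>lborel)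
    = - (\<Sum>i\<in>UNIV. \<Sum>j\<in>UNIV. \<integral>x. G i x * ((x $ j * U n i x - x $ i * U n j x) * partial j chi x) \<partial>lborel)"
proof -
  let ?B = "\<lambda>j i x. x $ j * U n i x - x $ i * U n j x"
  have B: "smooth (?B j i)" for i j by (intro smooth_diff smooth_mult smooth_nth U_smooth)
  have t: "(\<lambda>x. ?B j i x * chi x) \<in> test_functions" for i j by (intro test_mult_left chi B)
  let ?I = "\<lambda>i j k l. \<integral>x. G i x * partial j (\<lambda>x. ?B k l x * chi x) x \<partial>lborel"
  have "(\<Sum>i\<in>UNIV. \<Sum>j\<in>UNIV. ?I i j j i) = (\<Sum>i\<in>UNIV. \<Sum>j\<in>UNIV. ?I j i i j)"
    by (rule sum.swap)
  also have "\<dots> = (\<Sum>i\<in>UNIV. \<Sum>j\<in>UNIV. - ?I i j j i)"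
  proof (intro sum.cong refl)
    fix i j
    have "(\<lambda>x. ?B i j x * chi x) = (\<lambda>x. - (?B j i x * chi x))" by (simp add: fun_eq_iff algebra_simps)
    then have "partial i (\<lambda>x. ?B i j x * chi x) = (\<lambda>x. - partial i (\<lambda>x. ?B j i x * chi x) x)"
      using t by (simp only: fun_eq_iff) (auto intro!: partial_uminus smooth_differentiable)
    then have "?I j i i j = - (\<integral>x. G j x * partial i (\<lambda>x. ?B j i x * chi x) x \<partial>lborel)"
      by (simp only: mult_minus_right Bochner_Integration.integral_minus)
    then show "?I j i i j = - ?I i j j i"
      using G_curl[OF t, of i j j i] by simp
  qed
  finally have 0: "(\<Sum>i\<in>UNIV. \<Sum>j\<in>UNIV. ?I i j j i) = 0" by (simp add: sum_negf)
  have tp: "(\<lambda>x. partial j (?B k i) x * chi x) \<in> test_functions" "(\<lambda>x. ?B k i x * partial j chi x) \<in> test_functions" for i j k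
    by (intro test_mult_left test_partial chi B smooth_partial)+
  have "?I i j j i = (\<integral>x. G i x * (?B j i x * partial j chi x) \<partial>lborel) + (\<integral>x. G i x * (partial j (?B j i) x * chi x) \<partial>lborel)" for i j
  proof -
    have "partial j (\<lambda>x. ?B j i x * chi x) x = ?B j i x * partial j chi x + partial j (?B j i) x * chi x" for x
      using chi B by (intro partial_mult smooth_differentiable) auto
    then have "?I i j j i = (\<integral>x. G i x * (?B j i x * partial j chi x) + G i x * (partial j (?B j i) x * chi x) \<partial>lborel)"
      by (simp only: distrib_left)
    also have "\<dots> = (\<integral>x. G i x * (?B j i x * partial j chi x) \<partial>lborel) + (\<integral>x. G i x * (partial j (?B j i) x * chi x) \<partial>lborel)"
      by (intro Bochner_Integration.integral_add loc_int_test G_loc_int tp)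
    finally show ?thesis .
  qed
  then have "(\<Sum>i\<in>UNIV. \<Sum>j\<in>UNIV. \<integral>x. G i x * (?B j i x * partial j chi x) \<partial>lborel)
     + (\<Sum>i\<in>UNIV. \<Sum>j\<in>UNIV. \<integral>x. G i x * (partial j (?B j i) x * chi x) \<partial>lborel) = 0"
    using 0 by (simp only: sum.distrib)
  moreover have "(\<Sum>j\<in>UNIV. \<integral>x. G i x * (partial j (?B j i) x * chi x) \<partial>lborel) = (\<integral>x. G i x * (Vn n i x * chi x) \<partial>lborel)" for i
  proof -
    have "(\<Sum>j\<in>UNIV. \<integral>x. G i x * (partial j (?B j i) x * chi x) \<partial>lborel)
      = (\<integral>x. (\<Sum>j\<in>UNIV. G i x * (partial j (?B j i) x * chi x)) \<partial>lborel)"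
      by (intro Bochner_Integration.integral_sum[symmetric] loc_int_test G_loc_int tp)
    then show ?thesis
      by (simp only: stream_tensor flip: sum_distrib_left sum_distrib_right)
  qed
  ultimately show ?thesis by simp
qed

definition Gtail :: "real \<Rightarrow> 3 \<Rightarrow> real" where
  "Gtail R i = (\<integral>x. indicator {x. R \<le> norm x} x * \<bar>G i x\<bar> powr (6/5) \<partial>lborel)"

text \<open>Young's inequality is applied for each t under the ray integral, before integrating in
  x. The part with \<open>G\<close> does not depend on t, and the sixth power of t V(t x) is reduced
  to that of V by a dilation, uniformly in t and n.\<close>

lemma G_U_estimate:
  assumes l: "l > 0"
  shows "(\<integral>\<^sup>+x. ennreal (indicator {x. R \<le> norm x} x * (\<bar>G i x\<bar> * \<bar>U n k x\<bar>)) \<partial>lborel)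
    \<le> ennreal (l powr (- (6/5)) * Gtail R i + l ^ 6 * K6)"
proof -
  let ?V = "Vn n k" and ?ind = "indicator {x. R \<le> norm x}"
  have [measurable]: "Measurable.pred borel (\<lambda>x :: real^3. x \<in> {x. R \<le> norm x})" by measurable
  have pt: "ennreal (?ind x * (\<bar>G i x\<bar> * \<bar>U n k x\<bar>))
      \<le> ennreal (l powr (- (6/5)) * (?ind x * \<bar>G i x\<bar> powr (6/5)))
        + (\<integral>\<^sup>+t. ennreal (l ^ 6) * indicator {0..1} t * ennreal ((t * ?V (t *\<^sub>R x)) ^ 6) \<partial>lborel)" for x
  proof (cases "R \<le> norm x")
    case True
    have int: "integrable lborel (\<lambda>t. indicator {0..1} t * t ^ 1 * ?V (t *\<^sub>R x))"
      by (intro ray_integrable Vn_smooth) auto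
    have "ennreal (\<bar>G i x\<bar> * \<bar>U n k x\<bar>) = ennreal \<bar>G i x\<bar> * ennreal (norm (\<integral>t. indicator {0..1} t * t ^ 1 * ?V (t *\<^sub>R x) \<partial>lborel))"
      by (simp add: U_def ray_def ennreal_mult)
    also have "\<dots> \<le> ennreal \<bar>G i x\<bar> * (\<integral>\<^sup>+t. ennreal (norm (indicator {0..1} t * t ^ 1 * ?V (t *\<^sub>R x))) \<partial>lborel)"
      by (intro mult_left_mono integral_norm_bound_ennreal[OF int]) auto
    also have "\<dots> = (\<integral>\<^sup>+t. ennreal \<bar>G i x\<bar> * ennreal (norm (indicator {0..1} t * t ^ 1 * ?V (t *\<^sub>R x))) \<partial>lborel)"
      by (rule nn_integral_cmult[symmetric]) measurable
    also have "\<dots> \<le> (\<integral>\<^sup>+t. ennreal (l powr (- (6/5)) * \<bar>G i x\<bar> powr (6/5)) * indicator {0..1} t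
        + ennreal (l ^ 6) * indicator {0..1} t * ennreal ((t * ?V (t *\<^sub>R x)) ^ 6) \<partial>lborel)"
    proof (rule nn_integral_mono)
      fix t :: real
      show "ennreal \<bar>G i x\<bar> * ennreal (norm (indicator {0..1} t * t ^ 1 * ?V (t *\<^sub>R x)))
        \<le> ennreal (l powr (- (6/5)) * \<bar>G i x\<bar> powr (6/5)) * indicator {0..1} t
        + ennreal (l ^ 6) * indicator {0..1} t * ennreal ((t * ?V (t *\<^sub>R x)) ^ 6)"
      proof (cases "t \<in> {0..1}")
        case t: True
        have "\<bar>G i x\<bar> * \<bar>t * ?V (t *\<^sub>R x)\<bar> \<le> l powr (- (6/5)) * \<bar>G i x\<bar> powr (6/5) + l ^ 6 * \<bar>t * ?V (t *\<^sub>R x)\<bar> ^ 6"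
          using l by (intro mult_le_powr_sixth) auto
        then have "ennreal (\<bar>G i x\<bar> * \<bar>t * ?V (t *\<^sub>R x)\<bar>)
            \<le> ennreal (l powr (- (6/5)) * \<bar>G i x\<bar> powr (6/5) + l ^ 6 * (t * ?V (t *\<^sub>R x)) ^ 6)"
          by (intro ennreal_leI) (simp add: power_even_abs del: of_nat_Suc)
        also have "\<dots> = ennreal (l powr (- (6/5)) * \<bar>G i x\<bar> powr (6/5)) + ennreal (l ^ 6) * ennreal ((t * ?V (t *\<^sub>R x)) ^ 6)"
          using l by (subst ennreal_plus) (auto simp: ennreal_mult' simp del: of_nat_Suc)
        finally show ?thesis using t by (simp add: ennreal_mult' del: of_nat_Suc)
      qed simp
    qed
    also have "\<dots> = ennreal (l powr (- (6/5)) * \<bar>G i x\<bar> powr (6/5))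
        + (\<integral>\<^sup>+t. ennreal (l ^ 6) * indicator {0..1} t * ennreal ((t * ?V (t *\<^sub>R x)) ^ 6) \<partial>lborel)"
      by (subst nn_integral_add) (measurable, simp add: nn_integral_cmult_indicator)
    finally show ?thesis using True by simp
  qed simp
  have "(\<integral>\<^sup>+x. ennreal (?ind x * (\<bar>G i x\<bar> * \<bar>U n k x\<bar>)) \<partial>lborel)
      \<le> (\<integral>\<^sup>+x. ennreal (l powr (- (6/5)) * (?ind x * \<bar>G i x\<bar> powr (6/5)))
        + (\<integral>\<^sup>+t. ennreal (l ^ 6) * indicator {0..1} t * ennreal ((t * ?V (t *\<^sub>R x)) ^ 6) \<partial>lborel) \<partial>lborel)"
    by (intro nn_integral_mono pt)
  also have "\<dots> = (\<integral>\<^sup>+x. ennreal (l powr (- (6/5)) * (?ind x * \<bar>G i x\<bar> powr (6/5))) \<partial>lborel)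
        + (\<integral>\<^sup>+x. (\<integral>\<^sup>+t. ennreal (l ^ 6) * indicator {0..1} t * ennreal ((t * ?V (t *\<^sub>R x)) ^ 6) \<partial>lborel) \<partial>lborel)"
    by (rule nn_integral_add) measurable
  also have "(\<integral>\<^sup>+x. ennreal (l powr (- (6/5)) * (?ind x * \<bar>G i x\<bar> powr (6/5))) \<partial>lborel) = ennreal (l powr (- (6/5)) * Gtail R i)"
  proof -
    have "integrable lborel (\<lambda>x. ?ind x * \<bar>G i x\<bar> powr (6/5))"
      using integrable_mult_indicator[OF _ G_int[of i], of "{x. R \<le> norm x}"] by simp
    then show ?thesis
      unfolding Gtail_def by (subst nn_integral_eq_integral) auto
  qed
  also have "(\<integral>\<^sup>+x. (\<integral>\<^sup>+t. ennreal (l ^ 6) * indicator {0..1} t * ennreal ((t * ?V (t *\<^sub>R x)) ^ 6) \<partial>lborel) \<partial>lborel)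
      = (\<integral>\<^sup>+t. (\<integral>\<^sup>+x. ennreal (l ^ 6) * indicator {0..1} t * ennreal ((t * ?V (t *\<^sub>R x)) ^ 6) \<partial>lborel) \<partial>lborel)"
    by (rule lborel_pair.Fubini') measurable
  also have "\<dots> \<le> (\<integral>\<^sup>+t. ennreal (l ^ 6 * K6) * indicator {0..1::real} t \<partial>lborel)"
  proof (rule nn_integral_mono)
    fix t :: real
    show "(\<integral>\<^sup>+x. ennreal (l ^ 6) * indicator {0..1} t * ennreal ((t * ?V (t *\<^sub>R x)) ^ 6) \<partial>lborel) \<le> ennreal (l ^ 6 * K6) * indicator {0..1} t"
    proof (cases "0 < t \<and> t \<le> 1")
      case True
      let ?J = "\<integral>\<^sup>+x. ennreal ((?V (0 + t *\<^sub>R x)) ^ 6) \<partial>lborel"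
      \<comment> \<open>Undoing the dilation costs t^-3, so of t^6 a factor t^3 remains, which is at
        most 1 on (0, 1].\<close>
      have "ennreal (t ^ 6) * ?J = ennreal (t ^ 3) * (ennreal (\<bar>t\<bar> ^ 3) * ?J)"
        using True by (simp add: mult.assoc[symmetric] del: of_nat_Suc flip: ennreal_mult power_add)
      also have "\<dots> = ennreal (t ^ 3) * (\<integral>\<^sup>+x. ennreal ((?V x) ^ 6) \<partial>lborel)"
        using nn_integral_affine3[of "\<lambda>x. ennreal ((?V x) ^ 6)" t 0] True by simp
      also have "\<dots> \<le> ennreal 1 * ennreal K6"
        using True by (intro mult_mono ennreal_leI power_le_one V_L6) auto
      finally have J: "ennreal (t ^ 6) * ?J \<le> ennreal K6" by simp
      have "(\<integral>\<^sup>+x. ennreal (l ^ 6) * indicator {0..1} t * ennreal ((t * ?V (t *\<^sub>R x)) ^ 6) \<partial>lborel)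
          = (\<integral>\<^sup>+x. ennreal (l ^ 6) * (ennreal (t ^ 6) * ennreal ((?V (0 + t *\<^sub>R x)) ^ 6)) \<partial>lborel)"
        using True by (intro nn_integral_cong) (simp add: power_mult_distrib ennreal_mult' del: of_nat_Suc)
      also have "\<dots> = ennreal (l ^ 6) * (ennreal (t ^ 6) * ?J)"
        by (simp add: nn_integral_cmult)
      also have "\<dots> \<le> ennreal (l ^ 6) * ennreal K6" by (intro mult_left_mono J) simp
      finally show ?thesis using True K6_nonneg by (simp add: ennreal_mult')
    qed (auto simp: indicator_def)
  qed
  also have "\<dots> = ennreal (l ^ 6 * K6)" by (simp add: nn_integral_cmult_indicator)
  also have "ennreal (l powr (- (6/5)) * Gtail R i) + ennreal (l ^ 6 * K6) = ennreal (l powr (- (6/5)) * Gtail R i + l ^ 6 * K6)"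
    using K6_nonneg by (intro ennreal_plus[symmetric]) (auto simp: Gtail_def intro!: mult_nonneg_nonneg)
  finally show ?thesis by (simp add: add_left_mono)
qed

end

lemma tail_integral_tendsto_0:
  fixes f :: "real^3 \<Rightarrow> real"
  assumes f: "integrable lborel f"
  shows "(\<lambda>n. \<integral>x. indicator {x. real n \<le> norm x} x * f x \<partial>lborel) \<longlonglongrightarrow> 0"
proof -
  have [measurable]: "f \<in> borel_measurable borel" using f by auto
  have "(\<lambda>n. \<integral>x. indicator {x. real n \<le> norm x} x * f x \<partial>lborel) \<longlonglongrightarrow> (\<integral>x. 0 \<partial>(lborel :: (real^3) measure))"
  proof (rule integral_dominated_convergence[OF _ _ integrable_norm[OF f]])
    show "AE x in lborel. (\<lambda>n. indicator {x. real n \<le> norm x} x * f x) \<longlonglongrightarrow> 0"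
    proof (intro AE_I2 tendsto_eventually)
      fix x :: "real^3"
      obtain N where N: "norm x < real N" using reals_Archimedean2 by blast
      have "indicator {x. real n \<le> norm x} x * f x = 0" if "n \<ge> N" for n
      proof -
        have "norm x < real n" using N that by (meson less_le_trans of_nat_mono)
        then show ?thesis by simp
      qed
      then show "\<forall>\<^sub>F n in sequentially. indicator {x. real n \<le> norm x} x * f x = 0"
        by (auto simp: eventually_sequentially)
    qed
    show "AE x in lborel. norm (indicator {x. real n \<le> norm x} x * f x) \<le> norm (f x)" for n
      by (intro AE_I2) (simp add: indicator_def)
  qed measurable
  then show ?thesis by simp
qed

text \<open>A majorant is all that is asked for: if \<open>f\<close> is not integrable, its Bochner
  integral is 0 and the bound is trivial.\<close>

lemma abs_integral_le_nn:
  fixes f g :: "real^3 \<Rightarrow> real"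
  assumes "\<And>x. \<bar>f x\<bar> \<le> g x" and g: "(\<integral>\<^sup>+x. ennreal (g x) \<partial>lborel) \<le> ennreal c" "c \<ge> 0"
  shows "\<bar>\<integral>x. f x \<partial>lborel\<bar> \<le> c"
proof (cases "integrable lborel f")
  case True
  have "ennreal \<bar>\<integral>x. f x \<partial>lborel\<bar> \<le> (\<integral>\<^sup>+x. ennreal \<bar>f x\<bar> \<partial>lborel)"
    using integral_norm_bound_ennreal[OF True] by simp
  also have "\<dots> \<le> (\<integral>\<^sup>+x. ennreal (g x) \<partial>lborel)"
    by (intro nn_integral_mono ennreal_leI assms)
  also note g(1)
  finally show ?thesis using g(2) by (subst (asm) ennreal_le_iff) auto
qed (use g in \<open>simp add: not_integrable_integral_eq\<close>)

lemma mult_le_squares: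
  fixes a b l :: real
  assumes l: "l > 0"
  shows "a * b \<le> a\<^sup>2 / l + l * b\<^sup>2"
proof -
  have "0 \<le> ((a - l * b)\<^sup>2 + a\<^sup>2 + (l * b)\<^sup>2) / (2 * l)"
    using l by simp
  also have "\<dots> = a\<^sup>2 / l + l * b\<^sup>2 - a * b"
    using l by (simp add: power2_eq_square field_simps)
  finally show ?thesis by simp
qed

context ns_system begin

text \<open>Removal of the mollification at a fixed cutoff. Dissipation and boundary term converge
  as L^2 products, the cubic term tends to 0, and the work of \<open>G\<close> enters through a
  bound uniform in n.\<close>

lemma energy_limit:
  assumes chi: "chi \<in> test_functions"
    and D: "\<And>n. \<bar>\<Sum>i\<in>UNIV. \<integral>x. G i x * (Vn n i x * chi x) \<partial>lborel\<bar> \<le> D"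
  shows "\<nu> / 2 * (\<Sum>i\<in>UNIV. \<Sum>j\<in>UNIV. \<integral>x. W j i x * W j i x * chi x \<partial>lborel)
    \<le> \<nu> * \<bar>\<Sum>i\<in>UNIV. \<Sum>j\<in>UNIV. \<integral>x. v i x * W j i x * partial j chi x \<partial>lborel\<bar> + D"
proof -
  let ?A = "\<Sum>i\<in>UNIV. \<Sum>j\<in>UNIV. \<integral>x. W j i x * W j i x * chi x \<partial>lborel"
    and ?B = "\<Sum>i\<in>UNIV. \<Sum>j\<in>UNIV. \<integral>x. v i x * W j i x * partial j chi x \<partial>lborel"
  let ?a = "\<lambda>n. \<nu> / 2 * (\<Sum>i\<in>UNIV. \<Sum>j\<in>UNIV. \<integral>x. Wn n j i x * W j i x * chi x \<partial>lborel)
    + \<nu> * (\<Sum>i\<in>UNIV. \<Sum>j\<in>UNIV. \<integral>x. Vn n i x * W j i x * partial j chi x \<partial>lborel)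
    + (\<Sum>i\<in>UNIV. \<Sum>j\<in>UNIV. \<integral>x. W j i x * (v j x * (Vn n i x - v i x) * chi x) \<partial>lborel)"
  note L = Vn_tends smooth_L2_loc[OF Vn_smooth] v_L2_locI Wn_tends Wn_L2_locI W_L2_locI tends_L2_const
  have "?a \<longlonglongrightarrow> \<nu> / 2 * ?A + \<nu> * ?B + (\<Sum>i\<in>(UNIV::3 set). \<Sum>j\<in>(UNIV::3 set). 0)"
    by (intro tendsto_intros tends_L2_product L test_partial cubic_tendsto_0 chi)
  then have lim: "(\<lambda>n. \<bar>?a n\<bar>) \<longlonglongrightarrow> \<bar>\<nu> / 2 * ?A + \<nu> * ?B\<bar>"
    using tendsto_rabs by fastforce
  have "\<bar>?a n\<bar> \<le> D" for n
    using energy_identity[OF chi, of n] D[of n] by linarith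
  then have "\<bar>\<nu> / 2 * ?A + \<nu> * ?B\<bar> \<le> D"
    by (intro LIMSEQ_le_const2[OF lim]) auto
  moreover have "\<nu> * \<bar>?B\<bar> = \<bar>\<nu> * ?B\<bar>" using \<nu> by (simp add: abs_mult)
  ultimately show ?thesis by linarith
qed

definition Wtail :: "real \<Rightarrow> 3 \<Rightarrow> 3 \<Rightarrow> real" where
  "Wtail R j i = (\<integral>x. indicator {x. R \<le> norm x} x * (W j i x)\<^sup>2 \<partial>lborel)"

lemma tails_nonneg: "Wtail R j i \<ge> 0" "Gtail R i \<ge> 0"
  by (auto simp: Wtail_def Gtail_def)

lemma K2_nonneg: "K2 \<ge> 0"
  by (simp add: K2_def)

section \<open>Estimates for a cutoff whose gradient lives between radii R and 2R\<close>

context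
  fixes chi :: "real^3 \<Rightarrow> real" and M R :: real
  assumes chi: "chi \<in> test_functions" and R: "R > 0" and M: "M \<ge> 0"
    and grad: "\<And>j x. \<bar>partial j chi x\<bar> \<le> M / R * indicator {x. R \<le> norm x \<and> norm x \<le> 2 * R} x"
begin

text \<open>The factor 1/R of the cutoff gradient is given to \<open>v\<close> in the inequality for
  products. By \<open>v_L2_ball\<close> the energy of \<open>v\<close> on the ball of radius 2R is
  at most 4 K2 R^2, so a constant independent of R remains, multiplied by the free parameter
  l.\<close>

lemma flux_bound:
  assumes l: "l > 0"
  shows "\<bar>\<integral>x. v i x * W j i x * partial j chi x \<partial>lborel\<bar> \<le> M * (Wtail R j i / l + 4 * l * K2)"
proof (rule abs_integral_le_nn)
  let ?g = "\<lambda>x. M / l * (indicator {x. R \<le> norm x} x * (W j i x)\<^sup>2) + M * l / R\<^sup>2 * ((v i x)\<^sup>2 * indicator (cball 0 (2 * R)) x)"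
  show "\<bar>v i x * W j i x * partial j chi x\<bar> \<le> ?g x" for x
  proof (cases "R \<le> norm x \<and> norm x \<le> 2 * R")
    case True
    have young: "\<bar>v i x\<bar> * \<bar>W j i x\<bar> / R \<le> (W j i x)\<^sup>2 / l + l * (v i x)\<^sup>2 / R\<^sup>2"
      using mult_le_squares[OF l, of "\<bar>W j i x\<bar>" "\<bar>v i x\<bar> / R"] by (simp add: power_divide mult.commute)
    have "\<bar>v i x * W j i x * partial j chi x\<bar> \<le> \<bar>v i x\<bar> * \<bar>W j i x\<bar> * (M / R)"
      unfolding abs_mult using grad[of j x] True by (intro mult_left_mono) auto
    also have "\<dots> = M * (\<bar>v i x\<bar> * \<bar>W j i x\<bar> / R)" by simp
    also have "\<dots> \<le> M * ((W j i x)\<^sup>2 / l + l * (v i x)\<^sup>2 / R\<^sup>2)"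
      by (intro mult_left_mono young M)
    finally show ?thesis using True by (simp add: distrib_left)
  next
    case False
    then have "partial j chi x = 0" using grad[of j x] by auto
    then show ?thesis using M l by simp
  qed
  have i: "integrable lborel (\<lambda>x. indicator {x. R \<le> norm x} x * (W j i x)\<^sup>2)"
    using integrable_mult_indicator[OF _ W_L2[of j i], of "{x. R \<le> norm x}"] by simp
  have "(\<integral>\<^sup>+x. ennreal (?g x) \<partial>lborel)
      = (\<integral>\<^sup>+x. ennreal (M / l) * ennreal (indicator {x. R \<le> norm x} x * (W j i x)\<^sup>2)
        + ennreal (M * l / R\<^sup>2) * (ennreal ((v i x)\<^sup>2) * indicator (cball 0 (2 * R)) x) \<partial>lborel)"
  proof (intro nn_integral_cong)
    fix x
    let ?P = "indicator {x. R \<le> norm x} x * (W j i x)\<^sup>2" and ?Q = "(v i x)\<^sup>2 * indicator (cball 0 (2 * R)) x"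
    have "ennreal (?g x) = ennreal (M / l * ?P) + ennreal (M * l / R\<^sup>2 * ?Q)"
      using M l by (intro ennreal_plus) auto
    also have "ennreal (M / l * ?P) = ennreal (M / l) * ennreal ?P"
      using M l by (intro ennreal_mult') auto
    also have "ennreal (M * l / R\<^sup>2 * ?Q) = ennreal (M * l / R\<^sup>2) * ennreal ?Q"
      using M l by (intro ennreal_mult') auto
    also have "ennreal ?Q = ennreal ((v i x)\<^sup>2) * indicator (cball 0 (2 * R)) x"
      by (simp add: ennreal_mult' ennreal_indicator del: indicator_simps)
    finally show "ennreal (?g x) = ennreal (M / l) * ennreal ?P
        + ennreal (M * l / R\<^sup>2) * (ennreal ((v i x)\<^sup>2) * indicator (cball 0 (2 * R)) x)" .
  qed
  also have "\<dots> = ennreal (M / l) * (\<integral>\<^sup>+x. ennreal (indicator {x. R \<le> norm x} x * (W j i x)\<^sup>2) \<partial>lborel)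
      + ennreal (M * l / R\<^sup>2) * (\<integral>\<^sup>+x. ennreal ((v i x)\<^sup>2) * indicator (cball 0 (2 * R)) x \<partial>lborel)"
  proof -
    let ?p = "\<lambda>x. ennreal (indicator {x. R \<le> norm x} x * (W j i x)\<^sup>2)" and ?q = "\<lambda>x. ennreal ((v i x)\<^sup>2) * indicator (cball 0 (2 * R)) x"
    have p: "?p \<in> borel_measurable lborel" and q: "?q \<in> borel_measurable lborel" by measurable
    have "(\<integral>\<^sup>+x. ennreal (M / l) * ?p x + ennreal (M * l / R\<^sup>2) * ?q x \<partial>lborel)
        = (\<integral>\<^sup>+x. ennreal (M / l) * ?p x \<partial>lborel) + (\<integral>\<^sup>+x. ennreal (M * l / R\<^sup>2) * ?q x \<partial>lborel)"
      by (rule nn_integral_add) (use p q in measurable)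
    then show ?thesis by (simp only: nn_integral_cmult[OF p] nn_integral_cmult[OF q])
  qed
  also have "\<dots> \<le> ennreal (M / l) * ennreal (Wtail R j i) + ennreal (M * l / R\<^sup>2) * ennreal (K2 * (2 * R)\<^sup>2)"
    using R i by (intro add_mono mult_left_mono v_L2_ball) (auto simp: Wtail_def nn_integral_eq_integral)
  also have "\<dots> = ennreal (M / l * Wtail R j i + M * l / R\<^sup>2 * (K2 * (2 * R)\<^sup>2))"
    using M l R tails_nonneg K2_nonneg by (simp add: ennreal_mult'' flip: ennreal_mult'' ennreal_plus)
  also have "M / l * Wtail R j i + M * l / R\<^sup>2 * (K2 * (2 * R)\<^sup>2) = M * (Wtail R j i / l + 4 * l * K2)"
    using R by (simp add: distrib_left power_mult_distrib)
  finally show "(\<integral>\<^sup>+x. ennreal (?g x) \<partial>lborel) \<le> ennreal (M * (Wtail R j i / l + 4 * l * K2))" .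
qed (use M l tails_nonneg K2_nonneg in simp)

text \<open>On the annulus |x| is at most 2R, so the linear factor in the tensor cancels the 1/R of
  the cutoff gradient and leaves 2 M. The tensor has two terms, hence 4 M.\<close>

lemma G_flux_bound:
  assumes l: "l > 0"
  shows "\<bar>\<integral>x. G i x * ((x $ j * U n i x - x $ i * U n j x) * partial j chi x) \<partial>lborel\<bar>
    \<le> 4 * M * (l powr (- (6/5)) * Gtail R i + l ^ 6 * K6)"
proof (rule abs_integral_le_nn)
  let ?ind = "indicator {x. R \<le> norm x}"
  let ?h = "\<lambda>k x. ?ind x * (\<bar>G i x\<bar> * \<bar>U n k x\<bar>)"
  let ?g = "\<lambda>x. 2 * M * (?h i x + ?h j x)"
  let ?c = "l powr (- (6/5)) * Gtail R i + l ^ 6 * K6"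
  have c: "?c \<ge> 0" using tails_nonneg K6_nonneg by simp
  have [measurable]: "U n k \<in> borel_measurable borel" for k
    by (intro smooth_borel U_smooth)
  show "\<bar>G i x * ((x $ j * U n i x - x $ i * U n j x) * partial j chi x)\<bar> \<le> ?g x" for x
  proof (cases "R \<le> norm x \<and> norm x \<le> 2 * R")
    case True
    have "\<bar>x $ j * U n i x - x $ i * U n j x\<bar> \<le> \<bar>x $ j\<bar> * \<bar>U n i x\<bar> + \<bar>x $ i\<bar> * \<bar>U n j x\<bar>"
      unfolding abs_mult[symmetric] by (rule abs_triangle_ineq4)
    also have "\<dots> \<le> (2 * R) * \<bar>U n i x\<bar> + (2 * R) * \<bar>U n j x\<bar>"
      using component_le_norm_cart[of x] True by (intro add_mono mult_right_mono) (auto intro: order_trans)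
    finally have B: "\<bar>x $ j * U n i x - x $ i * U n j x\<bar> \<le> (2 * R) * (\<bar>U n i x\<bar> + \<bar>U n j x\<bar>)"
      by (simp only: distrib_left)
    have "\<bar>G i x * ((x $ j * U n i x - x $ i * U n j x) * partial j chi x)\<bar>
        \<le> \<bar>G i x\<bar> * (((2 * R) * (\<bar>U n i x\<bar> + \<bar>U n j x\<bar>)) * (M / R))"
      unfolding abs_mult using B grad[of j x] True R M
      by (intro mult_left_mono mult_mono) (auto simp: abs_mult[symmetric])
    also have "\<dots> = 2 * M * (\<bar>G i x\<bar> * \<bar>U n i x\<bar> + \<bar>G i x\<bar> * \<bar>U n j x\<bar>)"
      using R by (simp add: field_simps)
    finally show ?thesis using True by simp
  next
    case False
    then have "partial j chi x = 0" using grad[of j x] by auto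
    then show ?thesis using M by simp
  qed
  have [measurable]: "Measurable.pred borel (\<lambda>x :: real^3. x \<in> {x. R \<le> norm x})" by measurable
  have "(\<integral>\<^sup>+x. ennreal (?g x) \<partial>lborel) = (\<integral>\<^sup>+x. ennreal (2 * M) * (ennreal (?h i x) + ennreal (?h j x)) \<partial>lborel)"
    using M by (intro nn_integral_cong) (simp add: ennreal_mult' ennreal_plus del: indicator_simps)
  also have "\<dots> = ennreal (2 * M) * ((\<integral>\<^sup>+x. ennreal (?h i x) \<partial>lborel) + (\<integral>\<^sup>+x. ennreal (?h j x) \<partial>lborel))"
  proof -
    have h: "(\<lambda>x. ennreal (?h k x)) \<in> borel_measurable lborel" for k by measurable
    then have "(\<integral>\<^sup>+x. ennreal (2 * M) * (ennreal (?h i x) + ennreal (?h j x)) \<partial>lborel)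
        = ennreal (2 * M) * (\<integral>\<^sup>+x. ennreal (?h i x) + ennreal (?h j x) \<partial>lborel)"
      by (intro nn_integral_cmult borel_measurable_add)
    then show ?thesis by (simp only: nn_integral_add[OF h h])
  qed
  also have "\<dots> \<le> ennreal (2 * M) * (ennreal ?c + ennreal ?c)"
    by (intro mult_left_mono add_mono G_U_estimate l) simp
  also have "ennreal ?c + ennreal ?c = ennreal (2 * ?c)"
    by (simp only: ennreal_plus[OF c c, symmetric] mult_2)
  also have "ennreal (2 * M) * \<dots> = ennreal (2 * M * (2 * ?c))"
    using M by (intro ennreal_mult'[symmetric]) simp
  also have "2 * M * (2 * ?c) = 4 * M * ?c" by simp
  finally show "(\<integral>\<^sup>+x. ennreal (?g x) \<partial>lborel) \<le> ennreal (4 * M * ?c)" .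
  show "0 \<le> 4 * M * ?c" using c M by simp
qed

lemma localized_energy:
  assumes l: "l > 0"
  shows "\<nu> / 2 * (\<Sum>i\<in>UNIV. \<Sum>j\<in>UNIV. \<integral>x. W j i x * W j i x * chi x \<partial>lborel)
    \<le> \<nu> * (\<Sum>i\<in>UNIV. \<Sum>j\<in>UNIV. M * (Wtail R j i / l + 4 * l * K2))
      + (\<Sum>i\<in>UNIV. \<Sum>j\<in>(UNIV::3 set). 4 * M * (l powr (- (6/5)) * Gtail R i + l ^ 6 * K6))"
proof -
  have "\<bar>\<Sum>i\<in>UNIV. \<integral>x. G i x * (Vn n i x * chi x) \<partial>lborel\<bar>
      \<le> (\<Sum>i\<in>UNIV. \<Sum>j\<in>(UNIV::3 set). 4 * M * (l powr (- (6/5)) * Gtail R i + l ^ 6 * K6))" for n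
    unfolding G_flux[OF chi] abs_minus_cancel
    by (intro order_trans[OF sum_abs] sum_mono G_flux_bound l)
  from energy_limit[OF chi this] show ?thesis
  proof (rule order_trans)
    have "\<bar>\<Sum>i\<in>UNIV. \<Sum>j\<in>UNIV. \<integral>x. v i x * W j i x * partial j chi x \<partial>lborel\<bar>
      \<le> (\<Sum>i\<in>UNIV. \<Sum>j\<in>UNIV. M * (Wtail R j i / l + 4 * l * K2))"
      by (intro order_trans[OF sum_abs] sum_mono flux_bound l)
    then show "\<nu> * \<bar>\<Sum>i\<in>UNIV. \<Sum>j\<in>UNIV. \<integral>x. v i x * W j i x * partial j chi x \<partial>lborel\<bar>
        + (\<Sum>i\<in>UNIV. \<Sum>j\<in>(UNIV::3 set). 4 * M * (l powr (- (6/5)) * Gtail R i + l ^ 6 * K6))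
      \<le> \<nu> * (\<Sum>i\<in>UNIV. \<Sum>j\<in>UNIV. M * (Wtail R j i / l + 4 * l * K2))
        + (\<Sum>i\<in>UNIV. \<Sum>j\<in>(UNIV::3 set). 4 * M * (l powr (- (6/5)) * Gtail R i + l ^ 6 * K6))"
      using \<nu> by (intro add_right_mono mult_left_mono) auto
  qed
qed

end

section \<open>Vanishing of the vorticity and of the field\<close>

text \<open>M comes from the unscaled cutoff and is the same for every R. With l fixed, R ->
  infinity removes the tails of \<open>W\<close> and \<open>G\<close>; what is left are multiples of
  l and l^6, which vanish as l -> 0. In the other order the negative powers of l would blow
  up.\<close>

lemma W_square_ball_eq_0:
  assumes r: "r > 0"
  shows "(\<integral>x. indicator (cball 0 r) x * (W j0 i0 x)\<^sup>2 \<partial>lborel) = 0"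
proof -
  obtain \<eta> where \<eta>: "\<eta> \<in> test_functions" "\<And>x. \<eta> x \<ge> 0" "\<And>x. norm x \<le> 1 \<Longrightarrow> \<eta> x = 1" "\<And>x. norm x > 2 \<Longrightarrow> \<eta> x = 0"
    using cutoff_exists by blast
  have "\<exists>B. B \<ge> 0 \<and> (\<forall>x. \<bar>partial j \<eta> x\<bar> \<le> B)" for j
    using test_bounded[OF test_partial[OF \<eta>(1)], of j] by metis
  then obtain B where B: "\<And>j. B j \<ge> 0" "\<And>j x. \<bar>partial j \<eta> x\<bar> \<le> B j" by metis
  define M where "M = (\<Sum>j\<in>UNIV. B j)"
  have M: "M \<ge> 0" "\<bar>partial j \<eta> x\<bar> \<le> M" for j x
  proof -
    show "M \<ge> 0" using B(1) by (simp add: M_def sum_nonneg)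
    have "B j \<le> M" unfolding M_def using B(1) by (intro member_le_sum) auto
    then show "\<bar>partial j \<eta> x\<bar> \<le> M" using B(2)[of j x] by linarith
  qed
  let ?S = "\<integral>x. indicator (cball 0 r) x * (W j0 i0 x)\<^sup>2 \<partial>lborel"
  let ?E = "\<lambda>R l. \<nu> * (\<Sum>i\<in>UNIV. \<Sum>j\<in>UNIV. M * (Wtail R j i / l + 4 * l * K2))
      + (\<Sum>i\<in>UNIV. \<Sum>j\<in>(UNIV::3 set). 4 * M * (l powr (- (6/5)) * Gtail R i + l ^ 6 * K6))"
  have main: "\<nu> / 2 * ?S \<le> ?E R l" if R: "R \<ge> r" and l: "l > 0" for R l
  proof -
    have R0: "R > 0" using R r by simp
    define chi where "chi x = \<eta> ((1 / R) *\<^sub>R x)" for x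
    have chi: "chi \<in> test_functions"
      using test_affine[OF \<eta>(1), of "1 / R" 0] R0 by (simp add: chi_def[abs_def])
    have grad: "\<bar>partial j chi x\<bar> \<le> M / R * indicator {x. R \<le> norm x \<and> norm x \<le> 2 * R} x" for j x
    proof -
      have p: "partial j chi x = 1 / R * partial j \<eta> ((1 / R) *\<^sub>R x)"
        using partial_affine[OF smooth_differentiable[OF test_smooth[OF \<eta>(1)]], where c = "1 / R" and x = x and a = 0 and i = j] by (simp add: chi_def[abs_def])
      consider "R \<le> norm x \<and> norm x \<le> 2 * R" | "norm x < R" | "norm x > 2 * R" by linarith
      then show ?thesis
      proof cases
        case 1
        then show ?thesis using M(2)[of j "(1 / R) *\<^sub>R x"] R0 by (simp add: p abs_mult divide_right_mono)
      next
        case 2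
        have "partial j chi x = 0"
          by (rule partial_locally_const[of "ball 0 R" _ _ 1]) (use 2 R0 in \<open>auto simp: chi_def intro!: \<eta>(3)\<close>)
        then show ?thesis using M(1) R0 by simp
      next
        case 3
        then have "norm ((1 / R) *\<^sub>R x) > 2" using R0 by (simp add: field_simps)
        then have "partial j \<eta> ((1 / R) *\<^sub>R x) = 0" using partial_eq_0[of 2 \<eta>] \<eta>(4) by blast
        then show ?thesis using M(1) R0 by (simp add: p)
      qed
    qed
    have "?S \<le> (\<integral>x. W j0 i0 x * W j0 i0 x * chi x \<partial>lborel)"
    proof (rule integral_mono)
      show "integrable lborel (\<lambda>x. indicator (cball 0 r) x * (W j0 i0 x)\<^sup>2)"
        using W_L2_locI by (simp add: L2_loc_def)
      show "integrable lborel (\<lambda>x. W j0 i0 x * W j0 i0 x * chi x)"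
        by (intro loc_int_test L2_loc_mult_loc_int W_L2_locI chi)
      show "indicator (cball 0 r) x * (W j0 i0 x)\<^sup>2 \<le> W j0 i0 x * W j0 i0 x * chi x" for x
      proof (cases "norm x \<le> r")
        case True
        then have "chi x = 1" unfolding chi_def using R R0 by (intro \<eta>(3)) (simp add: field_simps)
        then show ?thesis using True by (simp add: power2_eq_square)
      next
        case False
        then show ?thesis using \<eta>(2)[of "(1 / R) *\<^sub>R x"] by (simp add: chi_def)
      qed
    qed
    also have "\<dots> \<le> (\<Sum>i\<in>UNIV. \<Sum>j\<in>UNIV. \<integral>x. W j i x * W j i x * chi x \<partial>lborel)"
    proof -
      have nn: "0 \<le> (\<integral>x. W j i x * W j i x * chi x \<partial>lborel)" for i j
        using \<eta>(2) by (intro Bochner_Integration.integral_nonneg) (simp add: chi_def)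
      have "(\<integral>x. W j0 i0 x * W j0 i0 x * chi x \<partial>lborel) \<le> (\<Sum>j\<in>UNIV. \<integral>x. W j i0 x * W j i0 x * chi x \<partial>lborel)"
        using nn by (intro member_le_sum[where f = "\<lambda>j. \<integral>x. W j i0 x * W j i0 x * chi x \<partial>lborel"]) auto
      also have "\<dots> \<le> (\<Sum>i\<in>UNIV. \<Sum>j\<in>UNIV. \<integral>x. W j i x * W j i x * chi x \<partial>lborel)"
        using nn by (intro member_le_sum[where f = "\<lambda>i. \<Sum>j\<in>UNIV. \<integral>x. W j i x * W j i x * chi x \<partial>lborel"]) (auto intro: sum_nonneg)
      finally show ?thesis .
    qed
    finally have "\<nu> / 2 * ?S \<le> \<nu> / 2 * (\<Sum>i\<in>UNIV. \<Sum>j\<in>UNIV. \<integral>x. W j i x * W j i x * chi x \<partial>lborel)"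
      using \<nu> by (intro mult_left_mono) auto
    also have "\<dots> \<le> ?E R l"
      by (rule localized_energy[OF chi R0 M(1) grad l])
    finally show ?thesis .
  qed
  \<comment> \<open>The limit of the right-hand side as R tends to infinity, with both tails
    replaced by 0.\<close>
  define F where "F l = \<nu> * (\<Sum>i\<in>(UNIV::3 set). \<Sum>j\<in>(UNIV::3 set). M * (0 / l + 4 * l * K2))
      + (\<Sum>i\<in>(UNIV::3 set). \<Sum>j\<in>(UNIV::3 set). 4 * M * (l powr (- (6/5)) * 0 + l ^ 6 * K6))" for l
  have le: "\<nu> / 2 * ?S \<le> F l" if l: "l > 0" for l
  proof -
    have W0: "(\<lambda>n. Wtail (real n) j i) \<longlonglongrightarrow> 0" for i j
      unfolding Wtail_def by (rule tail_integral_tendsto_0[OF W_L2])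
    have G0: "(\<lambda>n. Gtail (real n) i) \<longlonglongrightarrow> 0" for i
      unfolding Gtail_def by (rule tail_integral_tendsto_0[OF G_int])
    have "(\<lambda>n. ?E (real n) l) \<longlonglongrightarrow> F l"
      unfolding F_def using l by (intro tendsto_intros W0 G0) auto
    moreover have "\<exists>N. \<forall>n\<ge>N. \<nu> / 2 * ?S \<le> ?E (real n) l"
    proof -
      obtain N where "r \<le> real N" using real_arch_simple by blast
      then show ?thesis using main[OF _ l] by (meson of_nat_mono order_trans)
    qed
    ultimately show ?thesis by (rule LIMSEQ_le_const)
  qed
  have lim4: "((\<lambda>l::real. 4 * l) \<longlongrightarrow> 0) (at_right 0)"
    using tendsto_mult_left[OF tendsto_ident_at[of "0::real" "{0<..}"], of 4] by simp
  have "(F \<longlongrightarrow> \<nu> * (\<Sum>i\<in>(UNIV::3 set). \<Sum>j\<in>(UNIV::3 set). M * (0 + 4 * 0 * K2)) + (\<Sum>i\<in>(UNIV::3 set). \<Sum>j\<in>(UNIV::3 set). 4 * M * (0 + 0 ^ 6 * K6))) (at_right 0)"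
    unfolding F_def mult_zero_right div_0
    by (intro tendsto_intros lim4)
  then have "(F \<longlongrightarrow> 0) (at_right 0)" by simp
  moreover have "\<forall>\<^sub>F l in at_right 0. \<nu> / 2 * ?S \<le> F l"
    using eventually_at_right_less[of "0::real"] by eventually_elim (rule le)
  ultimately have "\<nu> / 2 * ?S \<le> 0"
    by (intro tendsto_lowerbound) auto
  then have "?S \<le> 0" using \<nu> by (simp add: mult_le_0_iff)
  moreover have "?S \<ge> 0" by (intro Bochner_Integration.integral_nonneg) simp
  ultimately show ?thesis by linarith
qed

lemma W_eq_0: "AE x in lborel. W j i x = 0"
proof -
  have "(\<integral>\<^sup>+x. ennreal ((W j i x)\<^sup>2) \<partial>lborel) \<le> 0"
  proof (rule nn_integral_le_of_cball)
    fix n :: nat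
    have "(\<integral>\<^sup>+x. ennreal ((W j i x)\<^sup>2) * indicator (cball 0 (real n)) x \<partial>lborel)
        \<le> (\<integral>\<^sup>+x. ennreal (indicator (cball 0 (real (Suc n))) x * (W j i x)\<^sup>2) \<partial>lborel)"
      by (intro nn_integral_mono) (auto simp: indicator_def)
    also have "\<dots> = ennreal (\<integral>x. indicator (cball 0 (real (Suc n))) x * (W j i x)\<^sup>2 \<partial>lborel)"
      using W_L2_locI[of j i] by (intro nn_integral_eq_integral) (auto simp: L2_loc_def simp del: of_nat_Suc)
    also have "\<dots> = 0" by (subst W_square_ball_eq_0) auto
    finally show "(\<integral>\<^sup>+x. ennreal ((W j i x)\<^sup>2) * indicator (cball 0 (real n)) x \<partial>lborel) \<le> 0" .
  qed simp
  then show ?thesis by (simp add: nn_integral_0_iff_AE)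
qed

text \<open>Without vorticity the averages do not depend on the scale. They equal their limit 0 over
  large balls, while at small scales they converge to \<open>v\<close> in L^2.\<close>

theorem v_eq_0: "AE x in lborel. v i x = 0"
proof -
  have "AE x in lborel. Wabs x = 0"
  proof -
    have "AE x in lborel. \<forall>i\<in>UNIV. \<forall>j\<in>UNIV. W j i x = 0"
      by (intro AE_finite_allI W_eq_0) auto
    then show ?thesis by eventually_elim (simp add: Wabs_def)
  qed
  then have "(\<integral>\<^sup>+x. (Wabs x)\<^sup>2 \<partial>lborel) = (\<integral>\<^sup>+x. 0 \<partial>(lborel :: (real^3) measure))"
    by (intro nn_integral_cong_AE) auto
  \<comment> \<open>Since \<open>wnorm\<close> is at least 1 by construction,
    \<open>spread_le\<close> is invoked directly with N = 0.\<close>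
  then have W0: "(\<integral>\<^sup>+x. (Wabs x)\<^sup>2 \<partial>lborel) \<le> ennreal (0\<^sup>2)" by simp
  have diff: "V a i x = V b i x" if "0 < a" "a \<le> b" for a b x
  proof -
    have "ennreal \<bar>V a i x - V b i x\<bar> \<le> ennreal (2 * sqrt (b * phi_max) * 0)"
      using V_diff[OF that] spread_le[OF Wabs_measurable that order.refl W0] by (rule order_trans)
    then show ?thesis by simp
  qed
  have V0: "V b i x = 0" if b: "b > 0" for b x
  proof -
    have "\<forall>\<^sub>F t in at_right 0. t \<in> {0<..<b}" using b by (rule eventually_at_right_real)
    then have "\<forall>\<^sub>F t in at_right 0. V t i x = V b i x"
      by eventually_elim (rule diff, auto)
    then have "((\<lambda>t. V t i x) \<longlongrightarrow> V b i x) (at_right 0)" by (rule tendsto_eventually)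
    then show ?thesis using V_tendsto_0[of i x] tendsto_unique trivial_limit_at_right_real by blast
  qed
  have "(\<lambda>n. \<integral>\<^sup>+x. ennreal ((V (real (Suc n)) i x - v i x)\<^sup>2) \<partial>lborel) \<longlonglongrightarrow> 0"
    by (rule V_minus_v_tendsto)
  then have "(\<lambda>n::nat. \<integral>\<^sup>+x. ennreal ((v i x)\<^sup>2) \<partial>lborel) \<longlonglongrightarrow> 0"
    by (simp add: V0 del: of_nat_Suc)
  then have "(\<integral>\<^sup>+x. ennreal ((v i x)\<^sup>2) \<partial>lborel) = 0"
    by (simp add: LIMSEQ_const_iff)
  then show ?thesis by (simp add: nn_integral_0_iff_AE)
qed

end

subsection \<open>Passage from distributions to Borel functions\<close>

text \<open>The hypotheses concern Lebesgue measurable functions, whereas the exchanges of integrals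
  and the dilations above are carried out for Borel functions. Passing to a Borel representative
  leaves every pairing with a test function unchanged.\<close>

lemma integral_borel_version:
  fixes f f' g :: "real^3 \<Rightarrow> real"
  assumes "f \<in> borel_measurable lebesgue" "f' \<in> borel_measurable borel" "AE x in lborel. f x = f' x" "g \<in> borel_measurable borel"
  shows "(\<integral>x. f x * g x \<partial>lebesgue) = (\<integral>x. f' x * g x \<partial>lborel)"
proof -
  have [measurable]: "f \<in> borel_measurable lebesgue" "f' \<in> borel_measurable lebesgue" "g \<in> borel_measurable lebesgue"
    using assms by (auto intro: measurable_completion)
  have "AE x in lebesgue. f x * g x = f' x * g x"
    using AE_completion[OF assms(3)] by eventually_elim simp
  then have "(\<integral>x. f x * g x \<partial>lebesgue) = (\<integral>x. f' x * g x \<partial>lebesgue)"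
    by (intro integral_cong_AE) auto
  also have "\<dots> = (\<integral>x. f' x * g x \<partial>lborel)"
    using assms by (intro integral_completion) auto
  finally show ?thesis .
qed

lemma integrable_borel_version:
  fixes f f' :: "real^3 \<Rightarrow> real"
  assumes "integrable lebesgue f" "f' \<in> borel_measurable borel" "AE x in lborel. f x = f' x"
  shows "integrable lborel f'"
proof -
  have "integrable lebesgue f'"
    using assms by (intro integrable_cong_AE_imp[OF assms(1)] measurable_completion)
      (auto intro: AE_completion)
  then show ?thesis using assms by (simp add: integrable_completion)
qed

lemma test_schwartz:
  assumes "f \<in> test_functions"
  shows "f \<in> schwartz_functions"
  unfolding schwartz_functions_def
proof (intro CollectI conjI allI)
  show "smooth f" using assms by auto
  fix k "is"
  obtain R where R: "\<And>x. norm x > R \<Longrightarrow> partials is f x = 0" using test_partials[OF assms] by (auto simp: test_iff)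
  obtain B where B: "B \<ge> 0" "\<And>x. \<bar>partials is f x\<bar> \<le> B" using test_bounded[OF test_partials[OF assms]] by blast
  have "norm ((1 + norm x) ^ k * partials is f x) \<le> (1 + \<bar>R\<bar>) ^ k * B" for x
  proof (cases "norm x > R")
    case False
    then have "(1 + norm x) ^ k * \<bar>partials is f x\<bar> \<le> (1 + \<bar>R\<bar>) ^ k * B"
      by (intro mult_mono power_mono B) auto
    then show ?thesis by (simp add: abs_mult)
  qed (use R B in simp)
  then show "bounded (range (\<lambda>x. (1 + norm x) ^ k * partials is f x))"
    by (auto simp: bounded_iff)
qed

text \<open>Translation preserves the suprema of the derivatives, and on the support of the
  translate 1 + |y| is at most (1 + |R|)(1 + |x|). The seminorm of order N therefore grows at most
  like the N-th power of 1 + |x|.\<close>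

lemma tempered_translate_growth:
  assumes T: "is_tempered T" and K: "K \<in> test_functions"
  shows "\<exists>C N. \<forall>x. \<bar>T (\<lambda>y. K (x - y))\<bar> \<le> C * (1 + norm x) ^ N"
proof -
  obtain S where S: "tempered_distribution S" "\<And>\<phi>. \<phi> \<in> test_functions \<Longrightarrow> S \<phi> = T \<phi>"
    using T by (auto simp: is_tempered_def)
  then obtain C N where CN: "\<And>\<phi>. \<phi> \<in> schwartz_functions \<Longrightarrow>
      \<bar>S \<phi>\<bar> \<le> C * (\<Sum>is\<in>{is. length is \<le> N}. SUP x. (1 + norm x) ^ N * \<bar>partials is \<phi> x\<bar>)"
    unfolding tempered_distribution_def by blast
  have "\<exists>B. B \<ge> 0 \<and> (\<forall>x. \<bar>partials is K x\<bar> \<le> B)" for "is"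
    using test_bounded[OF test_partials[OF K]] by metis
  then obtain B where B: "\<And>is. B is \<ge> 0" "\<And>is x. \<bar>partials is K x\<bar> \<le> B is" by metis
  obtain R where R: "\<And>x. norm x > R \<Longrightarrow> K x = 0" using K by (auto simp: test_iff)
  define A where "A = \<bar>C\<bar> * (\<Sum>is\<in>{is. length is \<le> N}. (1 + \<bar>R\<bar>) ^ N * B is)"
  have "\<bar>T (\<lambda>y. K (x - y))\<bar> \<le> A * (1 + norm x) ^ N" for x
  proof -
    let ?\<phi> = "\<lambda>y. K (x - y)"
    have t: "?\<phi> \<in> test_functions" by (rule test_reflect(1)[OF K])
    have le: "(1 + norm y) ^ N * \<bar>partials is ?\<phi> y\<bar> \<le> (1 + \<bar>R\<bar>) ^ N * B is * (1 + norm x) ^ N" for y "is"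
    proof -
      have "partials is (\<lambda>y. K ((-1) *\<^sub>R y + x)) y = (-1) ^ length is * partials is K ((-1) *\<^sub>R y + x)"
        by (rule partials_affine[OF test_smooth[OF K]])
      then have "partials is ?\<phi> y = (-1) ^ length is * partials is K (x - y)" by simp
      then have p: "\<bar>partials is ?\<phi> y\<bar> = \<bar>partials is K (x - y)\<bar>"
        by (simp add: abs_mult power_abs)
      show ?thesis
      proof (cases "norm (x - y) > R")
        case True
        have "partials is K (x - y) = 0" by (rule partials_eq_0[OF R True])
        then show ?thesis using p B(1)[of "is"] by simp
      next
        case False
        then have "norm y \<le> norm x + \<bar>R\<bar>" using norm_triangle_ineq4[of x "x - y"] by simp
        moreover have "0 \<le> \<bar>R\<bar> * norm x" by simp
        ultimately have "1 + norm y \<le> 1 + \<bar>R\<bar> + norm x + \<bar>R\<bar> * norm x" by linarith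
        then have "1 + norm y \<le> (1 + \<bar>R\<bar>) * (1 + norm x)"
          by (simp add: algebra_simps)
        then have "(1 + norm y) ^ N \<le> ((1 + \<bar>R\<bar>) * (1 + norm x)) ^ N" by (intro power_mono) auto
        then have "(1 + norm y) ^ N * \<bar>partials is ?\<phi> y\<bar> \<le> ((1 + \<bar>R\<bar>) * (1 + norm x)) ^ N * B is"
          unfolding p by (intro mult_mono B) auto
        then show ?thesis by (simp add: power_mult_distrib mult_ac)
      qed
    qed
    \<comment> \<open>The sign of C is unknown, and replacing it by |C| requires nonnegative
      suprema. The bound \<open>le\<close> ensures that these suprema are taken over bounded
      sets.\<close>
    have nn: "0 \<le> (SUP y. (1 + norm y) ^ N * \<bar>partials is ?\<phi> y\<bar>)" for "is"
      by (rule cSUP_upper2[of _ _ 0]) (use le in \<open>auto intro!: bdd_aboveI2\<close>)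
    have "\<bar>T ?\<phi>\<bar> = \<bar>S ?\<phi>\<bar>" using S(2)[OF t] by simp
    also have "\<dots> \<le> C * (\<Sum>is\<in>{is. length is \<le> N}. SUP y. (1 + norm y) ^ N * \<bar>partials is ?\<phi> y\<bar>)"
      by (rule CN[OF test_schwartz[OF t]])
    also have "\<dots> \<le> \<bar>C\<bar> * (\<Sum>is\<in>{is. length is \<le> N}. SUP y. (1 + norm y) ^ N * \<bar>partials is ?\<phi> y\<bar>)"
      by (intro mult_right_mono sum_nonneg nn) auto
    also have "\<dots> \<le> \<bar>C\<bar> * (\<Sum>is\<in>{is. length is \<le> N}. (1 + \<bar>R\<bar>) ^ N * B is * (1 + norm x) ^ N)"
      by (intro mult_left_mono sum_mono cSUP_least le) auto
    also have "\<dots> = A * (1 + norm x) ^ N" by (simp add: A_def sum_distrib_right mult.assoc)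
    finally show ?thesis .
  qed
  then show ?thesis by blast
qed

theorem corollary1p15:
  fixes \<nu> :: real and v :: "real^3 \<Rightarrow> real^3" and p :: functional
  assumes "\<nu> > 0"
    and "in_Lp_loc 2 v"
    and "distribution p"
    and "stationary_navier_stokes \<nu> v p"
    and "\<forall>i. is_tempered (vdist_of v $ i)"
    and "\<forall>s>0. emeasure lebesgue {x. norm (v x) > s} < \<infinity>"
    and "vdist_in_Lp 2 (dist_curl (vdist_of v))"
    and "vdist_in_Lp (6/5) (dist_grad (bernoulli_head_pressure v p))"
  shows "AE x in lebesgue. v x = 0"
proof -
  obtain phi psi where bump: "bump phi psi" using bump_exists by blast
  obtain \<omega> where \<omega>: "in_Lp 2 \<omega>" and curl: "\<And>i \<theta>. \<theta> \<in> test_functions \<Longrightarrow> (dist_curl (vdist_of v) $ i) \<theta> = (vdist_of \<omega> $ i) \<theta>"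
    using assms(7) unfolding vdist_in_Lp_def by blast
  obtain g where g: "in_Lp (6/5) g" and head: "\<And>i \<theta>. \<theta> \<in> test_functions \<Longrightarrow>
      (dist_grad (bernoulli_head_pressure v p) $ i) \<theta> = (vdist_of g $ i) \<theta>"
    using assms(8) unfolding vdist_in_Lp_def by blast
  have vm [measurable]: "v \<in> borel_measurable lebesgue" and \<omega>m [measurable]: "\<omega> \<in> borel_measurable lebesgue"
    and gm [measurable]: "g \<in> borel_measurable lebesgue"
    using assms(2) \<omega> g by (auto simp: in_Lp_loc_def in_Lp_def)
  have comp: "(\<lambda>x. f x $ i) \<in> borel_measurable lebesgue" if "f \<in> borel_measurable lebesgue" for f :: "real^3 \<Rightarrow> real^3" and i
    using borel_measurable_continuous_onI[of "\<lambda>x :: real^3. x $ i"] that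
    by (auto intro!: continuous_intros measurable_compose[OF that])
  have ex: "\<exists>f'. \<forall>i. f' i \<in> borel_measurable borel \<and> (AE x in lborel. f x $ i = f' i x)"
    if "f \<in> borel_measurable lebesgue" for f :: "real^3 \<Rightarrow> real^3"
  proof -
    have "\<forall>i. \<exists>h. h \<in> borel_measurable borel \<and> (AE x in lborel. f x $ i = h x)"
      using completion_ex_borel_measurable_real[OF comp[OF that]] by auto
    then show ?thesis by (rule choice)
  qed
  obtain v' where v': "\<And>i. v' i \<in> borel_measurable borel" "\<And>i. AE x in lborel. v x $ i = v' i x"
    using ex[OF vm] by blast
  obtain \<omega>' where \<omega>': "\<And>i. \<omega>' i \<in> borel_measurable borel" "\<And>i. AE x in lborel. \<omega> x $ i = \<omega>' i x"
    using ex[OF \<omega>m] by blast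
  obtain g' where g': "\<And>i. g' i \<in> borel_measurable borel" "\<And>i. AE x in lborel. g x $ i = g' i x"
    using ex[OF gm] by blast
  have dv: "dist_of (\<lambda>x. v x $ i) \<theta> = (\<integral>x. v' i x * \<theta> x \<partial>lborel)" if "\<theta> \<in> test_functions" for i \<theta>
    unfolding dist_of_def
    by (rule integral_borel_version[OF comp[OF vm] v'(1) v'(2) smooth_borel[OF test_smooth[OF that]]])
  have d\<omega>: "dist_of (\<lambda>x. \<omega> x $ i) \<theta> = (\<integral>x. \<omega>' i x * \<theta> x \<partial>lborel)" if "\<theta> \<in> test_functions" for i \<theta>
    unfolding dist_of_def
    by (rule integral_borel_version[OF comp[OF \<omega>m] \<omega>'(1) \<omega>'(2) smooth_borel[OF test_smooth[OF that]]])
  have dg: "dist_of (\<lambda>x. g x $ i) \<theta> = (\<integral>x. g' i x * \<theta> x \<partial>lborel)" if "\<theta> \<in> test_functions" for i \<theta>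
    unfolding dist_of_def
    by (rule integral_borel_version[OF comp[OF gm] g'(1) g'(2) smooth_borel[OF test_smooth[OF that]]])
  have dvv: "dist_of (\<lambda>x. v x $ j * v x $ i) \<theta> = (\<integral>x. v' j x * v' i x * \<theta> x \<partial>lborel)" if "\<theta> \<in> test_functions" for i j \<theta>
    unfolding dist_of_def
  proof (rule integral_borel_version[OF borel_measurable_times[OF comp[OF vm] comp[OF vm]]
        borel_measurable_times[OF v'(1) v'(1)] _ smooth_borel[OF test_smooth[OF that]]])
    show "AE x in lborel. v x $ j * v x $ i = v' j x * v' i x"
      using v'(2)[of i] v'(2)[of j] by eventually_elim simp
  qed
  \<comment> \<open>The antisymmetric matrix of the curl vector: the entry (1, 2) is d_1 v_2 - d_2
    v_1, the third component, and the others follow cyclically.\<close>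
  define W where "W j i x = (if j = 1 \<and> i = 2 then \<omega>' 3 x else if j = 2 \<and> i = 1 then - \<omega>' 3 x
    else if j = 2 \<and> i = 3 then \<omega>' 1 x else if j = 3 \<and> i = 2 then - \<omega>' 1 x
    else if j = 3 \<and> i = 1 then \<omega>' 2 x else if j = 1 \<and> i = 3 then - \<omega>' 2 x else 0)" for j i :: 3 and x
  have sq_powr: "(a $ i)\<^sup>2 \<le> norm a powr 2" for a :: "real^3" and i
  proof -
    have "(a $ i)\<^sup>2 \<le> (norm a)\<^sup>2"
      using power_mono[OF component_le_norm_cart[of a i], of 2] by simp
    then show ?thesis by (cases "a = 0") (simp_all add: powr_numeral)
  qed
  have v'_L2: "integrable lborel (\<lambda>x. indicator (cball 0 R) x * (v' i x)\<^sup>2)" for R i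
  proof (rule integrable_borel_version)
    have "integrable lebesgue (\<lambda>x. indicator (cball 0 R) x *\<^sub>R (norm (v x) powr 2))"
      using assms(2) by (auto simp: in_Lp_loc_def set_integrable_def)
    then show "integrable lebesgue (\<lambda>x. indicator (cball 0 R) x * (v x $ i)\<^sup>2)"
    proof (rule Bochner_Integration.integrable_bound)
      show "(\<lambda>x. indicator (cball 0 R) x * (v x $ i)\<^sup>2) \<in> borel_measurable lebesgue"
        by (intro borel_measurable_times borel_measurable_power comp vm borel_measurable_indicator) auto
      show "AE x in lebesgue. norm (indicator (cball 0 R) x * (v x $ i)\<^sup>2) \<le> norm (indicator (cball 0 R) x *\<^sub>R (norm (v x) powr 2))"
        using sq_powr by (intro AE_I2) (auto simp: indicator_def)
    qed
    show "(\<lambda>x. indicator (cball 0 R) x * (v' i x)\<^sup>2) \<in> borel_measurable borel"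
      by (intro borel_measurable_times borel_measurable_power v' borel_measurable_indicator) auto
    show "AE x in lborel. indicator (cball 0 R) x * (v x $ i)\<^sup>2 = indicator (cball 0 R) x * (v' i x)\<^sup>2"
      using v'(2)[of i] by eventually_elim simp
  qed
  have \<omega>'_L2: "integrable lborel (\<lambda>x. (\<omega>' i x)\<^sup>2)" for i
  proof (rule integrable_borel_version)
    have "integrable lebesgue (\<lambda>x. norm (\<omega> x) powr 2)" using \<omega> by (auto simp: in_Lp_def)
    then show "integrable lebesgue (\<lambda>x. (\<omega> x $ i)\<^sup>2)"
      by (rule Bochner_Integration.integrable_bound)
        (use sq_powr comp[OF \<omega>m] in \<open>auto intro!: AE_I2\<close>)
    show "(\<lambda>x. (\<omega>' i x)\<^sup>2) \<in> borel_measurable borel" by (intro borel_measurable_power \<omega>')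
    show "AE x in lborel. (\<omega> x $ i)\<^sup>2 = (\<omega>' i x)\<^sup>2"
      using \<omega>'(2)[of i] by eventually_elim simp
  qed
  have g'_int: "integrable lborel (\<lambda>x. \<bar>g' i x\<bar> powr (6/5))" for i
  proof (rule integrable_borel_version)
    have "integrable lebesgue (\<lambda>x. norm (g x) powr (6/5))" using g by (auto simp: in_Lp_def)
    then show "integrable lebesgue (\<lambda>x. \<bar>g x $ i\<bar> powr (6/5))"
    proof (rule Bochner_Integration.integrable_bound)
      show "(\<lambda>x. \<bar>g x $ i\<bar> powr (6/5)) \<in> borel_measurable lebesgue"
        using comp[OF gm, of i] by measurable
      show "AE x in lebesgue. norm (\<bar>g x $ i\<bar> powr (6/5)) \<le> norm (norm (g x) powr (6/5))"
        by (intro AE_I2) (simp add: powr_mono2 component_le_norm_cart)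
    qed
    show "(\<lambda>x. \<bar>g' i x\<bar> powr (6/5)) \<in> borel_measurable borel" using g'(1)[of i] by measurable
    show "AE x in lborel. \<bar>g x $ i\<bar> powr (6/5) = \<bar>g' i x\<bar> powr (6/5)"
      using g'(2)[of i] by eventually_elim simp
  qed
  have v'_loc: "loc_int (v' i)" for i
    using v'(1) v'_L2 by (rule square_int_loc_int)
  have "curl_system_axioms v' W"
  proof
    show "v' i \<in> borel_measurable borel" for i by (rule v')
    show "integrable lborel (\<lambda>x. indicator (cball 0 R) x * (v' i x)\<^sup>2)" for R i by (rule v'_L2)
    show "W j i \<in> borel_measurable borel" for j i
      using exhaust_3[of i] exhaust_3[of j] by (elim disjE; simp add: W_def[abs_def] \<omega>'(1))
    show "integrable lborel (\<lambda>x. (W j i x)\<^sup>2)" for j i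
      using exhaust_3[of i] exhaust_3[of j] by (elim disjE; simp add: W_def \<omega>'_L2)
    show "W i j x = - W j i x" for i j x
      using exhaust_3[of i] exhaust_3[of j] by (elim disjE; simp add: W_def)
    show "(\<Sum>j\<in>UNIV. \<integral>x. v' j x * partial j \<theta> x \<partial>lborel) = 0" if "\<theta> \<in> test_functions" for \<theta>
    proof -
      have "dist_div (vdist_of v) \<theta> = 0"
        using assms(4) that by (auto simp: stationary_navier_stokes_def)
      then show ?thesis
        using that by (simp add: dist_div_def dist_partial_def vdist_of_def dv test_partial sum_negf)
    qed
    show "(\<integral>x. v' i x * partial j \<theta> x \<partial>lborel) - (\<integral>x. v' j x * partial i \<theta> x \<partial>lborel) = - (\<integral>x. W j i x * \<theta> x \<partial>lborel)"
      if \<theta>: "\<theta> \<in> test_functions" for \<theta> i j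
    proof -
      have c: "(dist_curl (vdist_of v) $ k) \<theta> = (\<integral>x. \<omega>' k x * \<theta> x \<partial>lborel)" for k
        using curl[OF \<theta>, of k] by (simp add: vdist_of_def d\<omega> \<theta>)
      have p: "dist_partial k (vdist_of v $ l) \<theta> = - (\<integral>x. v' l x * partial k \<theta> x \<partial>lborel)" for k l
        using dv[OF test_partial[OF \<theta>]] by (simp add: dist_partial_def vdist_of_def)
      have E: "(\<integral>x. v' 2 x * partial 3 \<theta> x \<partial>lborel) - (\<integral>x. v' 3 x * partial 2 \<theta> x \<partial>lborel) = (\<integral>x. \<omega>' 1 x * \<theta> x \<partial>lborel)"
        "(\<integral>x. v' 3 x * partial 1 \<theta> x \<partial>lborel) - (\<integral>x. v' 1 x * partial 3 \<theta> x \<partial>lborel) = (\<integral>x. \<omega>' 2 x * \<theta> x \<partial>lborel)"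
        "(\<integral>x. v' 1 x * partial 2 \<theta> x \<partial>lborel) - (\<integral>x. v' 2 x * partial 1 \<theta> x \<partial>lborel) = (\<integral>x. \<omega>' 3 x * \<theta> x \<partial>lborel)"
        using c[of 1] c[of 2] c[of 3] by (simp_all add: dist_curl_def p)
      show ?thesis
        using exhaust_3[of i] exhaust_3[of j] by (elim disjE; simp add: W_def; insert E; linarith)
    qed
  qed
  with bump have cs: "curl_system phi psi v' W" by (rule curl_system.intro)
  interpret C: curl_system phi psi v' W by (rule cs)
  have "decaying_curl_system_axioms phi v'"
  proof
    fix s :: real and i assume s: "s > 0"
    have [measurable]: "v' i \<in> borel_measurable borel" by (rule v')
    have "{x \<in> space lborel. \<bar>v' i x\<bar> > s} \<in> sets lborel" by measurable
    then have "emeasure lborel {x. \<bar>v' i x\<bar> > s} = emeasure lebesgue {x. \<bar>v' i x\<bar> > s}" by simp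
    also have "\<dots> \<le> emeasure lebesgue {x. norm (v x) > s}"
    proof (rule emeasure_mono_AE)
      show "AE x in lebesgue. x \<in> {x. \<bar>v' i x\<bar> > s} \<longrightarrow> x \<in> {x. norm (v x) > s}"
        using AE_completion[OF v'(2)[of i]]
      proof eventually_elim
        case (elim x)
        then show ?case using component_le_norm_cart[of "v x" i] by auto
      qed
      have "{x \<in> space lebesgue. norm (v x) > s} \<in> sets lebesgue" by measurable
      then show "{x. norm (v x) > s} \<in> sets lebesgue" by simp
    qed
    also have "\<dots> < \<infinity>" using assms(6) s by blast
    finally show "emeasure lborel {x. \<bar>v' i x\<bar> > s} < \<infinity>" .
  next
    fix i
    have m: "C.moll 1 \<in> test_functions" by (rule C.moll_test) simp
    obtain C N where "\<And>x. \<bar>(vdist_of v $ i) (\<lambda>y. C.moll 1 (x - y))\<bar> \<le> C * (1 + norm x) ^ N"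
      using tempered_translate_growth[OF assms(5)[rule_format] m] by blast
    moreover have "(vdist_of v $ i) (\<lambda>y. C.moll 1 (x - y)) = C.V 1 i x" for x
      using dv[OF test_reflect(1)[OF m]] by (simp add: vdist_of_def C.V_def conv_def)
    ultimately show "\<exists>C N. \<forall>x. \<bar>C.V 1 i x\<bar> \<le> C * (1 + norm x) ^ N" by auto
  qed
  with cs have ds: "decaying_curl_system phi psi v' W" by (rule decaying_curl_system.intro)
  \<comment> \<open>Testing with \<open>partial i \<theta>\<close> expresses the pressure through
    \<open>g'\<close> and the kinetic part of Q, which eliminates \<open>p\<close> from the momentum
    equation.\<close>
  have head': "p (partial i \<theta>) + 1/2 * (\<Sum>j\<in>UNIV. \<integral>x. v' j x * v' j x * partial i \<theta> x \<partial>lborel) = - (\<integral>x. g' i x * \<theta> x \<partial>lborel)"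
    if \<theta>: "\<theta> \<in> test_functions" for i \<theta>
  proof -
    have "dist_of (\<lambda>x. 1/2 * (norm (v x))\<^sup>2) (partial i \<theta>) = (\<integral>x. (1/2 * (\<Sum>j\<in>UNIV. v' j x * v' j x)) * partial i \<theta> x \<partial>lborel)"
      unfolding dist_of_def
    proof (rule integral_borel_version[OF _ _ _ smooth_borel[OF test_smooth[OF test_partial[OF \<theta>]]]])
      show "(\<lambda>x. 1/2 * (norm (v x))\<^sup>2) \<in> borel_measurable lebesgue" by measurable
      show "(\<lambda>x. 1/2 * (\<Sum>j\<in>UNIV. v' j x * v' j x)) \<in> borel_measurable borel"
        by (intro borel_measurable_times borel_measurable_sum borel_measurable_const v')
      have "AE x in lborel. \<forall>j\<in>UNIV. v x $ j = v' j x"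
        by (intro AE_finite_allI v') auto
      then show "AE x in lborel. 1/2 * (norm (v x))\<^sup>2 = 1/2 * (\<Sum>j\<in>UNIV. v' j x * v' j x)"
        by eventually_elim (simp add: power2_norm_eq_inner inner_vec_def)
    qed
    also have "\<dots> = 1/2 * (\<integral>x. (\<Sum>j\<in>UNIV. v' j x * v' j x * partial i \<theta> x) \<partial>lborel)"
      by (simp only: mult.assoc sum_distrib_right Bochner_Integration.integral_mult_right_zero)
    also have "\<dots> = 1/2 * (\<Sum>j\<in>UNIV. \<integral>x. v' j x * v' j x * partial i \<theta> x \<partial>lborel)"
    proof -
      have "L2_loc (v' j)" for j using v' v'_L2 by (simp add: L2_loc_def)
      then have "integrable lborel (\<lambda>x. v' j x * v' j x * partial i \<theta> x)" for j
        using \<theta> by (intro loc_int_test L2_loc_mult_loc_int test_partial)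
      then show ?thesis by (subst Bochner_Integration.integral_sum) auto
    qed
    finally show ?thesis
      using head[OF \<theta>, of i] dg[OF \<theta>, of i]
      by (simp add: dist_grad_def dist_partial_def bernoulli_head_pressure_def vdist_of_def)
  qed
  have "ns_system_axioms v' \<nu> g'"
  proof
    show "\<nu> > 0" by fact
    show "g' i \<in> borel_measurable borel" for i by (rule g')
    show "integrable lborel (\<lambda>x. \<bar>g' i x\<bar> powr (6/5))" for i by (rule g'_int)
    \<comment> \<open>Both sides are minus Q applied to a mixed second derivative of \<theta>, and
      the order of differentiation is immaterial.\<close>
    show "(\<integral>x. g' i x * partial j \<theta> x \<partial>lborel) = (\<integral>x. g' j x * partial i \<theta> x \<partial>lborel)"
      if \<theta>: "\<theta> \<in> test_functions" for i j \<theta>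
    proof -
      have "partial i (partial j \<theta>) = partial j (partial i \<theta>)"
        using \<theta> by (intro ext partial_commute) auto
      then have "(dist_grad (bernoulli_head_pressure v p) $ i) (partial j \<theta>) = (dist_grad (bernoulli_head_pressure v p) $ j) (partial i \<theta>)"
        by (simp add: dist_grad_def dist_partial_def)
      then show ?thesis
        using head[OF test_partial[OF \<theta>]] dg[OF test_partial[OF \<theta>]] by (simp add: vdist_of_def)
    qed
    show "- \<nu> * (\<integral>x. v' i x * (\<Sum>j\<in>UNIV. partial j (partial j \<theta>) x) \<partial>lborel)
      - (\<Sum>j\<in>UNIV. \<integral>x. v' j x * v' i x * partial j \<theta> x \<partial>lborel)
      + 1/2 * (\<Sum>j\<in>UNIV. \<integral>x. v' j x * v' j x * partial i \<theta> x \<partial>lborel)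
      + (\<integral>x. g' i x * \<theta> x \<partial>lborel) = 0" if \<theta>: "\<theta> \<in> test_functions" for i \<theta>
    proof -
      have lap: "dist_laplacian (vdist_of v $ i) \<theta> = (\<integral>x. v' i x * (\<Sum>j\<in>UNIV. partial j (partial j \<theta>) x) \<partial>lborel)"
      proof -
        have "(\<integral>x. v' i x * (\<Sum>j\<in>UNIV. partial j (partial j \<theta>) x) \<partial>lborel) = (\<Sum>j\<in>UNIV. \<integral>x. v' i x * partial j (partial j \<theta>) x \<partial>lborel)"
          unfolding sum_distrib_left using \<theta>
          by (intro Bochner_Integration.integral_sum loc_int_test v'_loc test_partial)
        then show ?thesis
          using dv[OF test_partial[OF test_partial[OF \<theta>]]]
          by (simp add: dist_laplacian_def dist_partial_def vdist_of_def)
      qed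
      have conv: "dist_partial j (dist_of (\<lambda>x. v x $ j * v x $ i)) \<theta> = - (\<integral>x. v' j x * v' i x * partial j \<theta> x \<partial>lborel)" for j
        using dvv[OF test_partial[OF \<theta>]] by (simp add: dist_partial_def)
      have "- \<nu> * dist_laplacian (vdist_of v $ i) \<theta>
        + (\<Sum>j\<in>UNIV. dist_partial j (dist_of (\<lambda>x. v x $ j * v x $ i)) \<theta>) + (dist_grad p $ i) \<theta> = 0"
        using assms(4) \<theta> unfolding stationary_navier_stokes_def by blast
      moreover have "(dist_grad p $ i) \<theta> = - p (partial i \<theta>)"
        by (simp add: dist_grad_def dist_partial_def)
      ultimately show ?thesis
        unfolding lap conv using head'[OF \<theta>, of i] by (simp add: sum_negf)
    qed
  qed
  with ds have "ns_system phi psi v' W \<nu> g'" by (rule ns_system.intro)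
  then have "AE x in lborel. v' i x = 0" for i by (rule ns_system.v_eq_0)
  then have "AE x in lborel. \<forall>i\<in>UNIV. v' i x = 0 \<and> v x $ i = v' i x"
    using v'(2) by (intro AE_finite_allI) auto
  then have "AE x in lborel. v x = 0"
    by eventually_elim (simp add: vec_eq_iff)
  then show ?thesis by (rule AE_completion)
qed

end
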